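(* Let $(X,\mathcal{X})$ be a stable measurable space and $\mu$ a stable probability measure on $(X,\mathcal{X})$. If $\nu$ is a stable probability measure on $(X,\mathcal{X})$ which is absolutely continuous relative to $\mu$, then there exists a stable integrable (with respect to $\mu$) function $f:X\to L^0$ such that $$\nu(V|A)=\int_X1_{V|A}f\,d\mu$$ for all $V|A\in\mathcal{X}$.
   Context: $(\Omega,\mathscr{F},\mathbb{P})$ is a complete probability space; $A,B\in\mathscr{F}$ are identified if $\mathbb{P}(A\Delta B)=0$, and inclusions and (in)equalities between (extended) random variables are understood a.s. $L^0$, $L^0_+$, $\bar L^0_+$ are the sets of measurable functions on $\Omega$ with values in $\mathbb{R}$, $[0,\infty)$, $[0,\infty]$; $L^0_{++}=\{x\in L^0:x>0\}$. The supremum of a family in $\mathscr{F}$ is its essential supremum. A partition (of $\Omega$) is a countable pairwise disjoint family $(A_k)$ in $\mathscr{F}$ with union $\Omega$. For a function $x$ on $\Omega$ and $A\in\mathscr{F}$, $x|A$ is the restriction to $A$; $x|A$ and $y|B$ are identified if $\mathbb{P}(A\Delta B)=0$ and $x=y$ a.e. on $A\cap B$. $\sum x_k|A_k$ is the function equal to $x_k$ on $A_k$ for each $k$ (so $r|A+0|A^c$ equals $r$ on $A$ and $0$ on $A^c$). For a set $X$ of functions on $\Omega$, $X|A:=\{x|A: x\in X\}$, $(X|A)|B:=X|A\cap B$, $X|\emptyset=\{\ast\}$, $X|\Omega=X$. A set $X$ of functions on $\Omega$ with values in a fixed set is stable if $X\neq\emptyset$ and $\sum x_k|A_k\in X$ for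 all partitions $(A_k)$ and sequences $(x_k)$ in $X$. $\mathcal{P}(X)$ is the collection of all conditional subsets $V|A$, $V\subseteq X$ stable, $A\in\mathscr{F}$. For stable $V_k\subseteq X$, $\sum V_k|A_k:=\{\sum x_k|A_k: x_k\in V_k\ \forall k\}$, and $\sum (V_k|B_k)|A_k:=(\sum V_k|A_k)|\bigcup_k(A_k\cap B_k)$. A subset of $\mathcal{P}(X)$ is a stable collection if nonempty and closed under such countable concatenations. $V|A\sqsubseteq W|B$ iff $A\subseteq B$ and $V|A\subseteq W|A$. $(\mathcal{P}(X),\sqsubseteq)$ is a complete Boolean algebra with greatest element $X$ and least element $\{\ast\}$; $\sqcup,\sqcap,{}^\sqsubset$ are its supremum, infimum, complement; disjoint means $V|A\sqcap W|B=\{\ast\}$. A stable collection $\mathcal{X}$ is a stable $\sigma$-algebra if $X\in\mathcal{X}$ and it is closed under ${}^\sqsubset$ and countable $\sqcup$; then $(X,\mathcal{X})$ is a stable measurable space. A stable measure on $(X,\mathcal{X})$ is a function $\mu:\mathcal{X}\to\bar L^0_+$ with $\mu(\sum(V_k|B_k)|A_k)=\sum\mu(V_k|B_k)|A_k$ (stability), (M1) $\mu(V|A)=\mu(V|A)|A+0|A^c$, and (M2) $\mu(\sqcup_k(V_k|A_k))=\sum_{k}\mu(V_k|A_k)$ for sequences of pairwise disjoint elements of $\mathcal{X}$; it is a stable probability measure if $\mu(X)=1$. A stable probability measure $\nu$ is absolutely continuous w.r.t. $\mu$ if $V|A\in\mathcal{X}$ and $\mu(V|A)=0$ imply $\nu(V|A)=0$.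 A function $f:X\to Y$ between stable sets is stable if $f(\sum x_k|A_k)=\sum f(x_k)|A_k$. For $W|A\in\mathcal{P}(Y)$, with $C_\ast:=\sup\{A'\subseteq A:\exists x\in X,\ f(x)|A'\in W|A'\}$ (attained), $f^{-1}(W|A):=\{x\in X:f(x)|C_\ast\in W|C_\ast\}|C_\ast$. A stable function is stably measurable if preimages of elements of the stable $\sigma$-algebra on $Y$ belong to that on $X$; $L^0$ carries the stable Borel $\sigma$-algebra $\mathcal{B}(L^0)$ generated by the balls $\{y\in L^0:|x-y|<r\}$, $x\in L^0$, $r\in L^0_{++}$. The stable indicator function is $1_{V|A}(x):=1|A_x+0|A_x^c$, with $A_x:=\sup\{A'\subseteq A: x|A'\in V|A'\}$. A stable elementary function is $\sum_{k\le n}r_k1_{V_k|A_k}$ with $r_k\in L^0_+$ and pairwise disjoint $V_k|A_k\in\mathcal{X}$ with $\sqcup_kV_k|A_k=X$; its integral is $\sum_{k\le n}r_k\mu(V_k|A_k)\in\bar L^0_+$ ($0\cdot\infty=0$). For stably measurable $f:X\to L^0_+$, $\int_Xf\,d\mu:=\sup_n\int_Xf_n\,d\mu$ for any increasing sequence $(f_n)$ of stable elementary functions with $\sup_nf_n=f$ pointwise (exists; independent of the choice). A stably measurable $f:X\to L^0$ is (stable) integrable if $\int_X f^\pm d\mu\in L^0$, and then $\int_Xf\,d\mu:=\int_Xf^+d\mu-\int_Xf^-d\mu$. *)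

theory Defs
  imports "HOL-Probability.Probability" "HOL-Algebra.Lattice"
begin

text \<open>
  Encoding. A function \<open>x\<close> on \<open>\<Omega> = space M\<close> with values in a fixed set is a function \<open>'w \<Rightarrow> 'e\<close>, and
  a function on a part of \<open>\<Omega>\<close> is a partial function \<open>'w \<rightharpoonup> 'e\<close>. Two restrictions \<open>x|A\<close>, \<open>y|B\<close> are
  identified (\<open>A\<close> and \<open>B\<close> differ by a null set and \<open>x = y\<close> almost everywhere on \<open>A \<inter> B\<close>) iff they are
  almost everywhere equal as partial functions. A set of equivalence classes is represented by the
  union of these classes, i.e. by a set closed under almost everywhere equality; then equality of
  conditional sets is equality of HOL sets. Values outside \<open>space M\<close> are irrelevant throughout.
\<close>

section \<open>Concatenations and stable sets\<close>

definition msr_partition :: "'w measure \<Rightarrow> (nat \<Rightarrow> 'w set) \<Rightarrow> bool" where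
  "msr_partition M A \<longleftrightarrow>
     (\<forall>k. A k \<in> sets M) \<and> disjoint_family A \<and> (\<Union>k. A k) = space M"

text \<open>\<open>z\<close> is (a representative of) \<open>\<Sum>\<^sub>k x\<^sub>k|A\<^sub>k\<close>.\<close>

definition is_concat ::
  "'w measure \<Rightarrow> (nat \<Rightarrow> 'w set) \<Rightarrow> (nat \<Rightarrow> 'w \<Rightarrow> 'b) \<Rightarrow> ('w \<Rightarrow> 'b) \<Rightarrow> bool" where
  "is_concat M A x z \<longleftrightarrow> (\<forall>k. AE \<omega> in M. \<omega> \<in> A k \<longrightarrow> z \<omega> = x k \<omega>)"

text \<open>
  As \<open>is_concat\<close> fixes \<open>z\<close> only up to a null set, a stable set is in particular closed under almost
  everywhere equality (take \<open>A 0 = \<Omega>\<close>).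
\<close>

definition stable_set :: "'w measure \<Rightarrow> ('w \<Rightarrow> 'e) set \<Rightarrow> bool" where
  "stable_set M X \<longleftrightarrow> X \<noteq> {} \<and>
     (\<forall>A x z. msr_partition M A \<and> (\<forall>k. x k \<in> X) \<and> is_concat M A x z \<longrightarrow> z \<in> X)"

definition stable_subsets :: "'w measure \<Rightarrow> ('w \<Rightarrow> 'e) set \<Rightarrow> ('w \<Rightarrow> 'e) set set" where
  "stable_subsets M X = {V. V \<subseteq> X \<and> stable_set M V}"

definition set_concat ::
  "'w measure \<Rightarrow> (nat \<Rightarrow> 'w set) \<Rightarrow> (nat \<Rightarrow> ('w \<Rightarrow> 'e) set) \<Rightarrow> ('w \<Rightarrow> 'e) set" where
  "set_concat M A V = {z. \<exists>x. (\<forall>k. x k \<in> V k) \<and> is_concat M A x z}"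

section \<open>Conditional subsets\<close>

definition restr :: "('w \<Rightarrow> 'e) \<Rightarrow> 'w set \<Rightarrow> ('w \<rightharpoonup> 'e)" where
  "restr x A = (Some \<circ> x) |` A"

text \<open>\<open>cond M V A\<close> is \<open>V|A\<close>; in particular \<open>cond M X (space M)\<close> is \<open>X\<close> and \<open>cond M X {}\<close> is \<open>{\<ast>}\<close>.\<close>

definition cond :: "'w measure \<Rightarrow> ('w \<Rightarrow> 'e) set \<Rightarrow> 'w set \<Rightarrow> ('w \<rightharpoonup> 'e) set" where
  "cond M V A = {g. \<exists>x\<in>V. AE \<omega> in M. g \<omega> = restr x A \<omega>}"

definition cond_subsets :: "'w measure \<Rightarrow> ('w \<Rightarrow> 'e) set \<Rightarrow> ('w \<rightharpoonup> 'e) set set" where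
  "cond_subsets M X = {cond M V A | V A. V \<in> stable_subsets M X \<and> A \<in> sets M}"

text \<open>The concatenation \<open>\<Sum>\<^sub>k (V\<^sub>k|B\<^sub>k)|A\<^sub>k\<close>.\<close>

definition cond_concat ::
  "'w measure \<Rightarrow> (nat \<Rightarrow> 'w set) \<Rightarrow> (nat \<Rightarrow> ('w \<Rightarrow> 'e) set) \<Rightarrow> (nat \<Rightarrow> 'w set)
    \<Rightarrow> ('w \<rightharpoonup> 'e) set" where
  "cond_concat M A V B = cond M (set_concat M A V) (\<Union>k. A k \<inter> B k)"

definition cond_le ::
  "'w measure \<Rightarrow> ('w \<Rightarrow> 'e) set \<Rightarrow> ('w \<rightharpoonup> 'e) set \<Rightarrow> ('w \<rightharpoonup> 'e) set \<Rightarrow> bool" where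
  "cond_le M X P Q \<longleftrightarrow>
     (\<exists>V\<in>stable_subsets M X. \<exists>W\<in>stable_subsets M X. \<exists>A\<in>sets M. \<exists>B\<in>sets M.
        P = cond M V A \<and> Q = cond M W B \<and>
        (AE \<omega> in M. \<omega> \<in> A \<longrightarrow> \<omega> \<in> B) \<and> cond M V A \<subseteq> cond M W A)"

text \<open>
  The ordered set \<open>(\<P>(X), \<sqsubseteq>)\<close>; its suprema and infima are those of HOL-Algebra, written
  \<open>\<Squnion>\<close>, \<open>\<squnion>\<close>, \<open>\<sqinter>\<close> with subscript \<open>cond_order M X\<close>.
\<close>

definition cond_order :: "'w measure \<Rightarrow> ('w \<Rightarrow> 'e) set \<Rightarrow> ('w \<rightharpoonup> 'e) set gorder" where
  "cond_order M X = \<lparr>carrier = cond_subsets M X, eq = (=), le = cond_le M X\<rparr>"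

definition cond_compl ::
  "'w measure \<Rightarrow> ('w \<Rightarrow> 'e) set \<Rightarrow> ('w \<rightharpoonup> 'e) set \<Rightarrow> ('w \<rightharpoonup> 'e) set" where
  "cond_compl M X P = (THE Q. Q \<in> cond_subsets M X \<and>
     P \<squnion>\<^bsub>cond_order M X\<^esub> Q = cond M X (space M) \<and> P \<sqinter>\<^bsub>cond_order M X\<^esub> Q = cond M X {})"

definition cond_disjoint ::
  "'w measure \<Rightarrow> ('w \<Rightarrow> 'e) set \<Rightarrow> ('w \<rightharpoonup> 'e) set \<Rightarrow> ('w \<rightharpoonup> 'e) set \<Rightarrow> bool" where
  "cond_disjoint M X P Q \<longleftrightarrow> P \<sqinter>\<^bsub>cond_order M X\<^esub> Q = cond M X {}"

section \<open>Stable measurable spaces\<close>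

definition stable_collection ::
  "'w measure \<Rightarrow> ('w \<Rightarrow> 'e) set \<Rightarrow> ('w \<rightharpoonup> 'e) set set \<Rightarrow> bool" where
  "stable_collection M X \<X> \<longleftrightarrow> \<X> \<subseteq> cond_subsets M X \<and> \<X> \<noteq> {} \<and>
     (\<forall>A V B. msr_partition M A \<and>
        (\<forall>k. V k \<in> stable_subsets M X \<and> B k \<in> sets M \<and> cond M (V k) (B k) \<in> \<X>)
        \<longrightarrow> cond_concat M A V B \<in> \<X>)"

definition stable_sigma_algebra ::
  "'w measure \<Rightarrow> ('w \<Rightarrow> 'e) set \<Rightarrow> ('w \<rightharpoonup> 'e) set set \<Rightarrow> bool" where
  "stable_sigma_algebra M X \<X> \<longleftrightarrow> stable_collection M X \<X> \<and>
     cond M X (space M) \<in> \<X> \<and>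
     (\<forall>P\<in>\<X>. cond_compl M X P \<in> \<X>) \<and>
     (\<forall>P :: nat \<Rightarrow> _. range P \<subseteq> \<X> \<longrightarrow> \<Squnion>\<^bsub>cond_order M X\<^esub>(range P) \<in> \<X>)"

definition stable_measurable_space ::
  "'w measure \<Rightarrow> ('w \<Rightarrow> 'e) set \<Rightarrow> ('w \<rightharpoonup> 'e) set set \<Rightarrow> bool" where
  "stable_measurable_space M X \<X> \<longleftrightarrow> stable_set M X \<and> stable_sigma_algebra M X \<X>"

section \<open>Stable measures\<close>

text \<open>
  The second conjunct is stability: the value of \<open>\<mu>\<close> at a concatenation is the concatenation of the
  values. The last two are locality in \<open>A\<close> and countable additivity. All equalities hold almost surely.
\<close>

definition stable_measure ::
  "'w measure \<Rightarrow> ('w \<Rightarrow> 'e) set \<Rightarrow> ('w \<rightharpoonup> 'e) set set \<Rightarrow> (('w \<rightharpoonup> 'e) set \<Rightarrow> 'w \<Rightarrow> ennreal) \<Rightarrow> bool"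
where
  "stable_measure M X \<X> \<mu> \<longleftrightarrow>
     (\<forall>P\<in>\<X>. \<mu> P \<in> borel_measurable M) \<and>
     (\<forall>A V B. msr_partition M A \<and>
        (\<forall>k. V k \<in> stable_subsets M X \<and> B k \<in> sets M \<and> cond M (V k) (B k) \<in> \<X>)
        \<longrightarrow> is_concat M A (\<lambda>k. \<mu> (cond M (V k) (B k))) (\<mu> (cond_concat M A V B))) \<and>
     (\<forall>V\<in>stable_subsets M X. \<forall>A\<in>sets M. cond M V A \<in> \<X>
        \<longrightarrow> (AE \<omega> in M. \<mu> (cond M V A) \<omega> = (if \<omega> \<in> A then \<mu> (cond M V A) \<omega> else 0))) \<and>
     (\<forall>P :: nat \<Rightarrow> _. range P \<subseteq> \<X> \<and> (\<forall>i j. i \<noteq> j \<longrightarrow> cond_disjoint M X (P i) (P j))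
        \<longrightarrow> (AE \<omega> in M. \<mu> (\<Squnion>\<^bsub>cond_order M X\<^esub>(range P)) \<omega> = (\<Sum>k. \<mu> (P k) \<omega>)))"

definition stable_prob_measure ::
  "'w measure \<Rightarrow> ('w \<Rightarrow> 'e) set \<Rightarrow> ('w \<rightharpoonup> 'e) set set \<Rightarrow> (('w \<rightharpoonup> 'e) set \<Rightarrow> 'w \<Rightarrow> ennreal) \<Rightarrow> bool"
where
  "stable_prob_measure M X \<X> \<mu> \<longleftrightarrow>
     stable_measure M X \<X> \<mu> \<and> (AE \<omega> in M. \<mu> (cond M X (space M)) \<omega> = 1)"

text \<open>\<open>\<nu>\<close> is absolutely continuous with respect to \<open>\<mu>\<close>; note the order of the arguments.\<close>

definition stable_abs_continuous ::
  "'w measure \<Rightarrow> ('w \<rightharpoonup> 'e) set set \<Rightarrow> (('w \<rightharpoonup> 'e) set \<Rightarrow> 'w \<Rightarrow> ennreal)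
    \<Rightarrow> (('w \<rightharpoonup> 'e) set \<Rightarrow> 'w \<Rightarrow> ennreal) \<Rightarrow> bool" where
  "stable_abs_continuous M \<X> \<nu> \<mu> \<longleftrightarrow>
     (\<forall>P\<in>\<X>. (AE \<omega> in M. \<mu> P \<omega> = 0) \<longrightarrow> (AE \<omega> in M. \<nu> P \<omega> = 0))"

section \<open>Stable functions and measurability\<close>

definition is_ess_Sup :: "'w measure \<Rightarrow> 'w set set \<Rightarrow> 'w set \<Rightarrow> bool" where
  "is_ess_Sup M \<C> C \<longleftrightarrow> C \<in> sets M \<and>
     (\<forall>A\<in>\<C>. AE \<omega> in M. \<omega> \<in> A \<longrightarrow> \<omega> \<in> C) \<and>
     (\<forall>D\<in>sets M. (\<forall>A\<in>\<C>. AE \<omega> in M. \<omega> \<in> A \<longrightarrow> \<omega> \<in> D) \<longrightarrow> (AE \<omega> in M. \<omega> \<in> C \<longrightarrow> \<omega> \<in> D))"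

text \<open>The essential supremum is unique up to a null set, so any choice will do.\<close>

definition ess_Sup :: "'w measure \<Rightarrow> 'w set set \<Rightarrow> 'w set" where
  "ess_Sup M \<C> = (SOME C. is_ess_Sup M \<C> C)"

definition stable_fun ::
  "'w measure \<Rightarrow> ('w \<Rightarrow> 'e) set \<Rightarrow> ('w \<Rightarrow> 'd) set \<Rightarrow> (('w \<Rightarrow> 'e) \<Rightarrow> 'w \<Rightarrow> 'd) \<Rightarrow> bool" where
  "stable_fun M X Y f \<longleftrightarrow> (\<forall>x\<in>X. f x \<in> Y) \<and>
     (\<forall>A x z. msr_partition M A \<and> (\<forall>k. x k \<in> X) \<and> z \<in> X \<and> is_concat M A x z
        \<longrightarrow> is_concat M A (\<lambda>k. f (x k)) (f z))"

definition stable_preimage ::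
  "'w measure \<Rightarrow> ('w \<Rightarrow> 'e) set \<Rightarrow> (('w \<Rightarrow> 'e) \<Rightarrow> 'w \<Rightarrow> 'd) \<Rightarrow> ('w \<Rightarrow> 'd) set \<Rightarrow> 'w set
    \<Rightarrow> ('w \<rightharpoonup> 'e) set" where
  "stable_preimage M X f W A =
     (let C = ess_Sup M {A' \<in> sets M. A' \<subseteq> A \<and> (\<exists>x\<in>X. restr (f x) A' \<in> cond M W A')}
      in cond M {x \<in> X. restr (f x) C \<in> cond M W C} C)"

definition stably_measurable ::
  "'w measure \<Rightarrow> ('w \<Rightarrow> 'e) set \<Rightarrow> ('w \<rightharpoonup> 'e) set set \<Rightarrow> ('w \<Rightarrow> 'd) set \<Rightarrow> ('w \<rightharpoonup> 'd) set set
    \<Rightarrow> (('w \<Rightarrow> 'e) \<Rightarrow> 'w \<Rightarrow> 'd) \<Rightarrow> bool" where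
  "stably_measurable M X \<X> Y \<Y> f \<longleftrightarrow> stable_fun M X Y f \<and>
     (\<forall>W\<in>stable_subsets M Y. \<forall>A\<in>sets M. cond M W A \<in> \<Y> \<longrightarrow> stable_preimage M X f W A \<in> \<X>)"

abbreviation L0 :: "'w measure \<Rightarrow> ('w \<Rightarrow> real) set" where
  "L0 M \<equiv> borel_measurable M"

definition L0_nonneg :: "'w measure \<Rightarrow> ('w \<Rightarrow> real) set" where
  "L0_nonneg M = {x \<in> L0 M. AE \<omega> in M. 0 \<le> x \<omega>}"

definition L0_pos :: "'w measure \<Rightarrow> ('w \<Rightarrow> real) set" where
  "L0_pos M = {x \<in> L0 M. AE \<omega> in M. 0 < x \<omega>}"

definition L0_ball :: "'w measure \<Rightarrow> ('w \<Rightarrow> real) \<Rightarrow> ('w \<Rightarrow> real) \<Rightarrow> ('w \<Rightarrow> real) set" where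
  "L0_ball M x r = {y \<in> L0 M. AE \<omega> in M. \<bar>x \<omega> - y \<omega>\<bar> < r \<omega>}"

definition stable_borel :: "'w measure \<Rightarrow> ('w \<rightharpoonup> real) set set" where
  "stable_borel M = \<Inter>{\<Y>. stable_sigma_algebra M (L0 M) \<Y> \<and>
     (\<forall>x\<in>L0 M. \<forall>r\<in>L0_pos M. cond M (L0_ball M x r) (space M) \<in> \<Y>)}"

section \<open>The stable integral\<close>

definition stable_indicator ::
  "'w measure \<Rightarrow> ('w \<Rightarrow> 'e) set \<Rightarrow> 'w set \<Rightarrow> ('w \<Rightarrow> 'e) \<Rightarrow> 'w \<Rightarrow> real" where
  "stable_indicator M V A x =
     indicator (ess_Sup M {A' \<in> sets M. A' \<subseteq> A \<and> restr x A' \<in> cond M V A'})"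

text \<open>\<open>g\<close> is a stable elementary function on \<open>X\<close> with integral \<open>I\<close>.\<close>

definition has_elementary_integral ::
  "'w measure \<Rightarrow> ('w \<Rightarrow> 'e) set \<Rightarrow> ('w \<rightharpoonup> 'e) set set \<Rightarrow> (('w \<rightharpoonup> 'e) set \<Rightarrow> 'w \<Rightarrow> ennreal)
    \<Rightarrow> (('w \<Rightarrow> 'e) \<Rightarrow> 'w \<Rightarrow> real) \<Rightarrow> ('w \<Rightarrow> ennreal) \<Rightarrow> bool" where
  "has_elementary_integral M X \<X> \<mu> g I \<longleftrightarrow>
     (\<exists>(n::nat) r V A.
        (\<forall>k<n. r k \<in> L0_nonneg M \<and> V k \<in> stable_subsets M X \<and> A k \<in> sets M \<and>
               cond M (V k) (A k) \<in> \<X>) \<and>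
        (\<forall>i<n. \<forall>j<n. i \<noteq> j \<longrightarrow> cond_disjoint M X (cond M (V i) (A i)) (cond M (V j) (A j))) \<and>
        \<Squnion>\<^bsub>cond_order M X\<^esub>((\<lambda>k. cond M (V k) (A k)) ` {..<n}) = cond M X (space M) \<and>
        (\<forall>x\<in>X. g x \<in> L0 M \<and>
           (AE \<omega> in M. g x \<omega> = (\<Sum>k<n. r k \<omega> * stable_indicator M (V k) (A k) x \<omega>))) \<and>
        I \<in> borel_measurable M \<and>
        (AE \<omega> in M. I \<omega> = (\<Sum>k<n. ennreal (r k \<omega>) * \<mu> (cond M (V k) (A k)) \<omega>)))"

text \<open>
  \<open>I\<close> is the limit of the integrals along some increasing sequence of stable elementary functions with
  supremum \<open>f\<close>. For stably measurable \<open>f \<ge> 0\<close> such a sequence exists, and \<open>I\<close> does not depend on it up to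
  almost sure equality, so \<open>SOME\<close> below picks a representative of the integral.
\<close>

definition has_stable_nn_integral ::
  "'w measure \<Rightarrow> ('w \<Rightarrow> 'e) set \<Rightarrow> ('w \<rightharpoonup> 'e) set set \<Rightarrow> (('w \<rightharpoonup> 'e) set \<Rightarrow> 'w \<Rightarrow> ennreal)
    \<Rightarrow> (('w \<Rightarrow> 'e) \<Rightarrow> 'w \<Rightarrow> real) \<Rightarrow> ('w \<Rightarrow> ennreal) \<Rightarrow> bool" where
  "has_stable_nn_integral M X \<X> \<mu> f I \<longleftrightarrow>
     (\<exists>(g :: nat \<Rightarrow> _) J. (\<forall>i. has_elementary_integral M X \<X> \<mu> (g i) (J i)) \<and>
        (\<forall>x\<in>X. \<forall>i. AE \<omega> in M. g i x \<omega> \<le> g (Suc i) x \<omega>) \<and>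
        (\<forall>x\<in>X. AE \<omega> in M. (SUP i. ennreal (g i x \<omega>)) = ennreal (f x \<omega>)) \<and>
        I \<in> borel_measurable M \<and> (AE \<omega> in M. I \<omega> = (SUP i. J i \<omega>)))"

definition stable_nn_integral ::
  "'w measure \<Rightarrow> ('w \<Rightarrow> 'e) set \<Rightarrow> ('w \<rightharpoonup> 'e) set set \<Rightarrow> (('w \<rightharpoonup> 'e) set \<Rightarrow> 'w \<Rightarrow> ennreal)
    \<Rightarrow> (('w \<Rightarrow> 'e) \<Rightarrow> 'w \<Rightarrow> real) \<Rightarrow> 'w \<Rightarrow> ennreal" where
  "stable_nn_integral M X \<X> \<mu> f = (SOME I. has_stable_nn_integral M X \<X> \<mu> f I)"

definition pos_part :: "('b \<Rightarrow> 'w \<Rightarrow> real) \<Rightarrow> 'b \<Rightarrow> 'w \<Rightarrow> real" where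
  "pos_part f = (\<lambda>x \<omega>. max (f x \<omega>) 0)"

definition neg_part :: "('b \<Rightarrow> 'w \<Rightarrow> real) \<Rightarrow> 'b \<Rightarrow> 'w \<Rightarrow> real" where
  "neg_part f = (\<lambda>x \<omega>. max (- f x \<omega>) 0)"

definition stable_integrable ::
  "'w measure \<Rightarrow> ('w \<Rightarrow> 'e) set \<Rightarrow> ('w \<rightharpoonup> 'e) set set \<Rightarrow> (('w \<rightharpoonup> 'e) set \<Rightarrow> 'w \<Rightarrow> ennreal)
    \<Rightarrow> (('w \<Rightarrow> 'e) \<Rightarrow> 'w \<Rightarrow> real) \<Rightarrow> bool" where
  "stable_integrable M X \<X> \<mu> f \<longleftrightarrow>
     stably_measurable M X \<X> (L0 M) (stable_borel M) f \<and>
     (AE \<omega> in M. stable_nn_integral M X \<X> \<mu> (pos_part f) \<omega> < \<infinity>) \<and>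
     (AE \<omega> in M. stable_nn_integral M X \<X> \<mu> (neg_part f) \<omega> < \<infinity>)"

text \<open>Meaningful for \<open>stable_integrable\<close> functions only.\<close>

definition stable_integral ::
  "'w measure \<Rightarrow> ('w \<Rightarrow> 'e) set \<Rightarrow> ('w \<rightharpoonup> 'e) set set \<Rightarrow> (('w \<rightharpoonup> 'e) set \<Rightarrow> 'w \<Rightarrow> ennreal)
    \<Rightarrow> (('w \<Rightarrow> 'e) \<Rightarrow> 'w \<Rightarrow> real) \<Rightarrow> 'w \<Rightarrow> real" where
  "stable_integral M X \<X> \<mu> f = (\<lambda>\<omega>.
     enn2real (stable_nn_integral M X \<X> \<mu> (pos_part f) \<omega>) -
     enn2real (stable_nn_integral M X \<X> \<mu> (neg_part f) \<omega>))"

end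

theory Submission
  imports Defs
begin

text \<open>
  The proof reduces the statement to the classical Radon-Nikodym theorem on the product
  \<open>X \<times> \<Omega>\<close>.

  A conditional subset \<open>V|A\<close> of \<open>X\<close> is determined by the map that sends \<open>x \<in> X\<close> to the largest event
  on which \<open>x\<close> lies in \<open>V|A\<close>. The maps that arise are exactly the local ones: if \<open>x = y\<close> on \<open>B\<close>, the
  values at \<open>x\<close> and \<open>y\<close> agree on \<open>B\<close>. Such a map is the same as a set \<open>E \<subseteq> X \<times> \<Omega>\<close> with measurable,
  local sections \<open>E\<^sub>x\<close> (\<open>local_set\<close>), and \<open>cond_of\<close> turns \<open>E\<close> into a conditional set. The order on
  \<open>\<P>(X)\<close> becomes almost sure inclusion of sections (\<open>cond_le_iff\<close>), so suprema, infima, complements and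
  concatenations become the set operations on \<open>X \<times> \<Omega>\<close>.

  Hence the local sets with \<open>cond_of E \<in> \<X>\<close> form a \<open>\<sigma>\<close>-algebra \<open>\<L>\<close> on \<open>X \<times> \<Omega>\<close>, and
  \<open>E \<mapsto> \<integral> \<mu>(cond_of E) dP\<close> is a finite measure on it (\<open>emeasure_lift\<close>), with respect to which a subset
  of \<open>X \<times> \<Omega>\<close> with null sections is null (\<open>AE_lift\<close>). The measure obtained from \<open>\<nu>\<close> is absolutely
  continuous with respect to the one obtained from \<open>\<mu>\<close>, which gives a classical density \<open>D\<close>. The stable
  density is \<open>f(x)(\<omega>) = D(x, \<omega>)\<close>.

  Two translations remain. An \<open>\<L>\<close>-measurable function of \<open>(x, \<omega>)\<close> is stably measurable
  (\<open>stably_measurable_f\<close>), because the sets in \<open>\<P>(L\<^sup>0)\<close> whose preimage belongs to \<open>\<X>\<close> form a stable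
  \<open>\<sigma>\<close>-algebra that contains the balls. And the stable integral \<open>I\<close> of a function \<open>g \<ge> 0\<close> is
  characterised by \<open>\<integral>\<^sub>A I dP = \<integral>\<^sub>X\<^sub>\<times>\<^sub>A g\<close> for all events \<open>A\<close> (\<open>has_stable_nn_integral_lift\<close>), where
  the right-hand side is a classical integral. For \<open>g = 1\<^sub>E f\<close> it equals \<open>\<integral>\<^sub>A \<nu>(cond_of E) dP\<close>, so
  \<open>I = \<nu>(cond_of E)\<close>.
\<close>

section \<open>Comparing functions through their integrals over events\<close>

text \<open>
  On the event where the inequality fails, the integrals of \<open>u\<close> and \<open>v\<close> over each subevent agree, so the
  two functions are densities of the same measure there. This form of the argument also covers functions
  with infinite values.
\<close>

lemma (in sigma_finite_measure) AE_le_of_nn_integral_le: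
  assumes u: "u \<in> borel_measurable M" and v: "v \<in> borel_measurable M"
    and le: "\<And>A. A \<in> sets M \<Longrightarrow> (\<integral>\<^sup>+\<omega>. u \<omega> * indicator A \<omega> \<partial>M) \<le> (\<integral>\<^sup>+\<omega>. v \<omega> * indicator A \<omega> \<partial>M)"
  shows "AE \<omega> in M. u \<omega> \<le> (v \<omega> :: ennreal)"
proof -
  define B where "B = {\<omega>\<in>space M. v \<omega> < u \<omega>}"
  have B: "B \<in> sets M" unfolding B_def using u v by measurable
  have "density M (\<lambda>\<omega>. u \<omega> * indicator B \<omega>) = density M (\<lambda>\<omega>. v \<omega> * indicator B \<omega>)"
  proof (rule measure_eqI)
    fix A assume "A \<in> sets (density M (\<lambda>\<omega>. u \<omega> * indicator B \<omega>))"
    then have A: "A \<in> sets M" by simp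
    have "(\<integral>\<^sup>+\<omega>. u \<omega> * indicator (B \<inter> A) \<omega> \<partial>M) = (\<integral>\<^sup>+\<omega>. v \<omega> * indicator (B \<inter> A) \<omega> \<partial>M)"
    proof (rule antisym)
      show "(\<integral>\<^sup>+\<omega>. u \<omega> * indicator (B \<inter> A) \<omega> \<partial>M) \<le> (\<integral>\<^sup>+\<omega>. v \<omega> * indicator (B \<inter> A) \<omega> \<partial>M)"
        using A B by (intro le) simp
      show "(\<integral>\<^sup>+\<omega>. v \<omega> * indicator (B \<inter> A) \<omega> \<partial>M) \<le> (\<integral>\<^sup>+\<omega>. u \<omega> * indicator (B \<inter> A) \<omega> \<partial>M)"
        by (rule nn_integral_mono) (auto simp: B_def indicator_def)
    qed
    then show "emeasure (density M (\<lambda>\<omega>. u \<omega> * indicator B \<omega>)) A =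
        emeasure (density M (\<lambda>\<omega>. v \<omega> * indicator B \<omega>)) A"
      using A B u v by (simp add: emeasure_density indicator_inter_arith mult.assoc)
  qed simp
  then have "AE \<omega> in M. u \<omega> * indicator B \<omega> = v \<omega> * indicator B \<omega>"
    using u v B by (intro density_unique) auto
  with AE_space show ?thesis
  proof eventually_elim
    case (elim \<omega>)
    then show ?case by (cases "\<omega> \<in> B") (auto simp: B_def not_less)
  qed
qed

lemma (in sigma_finite_measure) AE_eq_of_nn_integral_eq:
  assumes u: "u \<in> borel_measurable M" and v: "v \<in> borel_measurable M"
    and eq: "\<And>A. A \<in> sets M \<Longrightarrow> (\<integral>\<^sup>+\<omega>. u \<omega> * indicator A \<omega> \<partial>M) = (\<integral>\<^sup>+\<omega>. v \<omega> * indicator A \<omega> \<partial>M)"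
  shows "AE \<omega> in M. u \<omega> = (v \<omega> :: ennreal)"
proof -
  have "AE \<omega> in M. u \<omega> \<le> v \<omega>" by (rule AE_le_of_nn_integral_le[OF u v]) (simp add: eq)
  moreover have "AE \<omega> in M. v \<omega> \<le> u \<omega>" by (rule AE_le_of_nn_integral_le[OF v u]) (simp add: eq)
  ultimately show ?thesis by eventually_elim (rule antisym)
qed

section \<open>Essential suprema of families of events\<close>

text \<open>
  Exhaustion: a countable subfamily whose union has the largest possible probability absorbs every member
  of the family up to a null set. That the supremum is an actual countable union is what permits gluing
  along it.
\<close>

lemma (in finite_measure) is_ess_Sup_countable_Union:
  assumes "\<C> \<subseteq> sets M"
  shows "\<exists>\<K>. countable \<K> \<and> \<K> \<subseteq> \<C> \<and> is_ess_Sup M \<C> (\<Union>\<K>)"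
proof -
  define \<D> where "\<D> = {\<Union>\<K> |\<K>. countable \<K> \<and> \<K> \<subseteq> \<C>}"
  have \<D>_sets: "D \<in> sets M" if "D \<in> \<D>" for D
  proof -
    obtain \<K> where "countable \<K>" "\<K> \<subseteq> \<C>" "D = \<Union>\<K>" using \<open>D \<in> \<D>\<close> unfolding \<D>_def by blast
    then show ?thesis using assms by (simp add: sets.countable_Union subset_trans)
  qed
  have "{} \<in> \<D>" unfolding \<D>_def by (intro CollectI exI[of _ "{}"]) simp
  then have "emeasure M ` \<D> \<noteq> {}" by blast
  from ennreal_Sup_countable_SUP[OF this] obtain a :: "nat \<Rightarrow> ennreal" where
    "incseq a \<and> range a \<subseteq> emeasure M ` \<D> \<and> (SUP D\<in>\<D>. emeasure M D) = (SUP i. a i)" ..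
  then have a: "range a \<subseteq> emeasure M ` \<D>" "(SUP D\<in>\<D>. emeasure M D) = (SUP i. a i)"
    by simp_all
  have "\<exists>D\<in>\<D>. a i = emeasure M D" for i using a(1) by (auto simp: image_subset_iff)
  then obtain D where D: "\<And>i. D i \<in> \<D>" "\<And>i. a i = emeasure M (D i)" by metis
  have "\<forall>i. \<exists>\<K>. D i = \<Union>\<K> \<and> countable \<K> \<and> \<K> \<subseteq> \<C>"
    using D(1) unfolding \<D>_def mem_Collect_eq ..
  from choice[OF this] obtain \<K> where "\<forall>i. D i = \<Union>(\<K> i) \<and> countable (\<K> i) \<and> \<K> i \<subseteq> \<C>" ..
  then have \<K>: "\<And>i. countable (\<K> i)" "\<And>i. \<K> i \<subseteq> \<C>" "\<And>i. D i = \<Union>(\<K> i)" by blast+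
  define \<L> where "\<L> = (\<Union>i. \<K> i)"
  have \<L>: "countable \<L>" "\<L> \<subseteq> \<C>" using \<K> unfolding \<L>_def by auto
  have \<L>_sets: "\<Union>\<L> \<in> sets M" using \<L> assms by (intro sets.countable_Union) blast+
  have upper: "AE \<omega> in M. \<omega> \<in> A \<longrightarrow> \<omega> \<in> \<Union>\<L>" if A: "A \<in> \<C>" for A
  proof -
    have As: "A \<in> sets M" using A assms by blast
    have "A \<union> \<Union>\<L> \<in> \<D>"
      unfolding \<D>_def using \<L> A by (intro CollectI exI[of _ "insert A \<L>"]) simp
    then have "emeasure M (A \<union> \<Union>\<L>) \<le> (SUP i. a i)"
      unfolding a(2)[symmetric] by (rule SUP_upper)
    also have "\<dots> \<le> emeasure M (\<Union>\<L>)"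
    proof (rule SUP_least)
      fix i
      have "D i \<subseteq> \<Union>\<L>" unfolding \<K>(3) \<L>_def by blast
      then show "a i \<le> emeasure M (\<Union>\<L>)" unfolding D(2) by (rule emeasure_mono[OF _ \<L>_sets])
    qed
    finally have le: "emeasure M (A \<union> \<Union>\<L>) \<le> emeasure M (\<Union>\<L>)" .
    have "measure M ((A - \<Union>\<L>) \<union> \<Union>\<L>) = measure M (A - \<Union>\<L>) + measure M (\<Union>\<L>)"
      by (rule finite_measure_Union[OF sets.Diff[OF As \<L>_sets] \<L>_sets]) (rule Diff_disjoint[THEN trans[OF Int_commute]])
    then have "measure M (A \<union> \<Union>\<L>) = measure M (A - \<Union>\<L>) + measure M (\<Union>\<L>)"
      by (simp only: Un_Diff_cancel2)
    then have "emeasure M (A - \<Union>\<L>) = 0"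
      using le measure_nonneg[of M "A - \<Union>\<L>"] by (simp add: emeasure_eq_measure)
    then have "A - \<Union>\<L> \<in> null_sets M" using As \<L>_sets by auto
    from AE_not_in[OF this] show ?thesis by eventually_elim auto
  qed
  have least: "AE \<omega> in M. \<omega> \<in> \<Union>\<L> \<longrightarrow> \<omega> \<in> B"
    if "\<forall>A\<in>\<C>. AE \<omega> in M. \<omega> \<in> A \<longrightarrow> \<omega> \<in> B" for B
  proof -
    have "AE \<omega> in M. \<forall>A\<in>\<L>. \<omega> \<in> A \<longrightarrow> \<omega> \<in> B"
      using that \<L> by (subst AE_ball_countable) auto
    then show ?thesis by eventually_elim auto
  qed
  have "is_ess_Sup M \<C> (\<Union>\<L>)" unfolding is_ess_Sup_def using \<L>_sets upper least by blast
  with \<L> show ?thesis by blast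
qed

lemma (in finite_measure) is_ess_Sup_ess_Sup:
  assumes "\<C> \<subseteq> sets M"
  shows "is_ess_Sup M \<C> (ess_Sup M \<C>)"
proof -
  from is_ess_Sup_countable_Union[OF assms] obtain \<K> where "is_ess_Sup M \<C> (\<Union>\<K>)" by blast
  then show ?thesis unfolding ess_Sup_def by (rule someI)
qed

lemma (in finite_measure) ess_Sup_measurable:
  "\<C> \<subseteq> sets M \<Longrightarrow> ess_Sup M \<C> \<in> sets M"
  using is_ess_Sup_ess_Sup by (auto simp: is_ess_Sup_def)

lemma (in finite_measure) ess_Sup_upper:
  "\<C> \<subseteq> sets M \<Longrightarrow> A \<in> \<C> \<Longrightarrow> AE \<omega> in M. \<omega> \<in> A \<longrightarrow> \<omega> \<in> ess_Sup M \<C>"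
  using is_ess_Sup_ess_Sup by (auto simp: is_ess_Sup_def)

lemma (in finite_measure) ess_Sup_least:
  "\<C> \<subseteq> sets M \<Longrightarrow> D \<in> sets M \<Longrightarrow> (\<And>A. A \<in> \<C> \<Longrightarrow> AE \<omega> in M. \<omega> \<in> A \<longrightarrow> \<omega> \<in> D)
    \<Longrightarrow> AE \<omega> in M. \<omega> \<in> ess_Sup M \<C> \<longrightarrow> \<omega> \<in> D"
  using is_ess_Sup_ess_Sup by (auto simp: is_ess_Sup_def)

section \<open>Gluing in stable sets\<close>

lemma is_concat_exists:
  assumes "msr_partition M A"
  shows "\<exists>z. \<forall>k. \<forall>\<omega>\<in>A k. z \<omega> = x k \<omega>"
proof -
  have "(THE k. \<omega> \<in> A k) = k" if "\<omega> \<in> A k" for \<omega> k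
    using assms that by (intro the_equality) (auto simp: msr_partition_def disjoint_family_on_def)
  then show ?thesis by (intro exI[of _ "\<lambda>\<omega>. x (THE k. \<omega> \<in> A k) \<omega>"]) simp
qed

lemma stable_set_concat:
  assumes "stable_set M X" "msr_partition M A" "\<And>k. x k \<in> X" "is_concat M A x z"
  shows "z \<in> X"
  using assms unfolding stable_set_def by blast

lemma msr_partition_binary:
  "B \<in> sets M \<Longrightarrow> msr_partition M (\<lambda>k::nat. if k = 0 then B else if k = 1 then space M - B else {})"
  by (auto simp: msr_partition_def disjoint_family_on_def dest: sets.sets_into_space split: if_splits)

lemma stable_set_glue:
  assumes "stable_set M X" "x \<in> X" "y \<in> X" "B \<in> sets M"
  shows "(\<lambda>\<omega>. if \<omega> \<in> B then x \<omega> else y \<omega>) \<in> X"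
  by (rule stable_set_concat[OF assms(1) msr_partition_binary[OF assms(4)],
        of "\<lambda>k. if k = 0 then x else y"]) (use assms in \<open>auto simp: is_concat_def\<close>)

text \<open>
  The property \<open>Q x \<omega>\<close> of pairs need not be measurable in \<open>\<omega>\<close>; an example is \<open>x \<omega> = y \<omega>\<close> for a fixed
  \<open>y\<close>, where the set of values carries no structure.
\<close>

definition local_on :: "'w measure \<Rightarrow> ('w \<Rightarrow> 'e) set \<Rightarrow> (('w \<Rightarrow> 'e) \<Rightarrow> 'w \<Rightarrow> bool) \<Rightarrow> bool" where
  "local_on M X Q \<longleftrightarrow> (\<forall>x\<in>X. \<forall>y\<in>X. \<forall>B\<in>sets M. (AE \<omega> in M. \<omega> \<in> B \<longrightarrow> x \<omega> = y \<omega>)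
     \<longrightarrow> (AE \<omega> in M. \<omega> \<in> B \<longrightarrow> (Q x \<omega> \<longleftrightarrow> Q y \<omega>)))"

lemma local_onD:
  "local_on M X Q \<Longrightarrow> x \<in> X \<Longrightarrow> y \<in> X \<Longrightarrow> B \<in> sets M \<Longrightarrow> AE \<omega> in M. \<omega> \<in> B \<longrightarrow> x \<omega> = y \<omega>
    \<Longrightarrow> AE \<omega> in M. \<omega> \<in> B \<longrightarrow> (Q x \<omega> \<longleftrightarrow> Q y \<omega>)"
  by (auto simp: local_on_def)

text \<open>
  The supremum is a countable union of members of \<open>\<C>\<close>, each with its own witness. Making the members
  disjoint and concatenating the witnesses gives one witness on the whole supremum, since \<open>Q\<close> is local.
\<close>

lemma (in finite_measure) ess_Sup_attained:
  assumes V: "stable_set M V" and loc: "local_on M V Q" and \<C>: "\<C> \<subseteq> sets M"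
    and Q: "\<And>A. A \<in> \<C> \<Longrightarrow> \<exists>v\<in>V. AE \<omega> in M. \<omega> \<in> A \<longrightarrow> Q v \<omega>"
  shows "\<exists>v\<in>V. AE \<omega> in M. \<omega> \<in> ess_Sup M \<C> \<longrightarrow> Q v \<omega>"
proof -
  obtain \<K> where \<K>: "countable \<K>" "\<K> \<subseteq> \<C>" "is_ess_Sup M \<C> (\<Union>\<K>)"
    using is_ess_Sup_countable_Union[OF \<C>] by blast
  obtain v0 where v0: "v0 \<in> V" using V by (auto simp: stable_set_def)
  define A where "A = from_nat_into (insert {} \<K>)"
  have rA: "range A = insert {} \<K>" unfolding A_def using \<K>(1) by (intro range_from_nat_into) auto
  have A_sets: "A k \<in> sets M" for k
  proof -
    have "A k \<in> insert {} \<K>" unfolding rA[symmetric] by simp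
    then show ?thesis using \<K>(2) \<C> by auto
  qed
  have "\<exists>v\<in>V. AE \<omega> in M. \<omega> \<in> A k \<longrightarrow> Q v \<omega>" for k
  proof -
    have "A k = {} \<or> A k \<in> \<C>" using rA \<K>(2) by blast
    then show ?thesis
    proof
      assume "A k = {}" with v0 show ?thesis by (intro bexI[of _ v0]) simp_all
    qed (rule Q)
  qed
  then obtain v where v: "\<And>k. v k \<in> V" "\<And>k. AE \<omega> in M. \<omega> \<in> A k \<longrightarrow> Q (v k) \<omega>" by metis
  \<comment> \<open>The index \<open>0\<close> takes the remainder of \<open>\<Omega>\<close>, so that the disjointed members form a partition.\<close>
  define B where "B k = (case k of 0 \<Rightarrow> space M - (\<Union>k. A k) | Suc k \<Rightarrow> disjointed A k)" for k
  have "msr_partition M B"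
    unfolding msr_partition_def
  proof (intro conjI allI)
    show "B k \<in> sets M" for k
      unfolding B_def using sets.range_disjointed_sets[of A M] A_sets by (auto split: nat.split)
    have disj: "B m \<inter> B n = {}" if "m < n" for m n
    proof -
      obtain j where n: "n = Suc j" using \<open>m < n\<close> by (cases n) simp_all
      have sub: "disjointed A j \<subseteq> (\<Union>k. A k)" using disjointed_subset[of A j] by blast
      show ?thesis
      proof (cases m)
        case 0 then show ?thesis using sub by (auto simp: B_def n)
      next
        case (Suc i)
        then show ?thesis
          using disjoint_family_onD[OF disjoint_family_disjointed[of A], of i j] \<open>m < n\<close>
          by (simp add: B_def n)
      qed
    qed
    show "disjoint_family B"
      unfolding disjoint_family_on_def
    proof (intro ballI impI)
      fix m n :: nat assume "m \<noteq> n"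
      then show "B m \<inter> B n = {}" using disj[of m n] disj[of n m] by (cases "m < n") auto
    qed
    have "B k \<subseteq> B 0 \<union> (\<Union>k. B (Suc k))" for k by (cases k) auto
    then have "(\<Union>k. B k) = B 0 \<union> (\<Union>k. B (Suc k))" by blast
    also have "(\<Union>k. B (Suc k)) = (\<Union>k. A k)" unfolding B_def by (simp add: UN_disjointed_eq)
    also have "B 0 \<union> (\<Union>k. A k) = space M"
    proof -
      have "(\<Union>k. A k) \<subseteq> space M" using sets.sets_into_space[OF A_sets] by blast
      then show ?thesis by (auto simp: B_def)
    qed
    finally show "(\<Union>k. B k) = space M" .
  qed
  note B = this
  define u where "u k = (case k of 0 \<Rightarrow> v0 | Suc k \<Rightarrow> v k)" for k
  have u: "u k \<in> V" for k unfolding u_def using v0 v by (auto split: nat.split)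
  obtain z where z: "\<And>k \<omega>. \<omega> \<in> B k \<Longrightarrow> z \<omega> = u k \<omega>" using is_concat_exists[OF B, of u] by blast
  have "is_concat M B u z" unfolding is_concat_def by (intro allI AE_I2 impI z)
  then have zV: "z \<in> V" by (rule stable_set_concat[OF V B u])
  have UB: "(\<Union>k. B (Suc k)) = \<Union>\<K>" unfolding B_def by (simp add: UN_disjointed_eq rA)
  have "AE \<omega> in M. \<omega> \<in> B (Suc k) \<longrightarrow> Q z \<omega>" for k
  proof -
    have "AE \<omega> in M. \<omega> \<in> B (Suc k) \<longrightarrow> (Q z \<omega> \<longleftrightarrow> Q (u (Suc k)) \<omega>)"
      using B by (intro local_onD[OF loc zV u] AE_I2 impI z) (simp add: msr_partition_def)
    moreover have "B (Suc k) \<subseteq> A k" using disjointed_subset[of A k] by (simp add: B_def)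
    ultimately show ?thesis
      using v(2)[of k] by (auto simp: u_def)
  qed
  then have "AE \<omega> in M. \<forall>k. \<omega> \<in> B (Suc k) \<longrightarrow> Q z \<omega>" unfolding AE_all_countable by blast
  moreover have "AE \<omega> in M. \<omega> \<in> ess_Sup M \<C> \<longrightarrow> \<omega> \<in> (\<Union>k. B (Suc k))"
    unfolding UB
    using \<K>(3) by (intro ess_Sup_least[OF \<C>]) (auto simp: is_ess_Sup_def)
  ultimately have "AE \<omega> in M. \<omega> \<in> ess_Sup M \<C> \<longrightarrow> Q z \<omega>" by eventually_elim blast
  with zV show ?thesis by blast
qed

section \<open>Conditional sets as local sets of pairs\<close>

definition local_set :: "'w measure \<Rightarrow> ('w \<Rightarrow> 'e) set \<Rightarrow> (('w \<Rightarrow> 'e) \<times> 'w) set \<Rightarrow> bool" where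
  "local_set M X E \<longleftrightarrow> E \<subseteq> X \<times> space M \<and> (\<forall>x\<in>X. {\<omega>. (x, \<omega>) \<in> E} \<in> sets M) \<and>
     local_on M X (\<lambda>x \<omega>. (x, \<omega>) \<in> E)"

text \<open>
  The conditional set with sections \<open>E\<^sub>x\<close>: its elements are the restrictions \<open>x|A\<close> such that \<open>x\<close>
  belongs to \<open>E\<close> on \<open>A\<close> and \<open>A\<close> contains all sections, i.e. \<open>A\<close> is the largest section. No
  representation \<open>V|A\<close> is chosen here, so \<open>cond_of\<close> depends on the sections only up to null sets.
\<close>

definition cond_of ::
  "'w measure \<Rightarrow> ('w \<Rightarrow> 'e) set \<Rightarrow> (('w \<Rightarrow> 'e) \<times> 'w) set \<Rightarrow> ('w \<rightharpoonup> 'e) set" where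
  "cond_of M X E = {g. \<exists>x\<in>X. \<exists>A\<in>sets M. (AE \<omega> in M. g \<omega> = restr x A \<omega>) \<and>
     (AE \<omega> in M. \<omega> \<in> A \<longrightarrow> (x, \<omega>) \<in> E) \<and> (\<forall>y\<in>X. AE \<omega> in M. (y, \<omega>) \<in> E \<longrightarrow> \<omega> \<in> A)}"

text \<open>
  A pointwise criterion for \<open>V|A\<close> to be the conditional set of \<open>E\<close>; see \<open>represents_cond_eq\<close> and
  \<open>cond_eq_represents\<close>. The third condition speaks of all events \<open>B\<close> and not only of \<open>A\<close>: in
  this form it produces the elements of \<open>V\<close> that are needed for gluing.
\<close>

definition represents ::
  "'w measure \<Rightarrow> ('w \<Rightarrow> 'e) set \<Rightarrow> (('w \<Rightarrow> 'e) \<times> 'w) set \<Rightarrow> ('w \<Rightarrow> 'e) set \<Rightarrow> 'w set \<Rightarrow> bool" where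
  "represents M X E V A \<longleftrightarrow>
     (\<forall>v\<in>V. AE \<omega> in M. \<omega> \<in> A \<longrightarrow> (v, \<omega>) \<in> E) \<and>
     (\<forall>x\<in>X. AE \<omega> in M. (x, \<omega>) \<in> E \<longrightarrow> \<omega> \<in> A) \<and>
     (\<forall>x\<in>X. \<forall>B\<in>sets M. (AE \<omega> in M. \<omega> \<in> B \<longrightarrow> (x, \<omega>) \<in> E) \<longrightarrow>
        (\<exists>v\<in>V. AE \<omega> in M. \<omega> \<in> B \<longrightarrow> v \<omega> = x \<omega>))"

lemma restr_apply: "restr x A \<omega> = (if \<omega> \<in> A then Some (x \<omega>) else None)"
  by (simp add: restr_def restrict_map_def)

lemma local_setI:
  assumes "E \<subseteq> X \<times> space M" "\<And>x. x \<in> X \<Longrightarrow> {\<omega>. (x, \<omega>) \<in> E} \<in> sets M"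
    "local_on M X (\<lambda>x \<omega>. (x, \<omega>) \<in> E)"
  shows "local_set M X E"
  using assms by (simp add: local_set_def)

lemma local_set_sub: "local_set M X E \<Longrightarrow> E \<subseteq> X \<times> space M"
  by (simp add: local_set_def)

lemma local_set_section: "local_set M X E \<Longrightarrow> x \<in> X \<Longrightarrow> {\<omega>. (x, \<omega>) \<in> E} \<in> sets M"
  by (simp add: local_set_def)

lemma local_set_local: "local_set M X E \<Longrightarrow> local_on M X (\<lambda>x \<omega>. (x, \<omega>) \<in> E)"
  by (simp add: local_set_def)

lemmas local_setD = local_onD[OF local_set_local]

lemma represents_inside: "represents M X E V A \<Longrightarrow> v \<in> V \<Longrightarrow> AE \<omega> in M. \<omega> \<in> A \<longrightarrow> (v, \<omega>) \<in> E"
  by (simp add: represents_def)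

lemma represents_support: "represents M X E V A \<Longrightarrow> x \<in> X \<Longrightarrow> AE \<omega> in M. (x, \<omega>) \<in> E \<longrightarrow> \<omega> \<in> A"
  by (simp add: represents_def)

lemma represents_attained:
  assumes "represents M X E V A" "x \<in> X" "B \<in> sets M" "AE \<omega> in M. \<omega> \<in> B \<longrightarrow> (x, \<omega>) \<in> E"
  obtains v where "v \<in> V" "AE \<omega> in M. \<omega> \<in> B \<longrightarrow> v \<omega> = x \<omega>"
  using assms unfolding represents_def by blast

lemma represents_cond_eq:
  assumes "V \<subseteq> X" "V \<noteq> {}" "A \<in> sets M" and rep: "represents M X E V A"
  shows "cond M V A = cond_of M X E"
proof (intro equalityI subsetI)
  fix g assume "g \<in> cond M V A"
  then obtain v where v: "v \<in> V" "AE \<omega> in M. g \<omega> = restr v A \<omega>" by (auto simp: cond_def)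
  show "g \<in> cond_of M X E"
    unfolding cond_of_def mem_Collect_eq
    using v assms(1,3) represents_inside[OF rep] represents_support[OF rep]
    by (intro bexI[of _ v] bexI[of _ A] conjI ballI) auto
next
  fix g assume "g \<in> cond_of M X E"
  then obtain x B where x: "x \<in> X" "B \<in> sets M" and g: "AE \<omega> in M. g \<omega> = restr x B \<omega>"
    and B: "AE \<omega> in M. \<omega> \<in> B \<longrightarrow> (x, \<omega>) \<in> E" "\<And>y. y \<in> X \<Longrightarrow> AE \<omega> in M. (y, \<omega>) \<in> E \<longrightarrow> \<omega> \<in> B"
    by (auto simp: cond_of_def)
  obtain v where v: "v \<in> V" "AE \<omega> in M. \<omega> \<in> B \<longrightarrow> v \<omega> = x \<omega>"
    using represents_attained[OF rep x B(1)] .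
  have "v \<in> X" using v assms(1) by blast
  have "AE \<omega> in M. g \<omega> = restr v A \<omega>"
    using g v(2) B(1) B(2)[OF \<open>v \<in> X\<close>] represents_inside[OF rep v(1)] represents_support[OF rep x(1)]
    by eventually_elim (auto simp: restr_apply)
  with v(1) show "g \<in> cond M V A" by (auto simp: cond_def)
qed

locale stable_base = prob_space M for M :: "'w measure" +
  fixes X :: "('w \<Rightarrow> 'e) set"
  assumes stable_X: "stable_set M X"
begin

lemma X_nonempty: "\<exists>x. x \<in> X"
  using stable_X by (auto simp: stable_set_def)

text \<open>
  An element \<open>x\<close> that belongs to \<open>E\<close> on \<open>B\<close> only is first extended outside \<open>B\<close> by an element of
  \<open>V\<close>. The extension belongs to \<open>E\<close> on all of \<open>A\<close>, and so it is an element of \<open>V|A\<close>.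
\<close>

lemma cond_eq_represents:
  assumes VX: "V \<subseteq> X" and "V \<noteq> {}" and A: "A \<in> sets M" and E: "local_set M X E"
    and eq: "cond M V A = cond_of M X E"
  shows "represents M X E V A"
proof -
  have 1: "AE \<omega> in M. \<omega> \<in> A \<longrightarrow> (v, \<omega>) \<in> E" and 2: "AE \<omega> in M. (y, \<omega>) \<in> E \<longrightarrow> \<omega> \<in> A"
    if v: "v \<in> V" and y: "y \<in> X" for v y
  proof -
    have "restr v A \<in> cond M V A" using v by (auto simp: cond_def)
    then obtain x B where x: "x \<in> X" "B \<in> sets M" and g: "AE \<omega> in M. restr v A \<omega> = restr x B \<omega>"
      and B: "AE \<omega> in M. \<omega> \<in> B \<longrightarrow> (x, \<omega>) \<in> E" "AE \<omega> in M. (y, \<omega>) \<in> E \<longrightarrow> \<omega> \<in> B"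
      using y unfolding eq cond_of_def by blast
    have g': "AE \<omega> in M. (\<omega> \<in> A \<longleftrightarrow> \<omega> \<in> B) \<and> (\<omega> \<in> A \<longrightarrow> v \<omega> = x \<omega>)"
      using g by eventually_elim (auto simp: restr_apply split: if_splits)
    then have "AE \<omega> in M. \<omega> \<in> A \<longrightarrow> v \<omega> = x \<omega>" by eventually_elim simp
    from local_setD[OF E _ x(1) A this] have "AE \<omega> in M. \<omega> \<in> A \<longrightarrow> ((v, \<omega>) \<in> E \<longleftrightarrow> (x, \<omega>) \<in> E)"
      using v VX by blast
    with g' B(1) show "AE \<omega> in M. \<omega> \<in> A \<longrightarrow> (v, \<omega>) \<in> E" by eventually_elim auto
    from g' B(2) show "AE \<omega> in M. (y, \<omega>) \<in> E \<longrightarrow> \<omega> \<in> A" by eventually_elim auto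
  qed
  obtain v0 where v0: "v0 \<in> V" using \<open>V \<noteq> {}\<close> by blast
  have v0X: "v0 \<in> X" using v0 VX by blast
  have 3: "\<exists>v\<in>V. AE \<omega> in M. \<omega> \<in> B \<longrightarrow> v \<omega> = x \<omega>"
    if x: "x \<in> X" and B: "B \<in> sets M" and BE: "AE \<omega> in M. \<omega> \<in> B \<longrightarrow> (x, \<omega>) \<in> E" for x B
  proof -
    define y where "y = (\<lambda>\<omega>. if \<omega> \<in> B then x \<omega> else v0 \<omega>)"
    have y: "y \<in> X" unfolding y_def by (rule stable_set_glue[OF stable_X x v0X B])
    have y1: "AE \<omega> in M. \<omega> \<in> B \<longrightarrow> ((y, \<omega>) \<in> E \<longleftrightarrow> (x, \<omega>) \<in> E)"
      by (rule local_setD[OF E y x B]) (simp add: y_def)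
    have y2: "AE \<omega> in M. \<omega> \<in> space M - B \<longrightarrow> ((y, \<omega>) \<in> E \<longleftrightarrow> (v0, \<omega>) \<in> E)"
      by (rule local_setD[OF E y v0X]) (use B in \<open>auto simp: y_def\<close>)
    have "AE \<omega> in M. \<omega> \<in> A \<longrightarrow> (y, \<omega>) \<in> E"
      using y1 y2 BE 1[OF v0 v0X] AE_space by eventually_elim auto
    then have "restr y A \<in> cond_of M X E"
      unfolding cond_of_def mem_Collect_eq using y A 2[OF v0]
      by (intro bexI[of _ y] bexI[of _ A] conjI ballI) auto
    then obtain v where v: "v \<in> V" "AE \<omega> in M. restr y A \<omega> = restr v A \<omega>"
      unfolding eq[symmetric] cond_def by blast
    have "AE \<omega> in M. \<omega> \<in> B \<longrightarrow> v \<omega> = x \<omega>"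
      using v(2) BE 2[OF v0 x] by eventually_elim (auto simp: restr_apply y_def split: if_splits)
    with v(1) show ?thesis by blast
  qed
  show ?thesis
    unfolding represents_def
  proof (intro conjI ballI impI)
    show "AE \<omega> in M. \<omega> \<in> A \<longrightarrow> (v, \<omega>) \<in> E" if "v \<in> V" for v by (rule 1[OF that v0X])
    show "AE \<omega> in M. (x, \<omega>) \<in> E \<longrightarrow> \<omega> \<in> A" if "x \<in> X" for x by (rule 2[OF v0 that])
    show "\<exists>v\<in>V. AE \<omega> in M. \<omega> \<in> B \<longrightarrow> v \<omega> = x \<omega>"
      if "x \<in> X" "B \<in> sets M" "AE \<omega> in M. \<omega> \<in> B \<longrightarrow> (x, \<omega>) \<in> E" for x B by (rule 3[OF that])
  qed
qed

lemma stable_subsetsD: "V \<in> stable_subsets M X \<Longrightarrow> V \<subseteq> X \<and> V \<noteq> {} \<and> stable_set M V"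
  by (auto simp: stable_subsets_def stable_set_def)

text \<open>
  The event \<open>A\<close> is the essential supremum of the sections of \<open>E\<close>, and \<open>V\<close> consists of the elements whose
  section is all of \<open>A\<close>. As \<open>X\<close> is stable, the essential supremum is attained, so \<open>V\<close> is nonempty.
\<close>

lemma local_set_represented:
  assumes E: "local_set M X E"
  shows "\<exists>V A. V \<in> stable_subsets M X \<and> A \<in> sets M \<and> represents M X E V A"
proof -
  let ?\<C> = "(\<lambda>x. {\<omega>. (x, \<omega>) \<in> E}) ` X"
  define A where "A = ess_Sup M ?\<C>"
  have \<C>: "?\<C> \<subseteq> sets M" using local_set_section[OF E] by blast
  have A: "A \<in> sets M" unfolding A_def by (rule ess_Sup_measurable[OF \<C>])
  define V where "V = {x\<in>X. AE \<omega> in M. \<omega> \<in> A \<longrightarrow> (x, \<omega>) \<in> E}"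
  have "\<exists>v\<in>X. AE \<omega> in M. \<omega> \<in> A \<longrightarrow> (v, \<omega>) \<in> E"
    unfolding A_def
    by (rule ess_Sup_attained[OF stable_X local_set_local[OF E] \<C>]) auto
  then obtain v where v: "v \<in> V" unfolding V_def by blast
  have "stable_set M V"
    unfolding stable_set_def
  proof (intro conjI allI impI; (elim conjE)?)
    show "V \<noteq> {}" using v by blast
    fix P x z assume P: "msr_partition M P" and x: "\<forall>k. x k \<in> V" and z: "is_concat M P x z"
    have xX: "x k \<in> X" for k using x by (simp add: V_def)
    have zX: "z \<in> X" by (rule stable_set_concat[OF stable_X P xX z])
    have "AE \<omega> in M. \<omega> \<in> A \<longrightarrow> \<omega> \<in> P k \<longrightarrow> (z, \<omega>) \<in> E" for k
    proof -
      have "AE \<omega> in M. \<omega> \<in> P k \<longrightarrow> ((z, \<omega>) \<in> E \<longleftrightarrow> (x k, \<omega>) \<in> E)"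
        by (rule local_setD[OF E zX xX]) (use P z in \<open>simp_all add: msr_partition_def is_concat_def\<close>)
      moreover have "AE \<omega> in M. \<omega> \<in> A \<longrightarrow> (x k, \<omega>) \<in> E" using x by (simp add: V_def)
      ultimately show ?thesis by eventually_elim blast
    qed
    then have "AE \<omega> in M. \<forall>k. \<omega> \<in> A \<longrightarrow> \<omega> \<in> P k \<longrightarrow> (z, \<omega>) \<in> E" unfolding AE_all_countable by blast
    then have "AE \<omega> in M. \<omega> \<in> A \<longrightarrow> (z, \<omega>) \<in> E"
      using AE_space by eventually_elim (use P in \<open>auto simp: msr_partition_def\<close>)
    with zX show "z \<in> V" by (simp add: V_def)
  qed
  then have "V \<in> stable_subsets M X" by (auto simp: stable_subsets_def V_def)
  moreover have "represents M X E V A"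
    unfolding represents_def
  proof (intro conjI ballI impI)
    show "AE \<omega> in M. \<omega> \<in> A \<longrightarrow> (v, \<omega>) \<in> E" if "v \<in> V" for v using that by (simp add: V_def)
    show upper: "AE \<omega> in M. (x, \<omega>) \<in> E \<longrightarrow> \<omega> \<in> A" if "x \<in> X" for x
      using ess_Sup_upper[OF \<C> imageI[OF that]] by (simp add: A_def)
    fix x B assume x: "x \<in> X" and B: "B \<in> sets M" and BE: "AE \<omega> in M. \<omega> \<in> B \<longrightarrow> (x, \<omega>) \<in> E"
    define y where "y = (\<lambda>\<omega>. if \<omega> \<in> B then x \<omega> else v \<omega>)"
    have vX: "v \<in> X" using v by (simp add: V_def)
    have y: "y \<in> X" unfolding y_def by (rule stable_set_glue[OF stable_X x vX B])
    have y1: "AE \<omega> in M. \<omega> \<in> B \<longrightarrow> ((y, \<omega>) \<in> E \<longleftrightarrow> (x, \<omega>) \<in> E)"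
      by (rule local_setD[OF E y x B]) (simp add: y_def)
    have y2: "AE \<omega> in M. \<omega> \<in> space M - B \<longrightarrow> ((y, \<omega>) \<in> E \<longleftrightarrow> (v, \<omega>) \<in> E)"
      by (rule local_setD[OF E y vX]) (use B in \<open>auto simp: y_def\<close>)
    have "AE \<omega> in M. \<omega> \<in> A \<longrightarrow> (v, \<omega>) \<in> E" using v by (simp add: V_def)
    then have "AE \<omega> in M. \<omega> \<in> A \<longrightarrow> (y, \<omega>) \<in> E"
      using y1 y2 BE AE_space by eventually_elim auto
    with y have "y \<in> V" by (simp add: V_def)
    then show "\<exists>v\<in>V. AE \<omega> in M. \<omega> \<in> B \<longrightarrow> v \<omega> = x \<omega>" by (intro bexI[of _ y]) (simp_all add: y_def)
  qed
  ultimately show ?thesis using A by blast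
qed

lemma local_set_cond:
  assumes E: "local_set M X E"
  obtains V A where "V \<in> stable_subsets M X" "A \<in> sets M" "cond M V A = cond_of M X E"
    "represents M X E V A"
proof -
  obtain V A where VA: "V \<in> stable_subsets M X" "A \<in> sets M" "represents M X E V A"
    using local_set_represented[OF E] by blast
  moreover have "cond M V A = cond_of M X E"
    using stable_subsetsD[OF VA(1)] VA by (intro represents_cond_eq) auto
  ultimately show thesis using that by blast
qed

lemma local_sets_cond_sequence:
  assumes "\<And>k :: nat. local_set M X (E k)"
  obtains V B where "\<forall>k. V k \<in> stable_subsets M X" "\<forall>k. B k \<in> sets M"
    "\<forall>k. cond M (V k) (B k) = cond_of M X (E k)"
proof -
  have "\<exists>VB. fst VB \<in> stable_subsets M X \<and> snd VB \<in> sets M \<and>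
      cond M (fst VB) (snd VB) = cond_of M X (E k)" for k
  proof -
    obtain V B where "V \<in> stable_subsets M X" "B \<in> sets M" "cond M V B = cond_of M X (E k)"
      by (rule local_set_cond[OF assms])
    then show ?thesis by (intro exI[of _ "(V, B)"]) simp
  qed
  then have "\<forall>k. \<exists>VB. fst VB \<in> stable_subsets M X \<and> snd VB \<in> sets M \<and>
      cond M (fst VB) (snd VB) = cond_of M X (E k)" ..
  from choice[OF this] obtain VB where "\<forall>k. fst (VB k) \<in> stable_subsets M X \<and>
      snd (VB k) \<in> sets M \<and> cond M (fst (VB k)) (snd (VB k)) = cond_of M X (E k)" ..
  then show thesis using that[of "\<lambda>k. fst (VB k)" "\<lambda>k. snd (VB k)"] by simp
qed

lemma cond_of_in_cond_subsets: "local_set M X E \<Longrightarrow> cond_of M X E \<in> cond_subsets M X"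
  by (erule local_set_cond) (auto simp: cond_subsets_def)

text \<open>
  The local set of a given \<open>V|A\<close>; its indicator is the stable indicator function.
\<close>

definition indicator_set :: "('w \<Rightarrow> 'e) set \<Rightarrow> 'w set \<Rightarrow> (('w \<Rightarrow> 'e) \<times> 'w) set" where
  "indicator_set V A = {(x, \<omega>). x \<in> X \<and>
     \<omega> \<in> ess_Sup M {A' \<in> sets M. A' \<subseteq> A \<and> restr x A' \<in> cond M V A'}}"

lemma restr_in_cond_iff:
  "restr x B \<in> cond M V B \<longleftrightarrow> (\<exists>v\<in>V. AE \<omega> in M. \<omega> \<in> B \<longrightarrow> v \<omega> = x \<omega>)"
proof -
  have "(restr x B \<omega> = restr v B \<omega>) = (\<omega> \<in> B \<longrightarrow> v \<omega> = x \<omega>)" for v \<omega>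
    by (auto simp: restr_apply)
  then show ?thesis by (simp add: cond_def)
qed

text \<open>
  Locality holds since an event on which \<open>x\<close> lies in \<open>V|A\<close>, intersected with an event on which \<open>x = y\<close>,
  is an event on which \<open>y\<close> lies in \<open>V|A\<close>. Since \<open>V\<close> is stable, the essential supremum that defines a section
  is itself an event on which \<open>x\<close> lies in \<open>V|A\<close>.
\<close>

lemma
  assumes V: "V \<in> stable_subsets M X" and A: "A \<in> sets M"
  shows local_set_indicator_set: "local_set M X (indicator_set V A)"
    and represents_indicator_set: "represents M X (indicator_set V A) V A"
proof -
  define \<C> where "\<C> x = {A' \<in> sets M. A' \<subseteq> A \<and> restr x A' \<in> cond M V A'}" for x
  have \<C>: "\<C> x \<subseteq> sets M" for x by (auto simp: \<C>_def)
  have mem: "(x, \<omega>) \<in> indicator_set V A \<longleftrightarrow> x \<in> X \<and> \<omega> \<in> ess_Sup M (\<C> x)" for x \<omega>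
    by (simp add: indicator_set_def \<C>_def)
  note V' = stable_subsetsD[OF V]
  have half: "AE \<omega> in M. \<omega> \<in> B \<longrightarrow> \<omega> \<in> ess_Sup M (\<C> x) \<longrightarrow> \<omega> \<in> ess_Sup M (\<C> y)"
    if B: "B \<in> sets M" and xy: "AE \<omega> in M. \<omega> \<in> B \<longrightarrow> x \<omega> = y \<omega>" for x y B
  proof -
    have "AE \<omega> in M. \<omega> \<in> ess_Sup M (\<C> x) \<longrightarrow> \<omega> \<in> ess_Sup M (\<C> y) \<union> (space M - B)"
    proof (rule ess_Sup_least[OF \<C>])
      show "ess_Sup M (\<C> y) \<union> (space M - B) \<in> sets M" using B ess_Sup_measurable[OF \<C>] by auto
      fix A' assume "A' \<in> \<C> x"
      then have A': "A' \<in> sets M" "A' \<subseteq> A" "restr x A' \<in> cond M V A'" by (auto simp: \<C>_def)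
      then obtain v where v: "v \<in> V" "AE \<omega> in M. \<omega> \<in> A' \<longrightarrow> v \<omega> = x \<omega>"
        unfolding restr_in_cond_iff by blast
      have "AE \<omega> in M. \<omega> \<in> A' \<inter> B \<longrightarrow> v \<omega> = y \<omega>" using v(2) xy by eventually_elim auto
      then have "A' \<inter> B \<in> \<C> y" using A' B v(1) by (auto simp: \<C>_def restr_in_cond_iff)
      from ess_Sup_upper[OF \<C> this] AE_space
      show "AE \<omega> in M. \<omega> \<in> A' \<longrightarrow> \<omega> \<in> ess_Sup M (\<C> y) \<union> (space M - B)" by eventually_elim auto
    qed
    then show ?thesis by eventually_elim auto
  qed
  show "local_set M X (indicator_set V A)"
  proof (rule local_setI)
    show "indicator_set V A \<subseteq> X \<times> space M"
      using sets.sets_into_space[OF ess_Sup_measurable[OF \<C>]] mem by auto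
    show "{\<omega>. (x, \<omega>) \<in> indicator_set V A} \<in> sets M" if "x \<in> X" for x
      using that ess_Sup_measurable[OF \<C>] by (simp add: mem)
    show "local_on M X (\<lambda>x \<omega>. (x, \<omega>) \<in> indicator_set V A)"
      unfolding local_on_def
    proof (intro ballI impI)
      fix x y B assume xy: "x \<in> X" "y \<in> X" "B \<in> sets M" "AE \<omega> in M. \<omega> \<in> B \<longrightarrow> x \<omega> = y \<omega>"
      then have yx: "AE \<omega> in M. \<omega> \<in> B \<longrightarrow> y \<omega> = x \<omega>" by (auto simp: eq_commute)
      show "AE \<omega> in M. \<omega> \<in> B \<longrightarrow> ((x, \<omega>) \<in> indicator_set V A) = ((y, \<omega>) \<in> indicator_set V A)"
        using half[OF xy(3,4)] half[OF xy(3) yx] by eventually_elim (use xy in \<open>auto simp: mem\<close>)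
    qed
  qed
  show "represents M X (indicator_set V A) V A"
    unfolding represents_def
  proof (intro conjI ballI impI)
    show "AE \<omega> in M. \<omega> \<in> A \<longrightarrow> (v, \<omega>) \<in> indicator_set V A" if v: "v \<in> V" for v
    proof -
      have "A \<in> \<C> v" using A v by (auto simp: \<C>_def restr_in_cond_iff)
      from ess_Sup_upper[OF \<C> this] show ?thesis using v V' by (auto simp: mem)
    qed
    show "AE \<omega> in M. (x, \<omega>) \<in> indicator_set V A \<longrightarrow> \<omega> \<in> A" if "x \<in> X" for x
    proof -
      have "AE \<omega> in M. \<omega> \<in> ess_Sup M (\<C> x) \<longrightarrow> \<omega> \<in> A"
        by (rule ess_Sup_least[OF \<C> A]) (auto simp: \<C>_def)
      then show ?thesis by eventually_elim (simp add: mem)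
    qed
    fix x B assume x: "x \<in> X" and B: "B \<in> sets M"
      and BE: "AE \<omega> in M. \<omega> \<in> B \<longrightarrow> (x, \<omega>) \<in> indicator_set V A"
    have "\<exists>v\<in>V. AE \<omega> in M. \<omega> \<in> ess_Sup M (\<C> x) \<longrightarrow> v \<omega> = x \<omega>"
    proof (rule ess_Sup_attained[OF _ _ \<C>])
      show "stable_set M V" using V' by blast
      show "local_on M V (\<lambda>v \<omega>. v \<omega> = x \<omega>)"
        unfolding local_on_def by (intro ballI impI) (auto elim: eventually_mono)
      show "\<exists>v\<in>V. AE \<omega> in M. \<omega> \<in> A' \<longrightarrow> v \<omega> = x \<omega>" if "A' \<in> \<C> x" for A'
        using that by (simp add: \<C>_def restr_in_cond_iff)
    qed
    then obtain v where v: "v \<in> V" "AE \<omega> in M. \<omega> \<in> ess_Sup M (\<C> x) \<longrightarrow> v \<omega> = x \<omega>" by blast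
    have "AE \<omega> in M. \<omega> \<in> B \<longrightarrow> v \<omega> = x \<omega>" using v(2) BE by eventually_elim (simp add: mem)
    with v(1) show "\<exists>v\<in>V. AE \<omega> in M. \<omega> \<in> B \<longrightarrow> v \<omega> = x \<omega>" by blast
  qed
qed

lemma cond_eq_indicator_set:
  assumes V: "V \<in> stable_subsets M X" and A: "A \<in> sets M"
  shows "cond M V A = cond_of M X (indicator_set V A)"
  using stable_subsetsD[OF V] A represents_indicator_set[OF V A] by (intro represents_cond_eq) auto

lemma cond_subsets_iff: "P \<in> cond_subsets M X \<longleftrightarrow> (\<exists>E. local_set M X E \<and> P = cond_of M X E)"
proof
  assume "P \<in> cond_subsets M X"
  then obtain V A where VA: "V \<in> stable_subsets M X" "A \<in> sets M" "P = cond M V A"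
    by (auto simp: cond_subsets_def)
  then show "\<exists>E. local_set M X E \<and> P = cond_of M X E"
    using local_set_indicator_set[OF VA(1,2)] cond_eq_indicator_set[OF VA(1,2)] by blast
qed (auto simp: cond_of_in_cond_subsets)

lemma stable_indicator_eq:
  "x \<in> X \<Longrightarrow> stable_indicator M V A x \<omega> = indicator (indicator_set V A) (x, \<omega>)"
  by (simp add: stable_indicator_def indicator_set_def indicator_def)


section \<open>The Boolean operations on conditional sets\<close>

lemma local_set_diff:
  assumes E: "local_set M X E" and F: "local_set M X F"
  shows "local_set M X (E - F)"
proof (rule local_setI)
  show "{\<omega>. (x, \<omega>) \<in> E - F} \<in> sets M" if "x \<in> X" for x
  proof -
    have "{\<omega>. (x, \<omega>) \<in> E - F} = {\<omega>. (x, \<omega>) \<in> E} - {\<omega>. (x, \<omega>) \<in> F}" by auto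
    then show ?thesis using local_set_section[OF E that] local_set_section[OF F that] by auto
  qed
  show "local_on M X (\<lambda>x \<omega>. (x, \<omega>) \<in> E - F)"
    unfolding local_on_def
  proof (intro ballI impI)
    fix x y B assume *: "x \<in> X" "y \<in> X" "B \<in> sets M" "AE \<omega> in M. \<omega> \<in> B \<longrightarrow> x \<omega> = y \<omega>"
    show "AE \<omega> in M. \<omega> \<in> B \<longrightarrow> ((x, \<omega>) \<in> E - F) = ((y, \<omega>) \<in> E - F)"
      using local_setD[OF E *] local_setD[OF F *] by eventually_elim auto
  qed
qed (use local_set_sub[OF E] in auto)

lemma local_set_Union:
  assumes "countable \<E>" and \<E>: "\<And>E. E \<in> \<E> \<Longrightarrow> local_set M X E"
  shows "local_set M X (\<Union>\<E>)"
proof (rule local_setI)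
  show "\<Union>\<E> \<subseteq> X \<times> space M" using local_set_sub[OF \<E>] by blast
  show "{\<omega>. (x, \<omega>) \<in> \<Union>\<E>} \<in> sets M" if "x \<in> X" for x
  proof -
    have "{\<omega>. (x, \<omega>) \<in> \<Union>\<E>} = (\<Union>E\<in>\<E>. {\<omega>. (x, \<omega>) \<in> E})" by auto
    then show ?thesis using local_set_section[OF \<E> that] assms(1) by (auto intro!: sets.countable_UN')
  qed
  show "local_on M X (\<lambda>x \<omega>. (x, \<omega>) \<in> \<Union>\<E>)"
    unfolding local_on_def
  proof (intro ballI impI)
    fix x y B assume *: "x \<in> X" "y \<in> X" "B \<in> sets M" "AE \<omega> in M. \<omega> \<in> B \<longrightarrow> x \<omega> = y \<omega>"
    have "AE \<omega> in M. \<forall>E\<in>\<E>. \<omega> \<in> B \<longrightarrow> ((x, \<omega>) \<in> E) = ((y, \<omega>) \<in> E)"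
      using local_setD[OF \<E> *] assms(1) by (subst AE_ball_countable) auto
    then show "AE \<omega> in M. \<omega> \<in> B \<longrightarrow> ((x, \<omega>) \<in> \<Union>\<E>) = ((y, \<omega>) \<in> \<Union>\<E>)"
      by eventually_elim auto
  qed
qed

lemma local_set_product:
  assumes "B \<in> sets M"
  shows "local_set M X (X \<times> B)"
proof (rule local_setI)
  show "X \<times> B \<subseteq> X \<times> space M" using sets.sets_into_space[OF assms] by auto
  show "{\<omega>. (x, \<omega>) \<in> X \<times> B} \<in> sets M" if "x \<in> X" for x using that assms by simp
qed (simp add: local_on_def)

lemma local_set_empty: "local_set M X {}"
  using local_set_product[of "{}"] by simp

lemma local_set_Int: "local_set M X E \<Longrightarrow> local_set M X F \<Longrightarrow> local_set M X (E \<inter> F)"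
  using local_set_diff[of E "E - F"] local_set_diff[of E F] by (simp add: Diff_Diff_Int)

lemma local_set_Un: "local_set M X E \<Longrightarrow> local_set M X F \<Longrightarrow> local_set M X (E \<union> F)"
  using local_set_Union[of "{E, F}"] by auto

definition section_le :: "(('w \<Rightarrow> 'e) \<times> 'w) set \<Rightarrow> (('w \<Rightarrow> 'e) \<times> 'w) set \<Rightarrow> bool" where
  "section_le E F \<longleftrightarrow> (\<forall>x\<in>X. AE \<omega> in M. (x, \<omega>) \<in> E \<longrightarrow> (x, \<omega>) \<in> F)"

lemma section_le_refl: "section_le E E"
  by (simp add: section_le_def)

lemma section_le_subset: "E \<subseteq> F \<Longrightarrow> section_le E F"
  by (auto simp: section_le_def)

lemma section_le_represents:
  assumes E: "local_set M X E" and F: "local_set M X F" and le: "section_le E F" "section_le F E"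
    and rep: "represents M X E V A" and "V \<subseteq> X"
  shows "represents M X F V A"
  unfolding represents_def
proof (intro conjI ballI impI)
  show "AE \<omega> in M. \<omega> \<in> A \<longrightarrow> (v, \<omega>) \<in> F" if "v \<in> V" for v
  proof -
    have "AE \<omega> in M. (v, \<omega>) \<in> E \<longrightarrow> (v, \<omega>) \<in> F"
      using le(1) that \<open>V \<subseteq> X\<close> by (auto simp: section_le_def)
    with represents_inside[OF rep that] show ?thesis by eventually_elim blast
  qed
  show "AE \<omega> in M. (x, \<omega>) \<in> F \<longrightarrow> \<omega> \<in> A" if "x \<in> X" for x
  proof -
    have "AE \<omega> in M. (x, \<omega>) \<in> F \<longrightarrow> (x, \<omega>) \<in> E" using le(2) that by (simp add: section_le_def)
    with represents_support[OF rep that] show ?thesis by eventually_elim blast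
  qed
  fix x B assume x: "x \<in> X" and B: "B \<in> sets M" and BF: "AE \<omega> in M. \<omega> \<in> B \<longrightarrow> (x, \<omega>) \<in> F"
  have "AE \<omega> in M. (x, \<omega>) \<in> F \<longrightarrow> (x, \<omega>) \<in> E" using le(2) x by (simp add: section_le_def)
  with BF have "AE \<omega> in M. \<omega> \<in> B \<longrightarrow> (x, \<omega>) \<in> E" by eventually_elim blast
  from represents_attained[OF rep x B this] show "\<exists>v\<in>V. AE \<omega> in M. \<omega> \<in> B \<longrightarrow> v \<omega> = x \<omega>" by blast
qed

lemma cond_of_eqI:
  assumes E: "local_set M X E" and F: "local_set M X F" and le: "section_le E F" "section_le F E"
  shows "cond_of M X E = cond_of M X F"
proof -
  obtain V A where VA: "V \<in> stable_subsets M X" "A \<in> sets M" "cond M V A = cond_of M X E"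
    "represents M X E V A" using local_set_cond[OF E] .
  note V = stable_subsetsD[OF VA(1)]
  have "cond M V A = cond_of M X F"
    using V VA(2) section_le_represents[OF E F le VA(4)] by (intro represents_cond_eq) auto
  with VA(3) show ?thesis by simp
qed

text \<open>
  The conditional sets with the order \<open>\<sqsubseteq>\<close> are thereby isomorphic to the local sets, up to sectionwise
  null sets, with inclusion. All lattice operations below are read off from this.
\<close>

lemma cond_le_iff:
  assumes E: "local_set M X E" and F: "local_set M X F"
  shows "cond_le M X (cond_of M X E) (cond_of M X F) \<longleftrightarrow> section_le E F"
proof
  assume "cond_le M X (cond_of M X E) (cond_of M X F)"
  then obtain V W A B where V: "V \<in> stable_subsets M X" and W: "W \<in> stable_subsets M X"
    and A: "A \<in> sets M" and B: "B \<in> sets M"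
    and eq: "cond_of M X E = cond M V A" "cond_of M X F = cond M W B"
    and AB: "AE \<omega> in M. \<omega> \<in> A \<longrightarrow> \<omega> \<in> B" and sub: "cond M V A \<subseteq> cond M W A"
    unfolding cond_le_def by blast
  note V' = stable_subsetsD[OF V] and W' = stable_subsetsD[OF W]
  have rE: "represents M X E V A"
    using V' by (intro cond_eq_represents A E eq(1)[symmetric]) auto
  have rF: "represents M X F W B"
    using W' by (intro cond_eq_represents B F eq(2)[symmetric]) auto
  show "section_le E F"
    unfolding section_le_def
  proof
    fix x assume x: "x \<in> X"
    have Ex: "{\<omega>. (x, \<omega>) \<in> E} \<in> sets M" by (rule local_set_section[OF E x])
    obtain v where v: "v \<in> V" "AE \<omega> in M. \<omega> \<in> {\<omega>. (x, \<omega>) \<in> E} \<longrightarrow> v \<omega> = x \<omega>"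
      by (rule represents_attained[OF rE x Ex]) auto
    have "restr v A \<in> cond M V A" using v(1) by (auto simp: cond_def)
    then have "restr v A \<in> cond M W A" using sub by blast
    then obtain w where w: "w \<in> W" "AE \<omega> in M. \<omega> \<in> A \<longrightarrow> w \<omega> = v \<omega>" unfolding restr_in_cond_iff by blast
    have "w \<in> X" using w(1) W' by blast
    moreover have "AE \<omega> in M. \<omega> \<in> {\<omega>. (x, \<omega>) \<in> E} \<longrightarrow> w \<omega> = x \<omega>"
      using w(2) v(2) represents_support[OF rE x] by eventually_elim auto
    ultimately have "AE \<omega> in M. \<omega> \<in> {\<omega>. (x, \<omega>) \<in> E} \<longrightarrow> ((w, \<omega>) \<in> F \<longleftrightarrow> (x, \<omega>) \<in> F)"
      using x Ex by (intro local_setD[OF F]) auto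
    with AB represents_support[OF rE x] represents_inside[OF rF w(1)]
    show "AE \<omega> in M. (x, \<omega>) \<in> E \<longrightarrow> (x, \<omega>) \<in> F" by eventually_elim auto
  qed
next
  assume le: "section_le E F"
  obtain V A where V: "V \<in> stable_subsets M X" and A: "A \<in> sets M" and eqE: "cond M V A = cond_of M X E"
    and rE: "represents M X E V A" using local_set_cond[OF E] .
  obtain W B where W: "W \<in> stable_subsets M X" and B: "B \<in> sets M" and eqF: "cond M W B = cond_of M X F"
    and rF: "represents M X F W B" using local_set_cond[OF F] .
  note V' = stable_subsetsD[OF V] and W' = stable_subsetsD[OF W]
  have VF: "AE \<omega> in M. \<omega> \<in> A \<longrightarrow> (v, \<omega>) \<in> F" if "v \<in> V" for v
  proof -
    have "AE \<omega> in M. (v, \<omega>) \<in> E \<longrightarrow> (v, \<omega>) \<in> F"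
      using le V' that by (auto simp: section_le_def)
    with represents_inside[OF rE that] show ?thesis by eventually_elim blast
  qed
  have "AE \<omega> in M. \<omega> \<in> A \<longrightarrow> \<omega> \<in> B"
  proof -
    obtain v where v: "v \<in> V" using V' by blast
    then have "v \<in> X" using V' by blast
    from represents_support[OF rF this] VF[OF v] show ?thesis by eventually_elim blast
  qed
  moreover have "cond M V A \<subseteq> cond M W A"
  proof
    fix g assume "g \<in> cond M V A"
    then obtain v where v: "v \<in> V" "AE \<omega> in M. g \<omega> = restr v A \<omega>" by (auto simp: cond_def)
    have "v \<in> X" using v(1) V' by blast
    from represents_attained[OF rF this A VF[OF v(1)]] obtain w where
      w: "w \<in> W" "AE \<omega> in M. \<omega> \<in> A \<longrightarrow> w \<omega> = v \<omega>" .
    have "AE \<omega> in M. g \<omega> = restr w A \<omega>" using v(2) w(2) by eventually_elim (simp add: restr_apply)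
    with w(1) show "g \<in> cond M W A" by (auto simp: cond_def)
  qed
  ultimately show "cond_le M X (cond_of M X E) (cond_of M X F)"
    unfolding cond_le_def using V W A B eqE eqF by blast
qed

lemma cond_of_eq_iff:
  assumes E: "local_set M X E" and F: "local_set M X F"
  shows "cond_of M X E = cond_of M X F \<longleftrightarrow> section_le E F \<and> section_le F E"
  using cond_of_eqI[OF E F] cond_le_iff[OF E E] cond_le_iff[OF E F] cond_le_iff[OF F E] section_le_refl
  by metis

text \<open>
  Countability is essential: an uncountable union of sections need not be measurable, and it is not
  determined by the sections up to null sets.
\<close>

lemma cond_Sup_eq:
  assumes "countable \<E>" and \<E>: "\<And>E. E \<in> \<E> \<Longrightarrow> local_set M X E"
  shows "\<Squnion>\<^bsub>cond_order M X\<^esub>(cond_of M X ` \<E>) = cond_of M X (\<Union>\<E>)"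
proof -
  let ?L = "cond_order M X" and ?U = "cond_of M X (\<Union>\<E>)"
  have U: "local_set M X (\<Union>\<E>)" by (rule local_set_Union[OF assms])
  have Upper: "cond_of M X F \<in> Upper ?L (cond_of M X ` \<E>) \<longleftrightarrow> (\<forall>E\<in>\<E>. section_le E F)"
    if "local_set M X F" for F
    using cond_of_in_cond_subsets[OF that] cond_of_in_cond_subsets[OF \<E>] cond_le_iff[OF \<E> that]
    by (auto simp: Upper_def cond_order_def)
  have carrier: "\<exists>F. local_set M X F \<and> P = cond_of M X F" if "P \<in> Upper ?L (cond_of M X ` \<E>)" for P
    using that by (auto simp: Upper_def cond_order_def cond_subsets_iff)
  have least: "least ?L ?U (Upper ?L (cond_of M X ` \<E>))"
    unfolding least_def
  proof (intro conjI ballI)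
    show "Upper ?L (cond_of M X ` \<E>) \<subseteq> carrier ?L" by (auto simp: Upper_def)
    show "?U \<in> Upper ?L (cond_of M X ` \<E>)"
      unfolding Upper[OF U] by (auto intro: section_le_subset)
    fix P assume P: "P \<in> Upper ?L (cond_of M X ` \<E>)"
    then obtain F where F: "local_set M X F" "P = cond_of M X F" using carrier by blast
    then have le: "\<forall>E\<in>\<E>. section_le E F" using P Upper[OF F(1)] by simp
    have "section_le (\<Union>\<E>) F"
      unfolding section_le_def
    proof
      fix x assume "x \<in> X"
      then have "AE \<omega> in M. \<forall>E\<in>\<E>. (x, \<omega>) \<in> E \<longrightarrow> (x, \<omega>) \<in> F"
        using le assms(1) by (subst AE_ball_countable) (auto simp: section_le_def)
      then show "AE \<omega> in M. (x, \<omega>) \<in> \<Union>\<E> \<longrightarrow> (x, \<omega>) \<in> F" by eventually_elim blast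
    qed
    then show "?U \<sqsubseteq>\<^bsub>?L\<^esub> P" using cond_le_iff[OF U F(1)] by (simp add: cond_order_def F(2))
  qed
  show ?thesis
    unfolding sup_def
  proof (rule some_equality)
    fix P assume P: "least ?L P (Upper ?L (cond_of M X ` \<E>))"
    then have PU: "P \<in> Upper ?L (cond_of M X ` \<E>)" by (simp add: least_def)
    then obtain F where F: "local_set M X F" "P = cond_of M X F" using carrier by blast
    have "P \<sqsubseteq>\<^bsub>?L\<^esub> ?U" "?U \<sqsubseteq>\<^bsub>?L\<^esub> P" using P PU least by (auto simp: least_def)
    then show "P = ?U"
      using cond_le_iff[OF U F(1)] cond_le_iff[OF F(1) U] cond_of_eqI[OF F(1) U]
      by (simp add: cond_order_def F(2))
  qed (rule least)
qed

lemma cond_join_eq: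
  assumes "local_set M X E" "local_set M X F"
  shows "cond_of M X E \<squnion>\<^bsub>cond_order M X\<^esub> cond_of M X F = cond_of M X (E \<union> F)"
  using cond_Sup_eq[of "{E, F}"] assms by (auto simp: join_def)

lemma cond_meet_eq:
  assumes E: "local_set M X E" and F: "local_set M X F"
  shows "cond_of M X E \<sqinter>\<^bsub>cond_order M X\<^esub> cond_of M X F = cond_of M X (E \<inter> F)"
proof -
  let ?L = "cond_order M X" and ?I = "cond_of M X (E \<inter> F)" and ?S = "{cond_of M X E, cond_of M X F}"
  have I: "local_set M X (E \<inter> F)" by (rule local_set_Int[OF E F])
  have Lower: "cond_of M X G \<in> Lower ?L ?S \<longleftrightarrow> section_le G E \<and> section_le G F"
    if "local_set M X G" for G
    using cond_of_in_cond_subsets[OF that] cond_of_in_cond_subsets[OF E] cond_of_in_cond_subsets[OF F]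
      cond_le_iff[OF that E] cond_le_iff[OF that F]
    by (auto simp: Lower_def cond_order_def)
  have carrier: "\<exists>G. local_set M X G \<and> P = cond_of M X G" if "P \<in> Lower ?L ?S" for P
    using that by (auto simp: Lower_def cond_order_def cond_subsets_iff)
  have greatest: "greatest ?L ?I (Lower ?L ?S)"
    unfolding greatest_def
  proof (intro conjI ballI)
    show "Lower ?L ?S \<subseteq> carrier ?L" by (auto simp: Lower_def)
    show "?I \<in> Lower ?L ?S" unfolding Lower[OF I] by (auto intro: section_le_subset)
    fix P assume P: "P \<in> Lower ?L ?S"
    then obtain G where G: "local_set M X G" "P = cond_of M X G" using carrier by blast
    then have le: "section_le G E" "section_le G F" using P Lower[OF G(1)] by simp_all
    have "section_le G (E \<inter> F)"
      unfolding section_le_def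
    proof
      fix x assume "x \<in> X"
      then have "AE \<omega> in M. (x, \<omega>) \<in> G \<longrightarrow> (x, \<omega>) \<in> E" "AE \<omega> in M. (x, \<omega>) \<in> G \<longrightarrow> (x, \<omega>) \<in> F"
        using le by (simp_all add: section_le_def)
      then show "AE \<omega> in M. (x, \<omega>) \<in> G \<longrightarrow> (x, \<omega>) \<in> E \<inter> F" by eventually_elim blast
    qed
    then show "P \<sqsubseteq>\<^bsub>?L\<^esub> ?I" using cond_le_iff[OF G(1) I] by (simp add: cond_order_def G(2))
  qed
  show ?thesis
    unfolding meet_def inf_def
  proof (rule some_equality)
    fix P assume P: "greatest ?L P (Lower ?L ?S)"
    then have PL: "P \<in> Lower ?L ?S" by (simp add: greatest_def)
    then obtain G where G: "local_set M X G" "P = cond_of M X G" using carrier by blast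
    have "P \<sqsubseteq>\<^bsub>?L\<^esub> ?I" "?I \<sqsubseteq>\<^bsub>?L\<^esub> P" using P PL greatest by (auto simp: greatest_def)
    then show "P = ?I"
      using cond_le_iff[OF I G(1)] cond_le_iff[OF G(1) I] cond_of_eqI[OF G(1) I]
      by (simp add: cond_order_def G(2))
  qed (rule greatest)
qed

lemma cond_product_eq:
  assumes B: "B \<in> sets M"
  shows "cond M X B = cond_of M X (X \<times> B)"
proof (rule represents_cond_eq)
  show "represents M X (X \<times> B) X B"
    unfolding represents_def
  proof (intro conjI ballI impI)
    show "\<exists>v\<in>X. AE \<omega> in M. \<omega> \<in> C \<longrightarrow> v \<omega> = x \<omega>" if "x \<in> X" for x C
      using that by (intro bexI[of _ x]) auto
  qed auto
qed (use X_nonempty B in auto)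

lemma cond_top_eq: "cond M X (space M) = cond_of M X (X \<times> space M)"
  by (rule cond_product_eq) simp

lemma cond_bot_eq: "cond M X {} = cond_of M X {}"
  using cond_product_eq[of "{}"] by simp

lemma cond_disjoint_iff:
  assumes "local_set M X E" "local_set M X F"
  shows "cond_disjoint M X (cond_of M X E) (cond_of M X F) \<longleftrightarrow> section_le (E \<inter> F) {}"
  unfolding cond_disjoint_def cond_meet_eq[OF assms] cond_bot_eq
  using cond_of_eq_iff[OF local_set_Int[OF assms] local_set_empty] section_le_subset[of "{}"] by simp

lemma cond_compl_eq:
  assumes E: "local_set M X E"
  shows "cond_compl M X (cond_of M X E) = cond_of M X (X \<times> space M - E)"
proof -
  have T: "local_set M X (X \<times> space M)" by (rule local_set_product) simp
  have C: "local_set M X (X \<times> space M - E)" by (rule local_set_diff[OF T E])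
  show ?thesis
    unfolding cond_compl_def
  proof (rule the_equality)
    have "E \<union> (X \<times> space M - E) = X \<times> space M" "E \<inter> (X \<times> space M - E) = {}"
      using local_set_sub[OF E] by auto
    then show "cond_of M X (X \<times> space M - E) \<in> cond_subsets M X \<and>
      cond_of M X E \<squnion>\<^bsub>cond_order M X\<^esub> cond_of M X (X \<times> space M - E) = cond M X (space M) \<and>
      cond_of M X E \<sqinter>\<^bsub>cond_order M X\<^esub> cond_of M X (X \<times> space M - E) = cond M X {}"
      using cond_of_in_cond_subsets[OF C] cond_join_eq[OF E C] cond_meet_eq[OF E C]
      by (simp only: cond_top_eq cond_bot_eq)
    fix Q assume Q: "Q \<in> cond_subsets M X \<and>
      cond_of M X E \<squnion>\<^bsub>cond_order M X\<^esub> Q = cond M X (space M) \<and>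
      cond_of M X E \<sqinter>\<^bsub>cond_order M X\<^esub> Q = cond M X {}"
    then obtain F where F: "local_set M X F" "Q = cond_of M X F" unfolding cond_subsets_iff by blast
    have "section_le (X \<times> space M) (E \<union> F)"
      using Q cond_of_eq_iff[OF local_set_Un[OF E F(1)] T]
      by (simp add: F cond_join_eq[OF E F(1)] cond_top_eq)
    moreover have "section_le (E \<inter> F) {}"
      using Q cond_of_eq_iff[OF local_set_Int[OF E F(1)] local_set_empty]
      by (simp add: F cond_meet_eq[OF E F(1)] cond_bot_eq)
    ultimately have *: "AE \<omega> in M. \<omega> \<in> space M \<longrightarrow> (x, \<omega>) \<in> E \<union> F" "AE \<omega> in M. (x, \<omega>) \<notin> E \<inter> F"
      if "x \<in> X" for x using that by (auto simp: section_le_def)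
    have F_sub: "F \<subseteq> X \<times> space M" by (rule local_set_sub[OF F(1)])
    have "section_le F (X \<times> space M - E)" "section_le (X \<times> space M - E) F"
      unfolding section_le_def
    proof (safe del: notI)
      fix x assume x: "x \<in> X"
      show "AE \<omega> in M. (x, \<omega>) \<in> F \<longrightarrow> (x, \<omega>) \<in> X \<times> space M - E"
        using *(2)[OF x] by eventually_elim (use F_sub in auto)
      show "AE \<omega> in M. (x, \<omega>) \<in> X \<times> space M - E \<longrightarrow> (x, \<omega>) \<in> F"
        using *(1)[OF x] by eventually_elim auto
    qed
    then show "Q = cond_of M X (X \<times> space M - E)"
      using cond_of_eqI[OF F(1) C] F(2) by simp
  qed
qed

text \<open>
  On \<open>A\<^sub>k\<close> the concatenation has the sections of \<open>E\<^sub>k\<close>. As \<open>cond_concat\<close> is defined through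
  representatives \<open>V\<^sub>k|B\<^sub>k\<close>, this also shows that it does not depend on their choice.
\<close>

lemma cond_concat_eq:
  assumes P: "msr_partition M A" and V: "\<And>k. V k \<in> stable_subsets M X" and B: "\<And>k. B k \<in> sets M"
    and E: "\<And>k. local_set M X (E k)" and eq: "\<And>k. cond M (V k) (B k) = cond_of M X (E k)"
  shows "cond_concat M A V B = cond_of M X (\<Union>k. E k \<inter> X \<times> A k)"
proof -
  have A: "A k \<in> sets M" for k using P by (simp add: msr_partition_def)
  have VX: "V k \<subseteq> X" "V k \<noteq> {}" for k using stable_subsetsD[OF V] by blast+
  have rep: "represents M X (E k) (V k) (B k)" for k
    by (rule cond_eq_represents[OF VX B E eq])
  have WX: "set_concat M A V \<subseteq> X"
  proof
    fix z assume "z \<in> set_concat M A V"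
    then obtain x where x: "\<And>k. x k \<in> V k" "is_concat M A x z" unfolding set_concat_def by blast
    show "z \<in> X" by (rule stable_set_concat[OF stable_X P _ x(2)]) (use x(1) VX in blast)
  qed
  have concat: "\<exists>z\<in>set_concat M A V. \<forall>k. \<forall>\<omega>\<in>A k. z \<omega> = x k \<omega>" if x: "\<And>k. x k \<in> V k" for x
  proof -
    obtain z where z: "\<forall>k. \<forall>\<omega>\<in>A k. z \<omega> = x k \<omega>" using is_concat_exists[OF P, of x] by blast
    then have "is_concat M A x z" by (auto simp: is_concat_def)
    with x have "z \<in> set_concat M A V" unfolding set_concat_def by blast
    with z show ?thesis by blast
  qed
  have "\<forall>k. \<exists>v. v \<in> V k" using VX(2) by blast
  from choice[OF this] obtain v0 where v0: "\<forall>k. v0 k \<in> V k" ..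
  have "represents M X (\<Union>k. E k \<inter> X \<times> A k) (set_concat M A V) (\<Union>k. A k \<inter> B k)"
    unfolding represents_def
  proof (intro conjI ballI impI)
    fix z assume z: "z \<in> set_concat M A V"
    then obtain x where x: "\<And>k. x k \<in> V k" "is_concat M A x z" unfolding set_concat_def by blast
    have zX: "z \<in> X" using z WX by blast
    have "AE \<omega> in M. \<omega> \<in> A k \<inter> B k \<longrightarrow> (z, \<omega>) \<in> E k" for k
    proof -
      have "x k \<in> X" using x(1) VX by blast
      moreover have "AE \<omega> in M. \<omega> \<in> A k \<longrightarrow> z \<omega> = x k \<omega>" using x(2) by (simp add: is_concat_def)
      ultimately have "AE \<omega> in M. \<omega> \<in> A k \<longrightarrow> ((z, \<omega>) \<in> E k \<longleftrightarrow> (x k, \<omega>) \<in> E k)"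
        by (intro local_setD[OF E zX _ A])
      with represents_inside[OF rep x(1)] show ?thesis by eventually_elim auto
    qed
    then have "AE \<omega> in M. \<forall>k. \<omega> \<in> A k \<inter> B k \<longrightarrow> (z, \<omega>) \<in> E k" unfolding AE_all_countable by blast
    then show "AE \<omega> in M. \<omega> \<in> (\<Union>k. A k \<inter> B k) \<longrightarrow> (z, \<omega>) \<in> (\<Union>k. E k \<inter> X \<times> A k)"
      by eventually_elim (use zX in blast)
  next
    fix x assume x: "x \<in> X"
    have "AE \<omega> in M. \<forall>k. (x, \<omega>) \<in> E k \<longrightarrow> \<omega> \<in> B k"
      unfolding AE_all_countable using represents_support[OF rep x] by blast
    then show "AE \<omega> in M. (x, \<omega>) \<in> (\<Union>k. E k \<inter> X \<times> A k) \<longrightarrow> \<omega> \<in> (\<Union>k. A k \<inter> B k)"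
      by eventually_elim blast
  next
    fix x C assume x: "x \<in> X" and C: "C \<in> sets M"
      and CE: "AE \<omega> in M. \<omega> \<in> C \<longrightarrow> (x, \<omega>) \<in> (\<Union>k. E k \<inter> X \<times> A k)"
    have disj: "\<omega> \<in> A k \<Longrightarrow> \<omega> \<in> A j \<Longrightarrow> j = k" for j k \<omega>
      using P by (auto simp: msr_partition_def disjoint_family_on_def)
    have "\<exists>v. v \<in> V k \<and> (AE \<omega> in M. \<omega> \<in> C \<inter> A k \<longrightarrow> v \<omega> = x \<omega>)" for k
    proof -
      have "AE \<omega> in M. \<omega> \<in> C \<inter> A k \<longrightarrow> (x, \<omega>) \<in> E k" using CE by eventually_elim (use disj in blast)
      from represents_attained[OF rep x sets.Int[OF C A] this] show ?thesis by blast
    qed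
    then have "\<forall>k. \<exists>v. v \<in> V k \<and> (AE \<omega> in M. \<omega> \<in> C \<inter> A k \<longrightarrow> v \<omega> = x \<omega>)" ..
    from choice[OF this] obtain v where
      v: "\<forall>k. v k \<in> V k \<and> (AE \<omega> in M. \<omega> \<in> C \<inter> A k \<longrightarrow> v k \<omega> = x \<omega>)" ..
    from v concat[of v] obtain z where
      z: "z \<in> set_concat M A V" "\<forall>k. \<forall>\<omega>\<in>A k. z \<omega> = v k \<omega>" by blast
    have "AE \<omega> in M. \<forall>k. \<omega> \<in> C \<inter> A k \<longrightarrow> v k \<omega> = x \<omega>" unfolding AE_all_countable using v by blast
    with CE have "AE \<omega> in M. \<omega> \<in> C \<longrightarrow> z \<omega> = x \<omega>" by eventually_elim (use z(2) in fastforce)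
    with z(1) show "\<exists>v\<in>set_concat M A V. AE \<omega> in M. \<omega> \<in> C \<longrightarrow> v \<omega> = x \<omega>" by blast
  qed
  moreover have "set_concat M A V \<noteq> {}" using concat[of v0] v0 by blast
  moreover have "(\<Union>k. A k \<inter> B k) \<in> sets M" using A B by auto
  ultimately show ?thesis
    unfolding cond_concat_def using WX by (intro represents_cond_eq)
qed

end

section \<open>The classical measure space behind a stable measure space\<close>

text \<open>
  This is the classical \<open>\<sigma>\<close>-algebra on \<open>X \<times> \<Omega>\<close>, and a stable measure gives a classical measure on it by
  integrating out \<open>\<omega>\<close>.
\<close>

definition lift_sets ::
  "'w measure \<Rightarrow> ('w \<Rightarrow> 'e) set \<Rightarrow> ('w \<rightharpoonup> 'e) set set \<Rightarrow> (('w \<Rightarrow> 'e) \<times> 'w) set set" where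
  "lift_sets M X \<X> = {E. local_set M X E \<and> cond_of M X E \<in> \<X>}"

definition lift_measure ::
  "'w measure \<Rightarrow> ('w \<Rightarrow> 'e) set \<Rightarrow> ('w \<rightharpoonup> 'e) set set \<Rightarrow> (('w \<rightharpoonup> 'e) set \<Rightarrow> 'w \<Rightarrow> ennreal)
    \<Rightarrow> (('w \<Rightarrow> 'e) \<times> 'w) measure" where
  "lift_measure M X \<X> \<mu> =
     measure_of (X \<times> space M) (lift_sets M X \<X>) (\<lambda>E. \<integral>\<^sup>+\<omega>. \<mu> (cond_of M X E) \<omega> \<partial>M)"

locale stable_space = stable_base M X for M :: "'w measure" and X :: "('w \<Rightarrow> 'e) set" +
  fixes \<X> :: "('w \<rightharpoonup> 'e) set set"
  assumes stable_algebra: "stable_sigma_algebra M X \<X>"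
begin

abbreviation "\<L> \<equiv> lift_sets M X \<X>"

lemma lift_setsD: "E \<in> \<L> \<Longrightarrow> local_set M X E" "E \<in> \<L> \<Longrightarrow> cond_of M X E \<in> \<X>"
  by (simp_all add: lift_sets_def)

lemma lift_sets_AE_cong:
  assumes "E \<in> \<L>" "local_set M X F" "section_le E F" "section_le F E"
  shows "F \<in> \<L>"
  using assms cond_of_eqI[of E F] by (simp add: lift_sets_def)

text \<open>
  Complements and countable unions of local sets correspond to the Boolean operations of \<open>\<P>(X)\<close>, under
  which \<open>\<X>\<close> is closed.
\<close>

lemma sigma_algebra_lift_sets: "sigma_algebra (X \<times> space M) \<L>"
proof -
  have top: "X \<times> space M \<in> \<L>"
    using stable_algebra
    by (simp add: lift_sets_def stable_sigma_algebra_def cond_top_eq local_set_product)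
  have compl: "X \<times> space M - E \<in> \<L>" if "E \<in> \<L>" for E
  proof -
    have E: "local_set M X E" "cond_of M X E \<in> \<X>" using lift_setsD[OF that] .
    have "cond_compl M X (cond_of M X E) \<in> \<X>"
      using E(2) stable_algebra by (simp add: stable_sigma_algebra_def)
    then show ?thesis
      using local_set_diff[OF local_set_product[OF sets.top] E(1)]
      by (simp add: lift_sets_def cond_compl_eq[OF E(1)])
  qed
  have Un: "(\<Union>i. E i) \<in> \<L>" if "range E \<subseteq> \<L>" for E :: "nat \<Rightarrow> _"
  proof -
    have E: "local_set M X (E i)" "cond_of M X (E i) \<in> \<X>" for i
      using that lift_setsD by blast+
    have "range (\<lambda>i. cond_of M X (E i)) \<subseteq> \<X>" using E(2) by blast
    then have "\<Squnion>\<^bsub>cond_order M X\<^esub>(range (\<lambda>i. cond_of M X (E i))) \<in> \<X>"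
      using stable_algebra unfolding stable_sigma_algebra_def by blast
    moreover have "range (\<lambda>i. cond_of M X (E i)) = cond_of M X ` range E" by (simp add: image_image)
    moreover have "local_set M X (\<Union>(range E))"
      "\<Squnion>\<^bsub>cond_order M X\<^esub>(cond_of M X ` range E) = cond_of M X (\<Union>(range E))"
      using E(1) by (intro local_set_Union cond_Sup_eq; auto)+
    ultimately show ?thesis by (simp add: lift_sets_def)
  qed
  have "\<L> \<subseteq> Pow (X \<times> space M)" using local_set_sub lift_setsD(1) by blast
  moreover have "{} \<in> \<L>" using compl[OF top] by simp
  ultimately show ?thesis unfolding sigma_algebra_iff2 using compl Un by blast
qed

lemma sets_lift [simp]: "sets (lift_measure M X \<X> \<mu>) = \<L>"
  unfolding lift_measure_def
  using sigma_algebra.sets_measure_of_eq[OF sigma_algebra_lift_sets] .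

lemma space_lift [simp]: "space (lift_measure M X \<X> \<mu>) = X \<times> space M"
  unfolding lift_measure_def
  using sigma_algebra.space_measure_of_eq[OF sigma_algebra_lift_sets] .

lemma empty_in_lift: "{} \<in> \<L>"
  using sets.empty_sets[of "lift_measure M X \<X> undefined"] by simp

lemma lift_sets_concat:
  assumes P: "msr_partition M A" and E: "\<And>k. E k \<in> \<L>"
  shows "\<exists>V B. (\<forall>k. V k \<in> stable_subsets M X \<and> B k \<in> sets M \<and>
      cond M (V k) (B k) = cond_of M X (E k)) \<and>
      cond_concat M A V B = cond_of M X (\<Union>k. E k \<inter> X \<times> A k) \<and>
      (\<Union>k. E k \<inter> X \<times> A k) \<in> \<L>"
proof -
  have A: "A k \<in> sets M" for k using P by (simp add: msr_partition_def)
  obtain V B where "\<forall>k. V k \<in> stable_subsets M X" "\<forall>k. B k \<in> sets M"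
    "\<forall>k. cond M (V k) (B k) = cond_of M X (E k)"
    by (rule local_sets_cond_sequence[OF lift_setsD(1)[OF E]])
  then have V: "V k \<in> stable_subsets M X" and B: "B k \<in> sets M"
    and VB_eq: "cond M (V k) (B k) = cond_of M X (E k)" for k
    by simp_all
  have eq: "cond_concat M A V B = cond_of M X (\<Union>k. E k \<inter> X \<times> A k)"
    by (rule cond_concat_eq[OF P V B lift_setsD(1)[OF E] VB_eq])
  have "\<forall>k. V k \<in> stable_subsets M X \<and> B k \<in> sets M \<and> cond M (V k) (B k) \<in> \<X>"
    using V B VB_eq lift_setsD(2)[OF E] by simp
  then have "cond_concat M A V B \<in> \<X>"
    using stable_algebra P unfolding stable_sigma_algebra_def stable_collection_def by blast
  moreover have "local_set M X (\<Union>k. E k \<inter> X \<times> A k)"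
  proof (rule local_set_Union)
    fix F assume "F \<in> range (\<lambda>k. E k \<inter> X \<times> A k)"
    then obtain k where "F = E k \<inter> X \<times> A k" by blast
    then show "local_set M X F"
      using local_set_Int[OF lift_setsD(1)[OF E] local_set_product[OF A]] by simp
  qed simp
  ultimately have "(\<Union>k. E k \<inter> X \<times> A k) \<in> \<L>" by (simp add: lift_sets_def eq)
  with V B VB_eq eq show ?thesis by (intro exI[of _ V] exI[of _ B]) simp
qed

text \<open>
  The conditional set \<open>X|B\<close> is the concatenation of \<open>X\<close> on \<open>B\<close> and \<open>{\<ast>}\<close> outside \<open>B\<close>. Consequently
  the projection to \<open>\<Omega>\<close> is measurable, which turns random coefficients such as the \<open>r\<^sub>k \<in> L\<^sup>0\<close> of an
  elementary function into classical measurable functions.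
\<close>

lemma product_in_lift:
  assumes B: "B \<in> sets M"
  shows "X \<times> B \<in> \<L>"
proof -
  let ?A = "\<lambda>k::nat. if k = 0 then B else if k = 1 then space M - B else {}"
  have top: "X \<times> space M \<in> \<L>"
    using sets.top[of "lift_measure M X \<X> undefined"] by simp
  have E: "(if k = 0 then X \<times> space M else {}) \<in> \<L>" for k :: nat using top empty_in_lift by simp
  have "(\<Union>k. (if k = 0 then X \<times> space M else {}) \<inter> X \<times> ?A k) \<in> \<L>"
    using lift_sets_concat[OF msr_partition_binary[OF B],
        where E = "\<lambda>k. if k = 0 then X \<times> space M else {}", OF E] by (elim exE conjE)
  moreover have "(\<Union>k. (if k = 0 then X \<times> space M else {}) \<inter> X \<times> ?A k) = X \<times> B" (is "?U = _")
  proof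
    show "?U \<subseteq> X \<times> B" by (auto split: if_splits)
    have "X \<times> B \<subseteq> (if (0::nat) = 0 then X \<times> space M else {}) \<inter> X \<times> ?A 0"
      using sets.sets_into_space[OF B] by auto
    then show "X \<times> B \<subseteq> ?U" by blast
  qed
  ultimately show ?thesis by simp
qed

lemma measurable_snd_lift [measurable]: "snd \<in> measurable (lift_measure M X \<X> \<mu>) M"
proof (rule measurableI)
  fix B assume B: "B \<in> sets M"
  have "snd -` B \<inter> X \<times> space M = X \<times> B" using sets.sets_into_space[OF B] by auto
  then show "snd -` B \<inter> space (lift_measure M X \<X> \<mu>) \<in> sets (lift_measure M X \<X> \<mu>)"
    using product_in_lift[OF B] by simp
qed auto

lemma measurable_Pair_lift:
  assumes "x \<in> X"
  shows "Pair x \<in> measurable M (lift_measure M X \<X> \<mu>)"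
proof (rule measurableI)
  fix E assume "E \<in> sets (lift_measure M X \<X> \<mu>)"
  then have E: "local_set M X E" using lift_setsD by simp
  have "Pair x -` E \<inter> space M = {\<omega>. (x, \<omega>) \<in> E}" using local_set_sub[OF E] by auto
  then show "Pair x -` E \<inter> space M \<in> sets M" using local_set_section[OF E assms] by simp
qed (use assms in auto)

lemma indicator_set_in_lift:
  assumes "V \<in> stable_subsets M X" "A \<in> sets M" "cond M V A \<in> \<X>"
  shows "indicator_set V A \<in> \<L>"
  using assms local_set_indicator_set[OF assms(1,2)] cond_eq_indicator_set[OF assms(1,2)]
  by (simp add: lift_sets_def)

end

locale stable_prob = stable_space M X \<X>
  for M :: "'w measure" and X :: "('w \<Rightarrow> 'e) set" and \<X> :: "('w \<rightharpoonup> 'e) set set" +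
  fixes \<mu> :: "('w \<rightharpoonup> 'e) set \<Rightarrow> 'w \<Rightarrow> ennreal"
  assumes stable_prob: "stable_prob_measure M X \<X> \<mu>"
begin

abbreviation "N \<equiv> lift_measure M X \<X> \<mu>"

abbreviation "\<mu>' E \<equiv> \<mu> (cond_of M X E)"

lemma stable_meas: "stable_measure M X \<X> \<mu>"
  using stable_prob by (simp add: stable_prob_measure_def)

lemma mu_measurable: "E \<in> \<L> \<Longrightarrow> \<mu>' E \<in> borel_measurable M"
  using stable_meas lift_setsD(2) by (simp add: stable_measure_def)

lemma mu_empty: "AE \<omega> in M. \<mu>' {} \<omega> = 0"
proof -
  have "cond M X {} \<in> \<X>" using lift_setsD(2)[OF empty_in_lift] by (simp add: cond_bot_eq)
  moreover have "X \<in> stable_subsets M X" using stable_X by (simp add: stable_subsets_def)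
  ultimately have "AE \<omega> in M. \<mu> (cond M X {}) \<omega> = (if \<omega> \<in> {} then \<mu> (cond M X {}) \<omega> else 0)"
    using stable_meas sets.empty_sets[of M] unfolding stable_measure_def by blast
  then show ?thesis by (simp add: cond_bot_eq)
qed

lemma mu_concat:
  assumes P: "msr_partition M A" and E: "\<And>k. E k \<in> \<L>"
  shows "AE \<omega> in M. \<omega> \<in> A k \<longrightarrow> \<mu>' (\<Union>k. E k \<inter> X \<times> A k) \<omega> = \<mu>' (E k) \<omega>"
proof -
  obtain V B where VB: "\<forall>k. V k \<in> stable_subsets M X \<and> B k \<in> sets M \<and>
      cond M (V k) (B k) = cond_of M X (E k)"
    "cond_concat M A V B = cond_of M X (\<Union>k. E k \<inter> X \<times> A k)"
    using lift_sets_concat[where E = E, OF P E] by (elim exE conjE)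
  have "\<forall>k. V k \<in> stable_subsets M X \<and> B k \<in> sets M \<and> cond M (V k) (B k) \<in> \<X>"
    using VB lift_setsD(2)[OF E] by simp
  then have "is_concat M A (\<lambda>k. \<mu> (cond M (V k) (B k))) (\<mu> (cond_concat M A V B))"
    using stable_meas P unfolding stable_measure_def by blast
  then show ?thesis by (simp add: is_concat_def VB)
qed

text \<open>
  This is stability of \<open>\<mu>\<close> for the concatenation of \<open>E\<close> on \<open>B\<close> with \<open>{\<ast>}\<close> outside \<open>B\<close>. It makes
  \<open>\<mu>(cond_of E)\<close> the density of the marginal on \<open>\<Omega>\<close> of the lifted measure restricted to \<open>E\<close>.
\<close>

lemma mu_restrict:
  assumes E: "E \<in> \<L>" and B: "B \<in> sets M"
  shows "AE \<omega> in M. \<mu>' (E \<inter> X \<times> B) \<omega> = \<mu>' E \<omega> * indicator B \<omega>"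
proof -
  let ?A = "\<lambda>k::nat. if k = 0 then B else if k = 1 then space M - B else {}"
  let ?E = "\<lambda>k::nat. if k = 0 then E else {}"
  note concat = mu_concat[OF msr_partition_binary[OF B], of ?E]
  have "(\<Union>k. ?E k \<inter> X \<times> ?A k) = E \<inter> X \<times> B" (is "?U = _")
  proof
    show "?U \<subseteq> E \<inter> X \<times> B" by (auto split: if_splits)
    have "E \<inter> X \<times> B \<subseteq> ?E 0 \<inter> X \<times> ?A 0" by simp
    then show "E \<inter> X \<times> B \<subseteq> ?U" by blast
  qed
  then have *: "AE \<omega> in M. \<omega> \<in> B \<longrightarrow> \<mu>' (E \<inter> X \<times> B) \<omega> = \<mu>' E \<omega>"
    "AE \<omega> in M. \<omega> \<in> space M - B \<longrightarrow> \<mu>' (E \<inter> X \<times> B) \<omega> = \<mu>' {} \<omega>"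
    using concat[of 0] concat[of 1] E empty_in_lift by simp_all
  then show ?thesis using mu_empty AE_space by eventually_elim (auto simp: indicator_def)
qed

lemma mu_suminf:
  assumes E: "\<And>i::nat. E i \<in> \<L>" and disj: "disjoint_family E"
  shows "AE \<omega> in M. \<mu>' (\<Union>i. E i) \<omega> = (\<Sum>i. \<mu>' (E i) \<omega>)"
proof -
  let ?P = "\<lambda>i. cond_of M X (E i)"
  have "cond_disjoint M X (?P i) (?P j)" if "i \<noteq> j" for i j
    using disj that lift_setsD(1)[OF E] disjoint_family_onD[OF disj, of i j]
    by (simp add: cond_disjoint_iff section_le_refl)
  moreover have "range ?P \<subseteq> \<X>" using lift_setsD(2)[OF E] by blast
  ultimately have "AE \<omega> in M. \<mu> (\<Squnion>\<^bsub>cond_order M X\<^esub>(range ?P)) \<omega> = (\<Sum>i. \<mu> (?P i) \<omega>)"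
    using stable_meas unfolding stable_measure_def by blast
  moreover have "\<Squnion>\<^bsub>cond_order M X\<^esub>(cond_of M X ` range E) = cond_of M X (\<Union>(range E))"
    using lift_setsD(1)[OF E] by (intro cond_Sup_eq) auto
  ultimately show ?thesis by (simp add: image_image)
qed

lemma emeasure_lift:
  assumes "E \<in> \<L>"
  shows "emeasure N E = (\<integral>\<^sup>+\<omega>. \<mu>' E \<omega> \<partial>M)"
proof (rule emeasure_measure_of[OF lift_measure_def])
  show "\<L> \<subseteq> Pow (X \<times> space M)" using local_set_sub lift_setsD(1) by blast
  show "E \<in> sets N" using assms by simp
  have "(\<integral>\<^sup>+\<omega>. \<mu>' {} \<omega> \<partial>M) = (\<integral>\<^sup>+\<omega>. 0 \<partial>M)" by (rule nn_integral_cong_AE[OF mu_empty])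
  then show "positive (sets N) (\<lambda>E. \<integral>\<^sup>+\<omega>. \<mu>' E \<omega> \<partial>M)" by (simp add: positive_def)
  show "countably_additive (sets N) (\<lambda>E. \<integral>\<^sup>+\<omega>. \<mu>' E \<omega> \<partial>M)"
    unfolding countably_additive_def
  proof (intro allI impI)
    fix E :: "nat \<Rightarrow> _" assume "range E \<subseteq> sets N" and disj: "disjoint_family E"
    then have E: "E i \<in> \<L>" for i by auto
    have "(\<integral>\<^sup>+\<omega>. \<mu>' (\<Union>i. E i) \<omega> \<partial>M) = (\<integral>\<^sup>+\<omega>. (\<Sum>i. \<mu>' (E i) \<omega>) \<partial>M)"
      by (rule nn_integral_cong_AE[OF mu_suminf[OF E disj]])
    also have "\<dots> = (\<Sum>i. \<integral>\<^sup>+\<omega>. \<mu>' (E i) \<omega> \<partial>M)"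
      by (rule nn_integral_suminf[OF mu_measurable[OF E]])
    finally show "(\<Sum>i. \<integral>\<^sup>+\<omega>. \<mu>' (E i) \<omega> \<partial>M) = (\<integral>\<^sup>+\<omega>. \<mu>' (\<Union>(range E)) \<omega> \<partial>M)" by simp
  qed
qed

lemma mu_top: "AE \<omega> in M. \<mu>' (X \<times> space M) \<omega> = 1"
  using stable_prob by (simp add: stable_prob_measure_def cond_top_eq)

lemma finite_measure_lift: "finite_measure N"
proof
  have "emeasure N (X \<times> space M) = (\<integral>\<^sup>+\<omega>. \<mu>' (X \<times> space M) \<omega> \<partial>M)"
    by (rule emeasure_lift[OF product_in_lift]) simp
  also have "\<dots> = (\<integral>\<^sup>+\<omega>. 1 \<partial>M)" by (rule nn_integral_cong_AE[OF mu_top])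
  finally show "emeasure N (space N) \<noteq> \<infinity>" by (simp add: emeasure_space_1)
qed

text \<open>
  Stable statements hold almost surely for each \<open>x\<close> separately, with null sets depending on \<open>x\<close>. The
  union of these null sets over all \<open>x\<close> is a local set with null sections, so it represents \<open>{\<ast>}\<close> and is null.
\<close>

lemma AE_lift:
  assumes "\<And>x. x \<in> X \<Longrightarrow> AE \<omega> in M. P x \<omega>"
  shows "AE p in N. P (fst p) (snd p)"
proof -
  have "\<exists>Z. x \<in> X \<longrightarrow> Z \<in> null_sets M \<and> {\<omega>\<in>space M. \<not> P x \<omega>} \<subseteq> Z" for x
  proof (cases "x \<in> X")
    case True
    from AE_E[OF assms[OF True]] obtain Z where
      "{\<omega>\<in>space M. \<not> P x \<omega>} \<subseteq> Z" "emeasure M Z = 0" "Z \<in> sets M" .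
    then show ?thesis by (intro exI[of _ Z]) (simp add: null_setsI)
  qed simp
  then have "\<forall>x. \<exists>Z. x \<in> X \<longrightarrow> Z \<in> null_sets M \<and> {\<omega>\<in>space M. \<not> P x \<omega>} \<subseteq> Z" ..
  from choice[OF this] obtain Z where
    Z: "\<forall>x. x \<in> X \<longrightarrow> Z x \<in> null_sets M \<and> {\<omega>\<in>space M. \<not> P x \<omega>} \<subseteq> Z x" ..
  define E where "E = {(x, \<omega>). x \<in> X \<and> \<omega> \<in> Z x}"
  have null: "AE \<omega> in M. (x, \<omega>) \<notin> E" if "x \<in> X" for x
  proof -
    have "Z x \<in> null_sets M" using Z that by blast
    from AE_not_in[OF this] show ?thesis by eventually_elim (simp add: E_def)
  qed
  have E: "local_set M X E"
  proof (rule local_setI)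
    have Z_sets: "Z x \<in> sets M" if "x \<in> X" for x using Z that by blast
    show "E \<subseteq> X \<times> space M" using sets.sets_into_space[OF Z_sets] unfolding E_def by blast
    show "{\<omega>. (x, \<omega>) \<in> E} \<in> sets M" if "x \<in> X" for x using Z_sets[OF that] that by (simp add: E_def)
    show "local_on M X (\<lambda>x \<omega>. (x, \<omega>) \<in> E)"
      unfolding local_on_def
    proof (intro ballI impI)
      fix x y B assume "x \<in> X" "y \<in> X"
      from null[OF this(1)] null[OF this(2)]
      show "AE \<omega> in M. \<omega> \<in> B \<longrightarrow> ((x, \<omega>) \<in> E) = ((y, \<omega>) \<in> E)" by eventually_elim simp
    qed
  qed
  have le: "section_le {} E" "section_le E {}" using null by (simp_all add: section_le_def)
  have EL: "E \<in> \<L>" by (rule lift_sets_AE_cong[OF empty_in_lift E le])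
  have "emeasure N E = (\<integral>\<^sup>+\<omega>. \<mu>' {} \<omega> \<partial>M)"
    using emeasure_lift[OF EL] cond_of_eqI[OF E local_set_empty le(2,1)] by simp
  also have "\<dots> = (\<integral>\<^sup>+\<omega>. 0 \<partial>M)" by (rule nn_integral_cong_AE[OF mu_empty])
  finally have "E \<in> null_sets N" using EL by (auto intro: null_setsI)
  moreover have "{p \<in> space N. \<not> P (fst p) (snd p)} \<subseteq> E"
  proof
    fix p assume "p \<in> {p \<in> space N. \<not> P (fst p) (snd p)}"
    then have "fst p \<in> X" "snd p \<in> {\<omega>\<in>space M. \<not> P (fst p) \<omega>}" by auto
    moreover from this(1) have "{\<omega>\<in>space M. \<not> P (fst p) \<omega>} \<subseteq> Z (fst p)" using Z by blast
    ultimately show "p \<in> E" unfolding E_def by (cases p) auto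
  qed
  ultimately show ?thesis by (rule AE_I')
qed

text \<open>
  The marginal on \<open>\<Omega>\<close> of the lifted measure restricted to \<open>E\<close> has density \<open>\<mu>(cond_of E)\<close>.
\<close>

lemma nn_integral_lift_indicator:
  assumes E: "E \<in> \<L>" and r: "r \<in> borel_measurable M"
  shows "(\<integral>\<^sup>+p. r (snd p) * indicator E p \<partial>N) = (\<integral>\<^sup>+\<omega>. r \<omega> * \<mu>' E \<omega> \<partial>M)"
proof -
  have "E \<in> sets N" using E by simp
  then have EN: "(indicator E :: _ \<Rightarrow> ennreal) \<in> borel_measurable N" by (rule borel_measurable_indicator)
  have eq: "distr (density N (indicator E)) M snd = density M (\<mu>' E)"
  proof (rule measure_eqI)
    fix B assume "B \<in> sets (distr (density N (indicator E)) M snd)"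
    then have B: "B \<in> sets M" by simp
    have EB: "E \<inter> X \<times> B \<in> \<L>" using sets.Int[of E N "X \<times> B"] E product_in_lift[OF B] by simp
    have vim: "snd -` B \<inter> space N = X \<times> B" using sets.sets_into_space[OF B] by auto
    have "emeasure (distr (density N (indicator E)) M snd) B = emeasure (density N (indicator E)) (X \<times> B)"
      using B vim by (subst emeasure_distr) auto
    also have "\<dots> = (\<integral>\<^sup>+p. indicator E p * indicator (X \<times> B) p \<partial>N)"
      using EN product_in_lift[OF B] by (subst emeasure_density) auto
    also have "\<dots> = (\<integral>\<^sup>+p. indicator (E \<inter> X \<times> B) p \<partial>N)" by (simp add: indicator_inter_arith)
    also have "\<dots> = (\<integral>\<^sup>+\<omega>. \<mu>' (E \<inter> X \<times> B) \<omega> \<partial>M)" using EB by (simp add: emeasure_lift)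
    also have "\<dots> = (\<integral>\<^sup>+\<omega>. \<mu>' E \<omega> * indicator B \<omega> \<partial>M)"
      by (rule nn_integral_cong_AE[OF mu_restrict[OF E B]])
    also have "\<dots> = emeasure (density M (\<mu>' E)) B"
      using B mu_measurable[OF E] by (subst emeasure_density) auto
    finally show "emeasure (distr (density N (indicator E)) M snd) B = emeasure (density M (\<mu>' E)) B" .
  qed simp
  have "(\<integral>\<^sup>+p. r (snd p) * indicator E p \<partial>N) = (\<integral>\<^sup>+p. r (snd p) \<partial>density N (indicator E))"
    using EN measurable_compose[OF measurable_snd_lift r]
    by (subst nn_integral_density) (auto simp: mult.commute)
  also have "\<dots> = (\<integral>\<^sup>+\<omega>. r \<omega> \<partial>distr (density N (indicator E)) M snd)"
    using r by (subst nn_integral_distr) auto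
  also have "\<dots> = (\<integral>\<^sup>+\<omega>. r \<omega> * \<mu>' E \<omega> \<partial>M)"
    unfolding eq using r mu_measurable[OF E] by (subst nn_integral_density) (auto simp: mult.commute)
  finally show ?thesis .
qed


text \<open>
  The function \<open>(x, \<omega>) \<mapsto> g(x)(\<omega>)\<close> is an elementary sum only up to null sets depending on \<open>x\<close>, so it
  need not be measurable itself; \<open>G\<close> is a measurable version.
\<close>

lemma has_elementary_integral_lift:
  assumes "has_elementary_integral M X \<X> \<mu> g I"
  shows "\<exists>G\<in>borel_measurable N. (AE p in N. ennreal (g (fst p) (snd p)) = G p) \<and>
    (\<forall>A\<in>sets M. (\<integral>\<^sup>+\<omega>. I \<omega> * indicator A \<omega> \<partial>M) = (\<integral>\<^sup>+p. G p * indicator A (snd p) \<partial>N))"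
proof -
  obtain n :: nat and r V A where
    *: "\<forall>k<n. r k \<in> L0_nonneg M \<and> V k \<in> stable_subsets M X \<and> A k \<in> sets M \<and> cond M (V k) (A k) \<in> \<X>"
    and g: "\<forall>x\<in>X. g x \<in> L0 M \<and>
      (AE \<omega> in M. g x \<omega> = (\<Sum>k<n. r k \<omega> * stable_indicator M (V k) (A k) x \<omega>))"
    and I: "AE \<omega> in M. I \<omega> = (\<Sum>k<n. ennreal (r k \<omega>) * \<mu> (cond M (V k) (A k)) \<omega>)"
    using assms unfolding has_elementary_integral_def by (elim exE conjE) (rule that)
  define E where "E k = indicator_set (V k) (A k)" for k
  have E: "E k \<in> \<L>" if "k < n" for k using * that indicator_set_in_lift by (simp add: E_def)
  have condE: "cond M (V k) (A k) = cond_of M X (E k)" if "k < n" for k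
    using * that cond_eq_indicator_set by (simp add: E_def)
  have r: "r k \<in> borel_measurable M" "AE \<omega> in M. 0 \<le> r k \<omega>" if "k < n" for k
    using * that by (simp_all add: L0_nonneg_def)
  have r_nonneg: "AE \<omega> in M. \<forall>k\<in>{..<n}. 0 \<le> r k \<omega>" by (rule AE_finite_allI) (simp_all add: r(2))
  define G where "G p = (\<Sum>k<n. ennreal (r k (snd p)) * indicator (E k) p)" for p
  have term_meas: "(\<lambda>p. ennreal (r k (snd p)) * indicator (E k) p) \<in> borel_measurable N" if "k < n" for k
  proof -
    have [measurable]: "r k \<in> borel_measurable M" "E k \<in> sets N" using r(1) E that by simp_all
    show ?thesis by measurable
  qed
  have "G \<in> borel_measurable N" unfolding G_def using term_meas by (intro borel_measurable_sum) simp
  moreover have "AE p in N. ennreal (g (fst p) (snd p)) = G (fst p, snd p)"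
  proof (rule AE_lift)
    fix x assume x: "x \<in> X"
    then have "AE \<omega> in M. g x \<omega> = (\<Sum>k<n. r k \<omega> * stable_indicator M (V k) (A k) x \<omega>)"
      using g by blast
    with r_nonneg show "AE \<omega> in M. ennreal (g x \<omega>) = G (x, \<omega>)"
    proof eventually_elim
      case (elim \<omega>)
      have "g x \<omega> = (\<Sum>k<n. r k \<omega> * indicator (E k) (x, \<omega>))"
        using elim(2) by (simp add: stable_indicator_eq[OF x] E_def)
      also have "ennreal \<dots> = (\<Sum>k<n. ennreal (r k \<omega> * indicator (E k) (x, \<omega>)))"
        using elim(1) by (subst sum_ennreal) auto
      also have "\<dots> = G (x, \<omega>)"
        unfolding G_def using elim(1) by (intro sum.cong) (auto simp: indicator_def)
      finally show ?case .
    qed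
  qed
  moreover have "(\<integral>\<^sup>+\<omega>. I \<omega> * indicator B \<omega> \<partial>M) = (\<integral>\<^sup>+p. G p * indicator B (snd p) \<partial>N)"
    if B: "B \<in> sets M" for B
  proof -
    have rB: "(\<lambda>\<omega>. ennreal (r k \<omega>) * indicator B \<omega>) \<in> borel_measurable M" if "k < n" for k
      using r(1)[OF that] B by measurable
    have "(\<integral>\<^sup>+p. G p * indicator B (snd p) \<partial>N) =
        (\<integral>\<^sup>+p. (\<Sum>k<n. ennreal (r k (snd p)) * indicator B (snd p) * indicator (E k) p) \<partial>N)"
      unfolding G_def sum_distrib_right by (simp add: mult_ac)
    also have "\<dots> = (\<Sum>k<n. \<integral>\<^sup>+p. ennreal (r k (snd p)) * indicator B (snd p) * indicator (E k) p \<partial>N)"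
    proof (rule nn_integral_sum)
      fix k assume "k \<in> {..<n}"
      then have [measurable]: "r k \<in> borel_measurable M" "E k \<in> sets N" "B \<in> sets M" using r(1) E B by simp_all
      show "(\<lambda>p. ennreal (r k (snd p)) * indicator B (snd p) * indicator (E k) p) \<in> borel_measurable N"
        by measurable
    qed
    also have "\<dots> = (\<Sum>k<n. \<integral>\<^sup>+\<omega>. ennreal (r k \<omega>) * indicator B \<omega> * \<mu>' (E k) \<omega> \<partial>M)"
      by (intro sum.cong refl nn_integral_lift_indicator E rB) auto
    also have "\<dots> = (\<integral>\<^sup>+\<omega>. (\<Sum>k<n. ennreal (r k \<omega>) * indicator B \<omega> * \<mu>' (E k) \<omega>) \<partial>M)"
    proof (rule nn_integral_sum[symmetric])
      fix k assume "k \<in> {..<n}"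
      then have [measurable]: "r k \<in> borel_measurable M" "\<mu>' (E k) \<in> borel_measurable M" "B \<in> sets M"
        using r(1) mu_measurable[OF E] B by simp_all
      show "(\<lambda>\<omega>. ennreal (r k \<omega>) * indicator B \<omega> * \<mu>' (E k) \<omega>) \<in> borel_measurable M" by measurable
    qed
    also have "\<dots> = (\<integral>\<^sup>+\<omega>. I \<omega> * indicator B \<omega> \<partial>M)"
    proof (rule nn_integral_cong_AE)
      show "AE \<omega> in M. (\<Sum>k<n. ennreal (r k \<omega>) * indicator B \<omega> * \<mu>' (E k) \<omega>) = I \<omega> * indicator B \<omega>"
        using I by eventually_elim (simp add: condE sum_distrib_left mult_ac)
    qed
    finally show ?thesis ..
  qed
  ultimately show ?thesis by auto
qed

text \<open>
  Monotone convergence on both sides. The integrals \<open>J\<^sub>i\<close> increase because their integrals over every event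
  do.
\<close>

lemma has_stable_nn_integral_lift:
  assumes "has_stable_nn_integral M X \<X> \<mu> f I" and A: "A \<in> sets M"
  shows "(\<integral>\<^sup>+\<omega>. I \<omega> * indicator A \<omega> \<partial>M) =
    (\<integral>\<^sup>+p. ennreal (f (fst p) (snd p)) * indicator A (snd p) \<partial>N)"
proof -
  obtain g J where gJ: "\<forall>i::nat. has_elementary_integral M X \<X> \<mu> (g i) (J i)"
    "\<forall>x\<in>X. \<forall>i. AE \<omega> in M. g i x \<omega> \<le> g (Suc i) x \<omega>"
    "\<forall>x\<in>X. AE \<omega> in M. (SUP i. ennreal (g i x \<omega>)) = ennreal (f x \<omega>)"
    and I: "AE \<omega> in M. I \<omega> = (SUP i. J i \<omega>)"
    using assms(1) unfolding has_stable_nn_integral_def by (elim exE conjE) (rule that)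
  have J: "has_elementary_integral M X \<X> \<mu> (g i) (J i)" for i using gJ(1) by (rule spec)
  have mono: "AE \<omega> in M. g i x \<omega> \<le> g (Suc i) x \<omega>" if "x \<in> X" for i x
    using bspec[OF gJ(2) that] by (rule spec)
  have sup: "AE \<omega> in M. (SUP i. ennreal (g i x \<omega>)) = ennreal (f x \<omega>)" if "x \<in> X" for x
    using gJ(3) that by (rule bspec)
  have "\<forall>i. \<exists>G. G \<in> borel_measurable N \<and> (AE p in N. ennreal (g i (fst p) (snd p)) = G p) \<and>
    (\<forall>A\<in>sets M. (\<integral>\<^sup>+\<omega>. J i \<omega> * indicator A \<omega> \<partial>M) = (\<integral>\<^sup>+p. G p * indicator A (snd p) \<partial>N))"
    using has_elementary_integral_lift[OF J] unfolding Bex_def ..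
  from choice[OF this] obtain G where
    "\<forall>i. G i \<in> borel_measurable N \<and> (AE p in N. ennreal (g i (fst p) (snd p)) = G i p) \<and>
    (\<forall>A\<in>sets M. (\<integral>\<^sup>+\<omega>. J i \<omega> * indicator A \<omega> \<partial>M) = (\<integral>\<^sup>+p. G i p * indicator A (snd p) \<partial>N))" ..
  then have G: "\<And>i. G i \<in> borel_measurable N" "\<And>i. AE p in N. ennreal (g i (fst p) (snd p)) = G i p"
    and int: "\<And>i A. A \<in> sets M \<Longrightarrow>
      (\<integral>\<^sup>+\<omega>. J i \<omega> * indicator A \<omega> \<partial>M) = (\<integral>\<^sup>+p. G i p * indicator A (snd p) \<partial>N)"
    by simp_all
  have J_meas [measurable]: "J i \<in> borel_measurable M" for i
    using J[of i] unfolding has_elementary_integral_def by (elim exE conjE)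
  have ind [measurable]: "(\<lambda>p. indicator B (snd p) :: ennreal) \<in> borel_measurable N" if "B \<in> sets M" for B
    using that by measurable
  note G(1) [measurable]
  have G_mono: "AE p in N. G i p \<le> G (Suc i) p" for i
  proof -
    have "AE p in N. g i (fst p) (snd p) \<le> g (Suc i) (fst p) (snd p)" by (rule AE_lift) (rule mono)
    with G(2)[of i] G(2)[of "Suc i"] show ?thesis
    proof eventually_elim
      case (elim p)
      then show ?case using ennreal_leI[OF elim(3)] by simp
    qed
  qed
  have J_mono: "AE \<omega> in M. J i \<omega> \<le> J (Suc i) \<omega>" for i
  proof (rule AE_le_of_nn_integral_le[OF J_meas J_meas])
    fix B assume B: "B \<in> sets M"
    show "(\<integral>\<^sup>+\<omega>. J i \<omega> * indicator B \<omega> \<partial>M) \<le> (\<integral>\<^sup>+\<omega>. J (Suc i) \<omega> * indicator B \<omega> \<partial>M)"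
      unfolding int[OF B]
    proof (rule nn_integral_mono_AE)
      show "AE p in N. G i p * indicator B (snd p) \<le> G (Suc i) p * indicator B (snd p)"
        using G_mono[of i] by eventually_elim (rule mult_right_mono, auto)
    qed
  qed
  have "(\<integral>\<^sup>+\<omega>. I \<omega> * indicator A \<omega> \<partial>M) = (\<integral>\<^sup>+\<omega>. (SUP i. J i \<omega> * indicator A \<omega>) \<partial>M)"
  proof (rule nn_integral_cong_AE)
    show "AE \<omega> in M. I \<omega> * indicator A \<omega> = (SUP i. J i \<omega> * indicator A \<omega>)"
      using I by eventually_elim (simp add: SUP_mult_right_ennreal)
  qed
  also have "\<dots> = (SUP i. \<integral>\<^sup>+\<omega>. J i \<omega> * indicator A \<omega> \<partial>M)"
  proof (rule nn_integral_monotone_convergence_SUP_AE)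
    show "AE \<omega> in M. J i \<omega> * indicator A \<omega> \<le> J (Suc i) \<omega> * indicator A \<omega>" for i
      using J_mono[of i] by eventually_elim (rule mult_right_mono, auto)
    show "(\<lambda>\<omega>. J i \<omega> * indicator A \<omega>) \<in> borel_measurable M" for i using A by measurable
  qed
  also have "\<dots> = (SUP i. \<integral>\<^sup>+p. G i p * indicator A (snd p) \<partial>N)" by (simp add: int[OF A])
  also have "\<dots> = (\<integral>\<^sup>+p. (SUP i. G i p * indicator A (snd p)) \<partial>N)"
  proof (rule nn_integral_monotone_convergence_SUP_AE[symmetric])
    show "AE p in N. G i p * indicator A (snd p) \<le> G (Suc i) p * indicator A (snd p)" for i
      using G_mono[of i] by eventually_elim (rule mult_right_mono, auto)
    show "(\<lambda>p. G i p * indicator A (snd p)) \<in> borel_measurable N" for i using A by measurable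
  qed
  also have "\<dots> = (\<integral>\<^sup>+p. ennreal (f (fst p) (snd p)) * indicator A (snd p) \<partial>N)"
  proof (rule nn_integral_cong_AE)
    have "AE p in N. (SUP i. ennreal (g i (fst p) (snd p))) = ennreal (f (fst p) (snd p))"
      by (rule AE_lift) (rule sup)
    moreover have "AE p in N. \<forall>i. ennreal (g i (fst p) (snd p)) = G i p"
      unfolding AE_all_countable using G(2) by blast
    ultimately show "AE p in N. (SUP i. G i p * indicator A (snd p)) =
        ennreal (f (fst p) (snd p)) * indicator A (snd p)"
    proof eventually_elim
      case (elim p)
      then have "(SUP i. G i p) = ennreal (f (fst p) (snd p))" by simp
      then show ?case by (simp add: SUP_mult_right_ennreal[symmetric])
    qed
  qed
  finally show ?thesis .
qed

text \<open>
  A classical simple function is a stable elementary function with constant coefficients: the level sets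
  \<open>E\<^sub>k\<close> give the disjoint conditional sets.
\<close>

lemma simple_function_has_elementary_integral:
  fixes s :: "('w \<Rightarrow> 'e) \<times> 'w \<Rightarrow> real"
  assumes s: "simple_function N s" and s_nonneg: "\<And>p. 0 \<le> s p"
  shows "\<exists>I. has_elementary_integral M X \<X> \<mu> (\<lambda>x \<omega>. s (x, \<omega>)) I"
proof -
  let ?S = "s ` space N"
  have "finite ?S" by (rule simple_functionD(1)[OF s])
  from ex_bij_betw_nat_finite[OF this] obtain c where
    c: "bij_betw c {..<card ?S} ?S" by (auto simp: atLeast0LessThan)
  define n where "n = card ?S"
  define E where "E k = s -` {c k} \<inter> space N" for k
  have E: "E k \<in> \<L>" for k using simple_functionD(2)[OF s, of "{c k}"] by (simp add: E_def)
  obtain V B where "\<forall>k. V k \<in> stable_subsets M X" "\<forall>k. B k \<in> sets M"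
    "\<forall>k. cond M (V k) (B k) = cond_of M X (E k)"
    by (rule local_sets_cond_sequence[OF lift_setsD(1)[OF E]])
  then have V: "V k \<in> stable_subsets M X" and B: "B k \<in> sets M"
    and VB_eq: "cond M (V k) (B k) = cond_of M X (E k)" for k
    by simp_all
  define I where "I \<omega> = (\<Sum>k<n. ennreal (c k) * \<mu> (cond M (V k) (B k)) \<omega>)" for \<omega>
  have c_nonneg: "0 \<le> c k" if "k < n" for k
  proof -
    have "c k \<in> ?S" using c that by (simp add: n_def bij_betw_def) blast
    then show ?thesis using s_nonneg by auto
  qed
  have "has_elementary_integral M X \<X> \<mu> (\<lambda>x \<omega>. s (x, \<omega>)) I"
    unfolding has_elementary_integral_def
  proof (rule exI[of _ n], rule exI[of _ "\<lambda>k \<omega>. c k"], rule exI[of _ V], rule exI[of _ B], intro conjI)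
    show "\<forall>k<n. (\<lambda>\<omega>. c k) \<in> L0_nonneg M \<and> V k \<in> stable_subsets M X \<and> B k \<in> sets M \<and>
        cond M (V k) (B k) \<in> \<X>"
      using V B c_nonneg VB_eq lift_setsD(2)[OF E] by (simp add: L0_nonneg_def)
    show "\<forall>i<n. \<forall>j<n. i \<noteq> j \<longrightarrow> cond_disjoint M X (cond M (V i) (B i)) (cond M (V j) (B j))"
    proof (intro allI impI)
      fix i j assume "i < n" "j < n" "i \<noteq> j"
      then have "c i \<noteq> c j" using c by (auto simp: n_def bij_betw_def inj_on_def)
      then have "E i \<inter> E j = {}" by (auto simp: E_def)
      then show "cond_disjoint M X (cond M (V i) (B i)) (cond M (V j) (B j))"
        using lift_setsD(1)[OF E] by (simp add: VB_eq cond_disjoint_iff section_le_refl)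
    qed
    have "(\<Union>k\<in>{..<n}. E k) = space N"
    proof
      show "space N \<subseteq> (\<Union>k\<in>{..<n}. E k)"
      proof
        fix p assume p: "p \<in> space N"
        then have "s p \<in> c ` {..<n}" using c by (simp add: n_def bij_betw_def)
        with p show "p \<in> (\<Union>k\<in>{..<n}. E k)" by (auto simp: E_def)
      qed
    qed (auto simp: E_def)
    moreover have "\<Squnion>\<^bsub>cond_order M X\<^esub>(cond_of M X ` (E ` {..<n})) = cond_of M X (\<Union>(E ` {..<n}))"
      using lift_setsD(1)[OF E] by (intro cond_Sup_eq) auto
    ultimately show "\<Squnion>\<^bsub>cond_order M X\<^esub>((\<lambda>k. cond M (V k) (B k)) ` {..<n}) = cond M X (space M)"
      by (simp add: VB_eq cond_top_eq image_image)
    show "I \<in> borel_measurable M"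
      unfolding I_def VB_eq using mu_measurable[OF E] by simp
    show "AE \<omega> in M. I \<omega> = (\<Sum>k<n. ennreal (c k) * \<mu> (cond M (V k) (B k)) \<omega>)"
      by (simp add: I_def)
    show "\<forall>x\<in>X. (\<lambda>\<omega>. s (x, \<omega>)) \<in> L0 M \<and>
      (AE \<omega> in M. s (x, \<omega>) = (\<Sum>k<n. c k * stable_indicator M (V k) (B k) x \<omega>))"
    proof (intro ballI conjI)
      fix x assume x: "x \<in> X"
      show "(\<lambda>\<omega>. s (x, \<omega>)) \<in> L0 M"
        using measurable_compose[OF measurable_Pair_lift[OF x] borel_measurable_simple_function[OF s]] .
      have "AE \<omega> in M. (x, \<omega>) \<in> indicator_set (V k) (B k) \<longleftrightarrow> (x, \<omega>) \<in> E k" for k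
      proof -
        have "cond_of M X (indicator_set (V k) (B k)) = cond_of M X (E k)"
          using cond_eq_indicator_set[OF V B] VB_eq by simp
        then have "section_le (indicator_set (V k) (B k)) (E k)" "section_le (E k) (indicator_set (V k) (B k))"
          using cond_of_eq_iff[OF local_set_indicator_set[OF V B] lift_setsD(1)[OF E]] by blast+
        then have "AE \<omega> in M. (x, \<omega>) \<in> indicator_set (V k) (B k) \<longrightarrow> (x, \<omega>) \<in> E k"
          "AE \<omega> in M. (x, \<omega>) \<in> E k \<longrightarrow> (x, \<omega>) \<in> indicator_set (V k) (B k)"
          using x by (auto simp: section_le_def)
        then show ?thesis by eventually_elim blast
      qed
      then have "AE \<omega> in M. \<forall>k. (x, \<omega>) \<in> indicator_set (V k) (B k) \<longleftrightarrow> (x, \<omega>) \<in> E k"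
        unfolding AE_all_countable by blast
      with AE_space
      show "AE \<omega> in M. s (x, \<omega>) = (\<Sum>k<n. c k * stable_indicator M (V k) (B k) x \<omega>)"
      proof eventually_elim
        case (elim \<omega>)
        have p: "(x, \<omega>) \<in> space N" using x elim(1) by simp
        have "(\<Sum>k<n. c k * stable_indicator M (V k) (B k) x \<omega>) =
            (\<Sum>k<n. if c k = s (x, \<omega>) then c k else 0)"
          using elim(2) p by (intro sum.cong) (auto simp: stable_indicator_eq[OF x] indicator_def E_def)
        also have "\<dots> = (\<Sum>y\<in>?S. if y = s (x, \<omega>) then y else 0)"
          using sum.reindex_bij_betw[OF c, of "\<lambda>y. if y = s (x, \<omega>) then y else 0"] by (simp add: n_def)
        also have "\<dots> = s (x, \<omega>)" using \<open>finite ?S\<close> p by (subst sum.delta) auto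
        finally show ?case ..
      qed
    qed
  qed
  then show ?thesis by (rule exI[where x = I])
qed

lemma has_stable_nn_integral_exists:
  assumes f: "(\<lambda>p. f (fst p) (snd p)) \<in> borel_measurable N" and f_nonneg: "\<And>x \<omega>. 0 \<le> f x \<omega>"
  shows "\<exists>I. has_stable_nn_integral M X \<X> \<mu> f I"
proof -
  from borel_measurable_implies_simple_function_sequence_real[OF f f_nonneg]
  obtain s where s: "incseq s \<and> (\<forall>i. simple_function N (s i)) \<and>
    (\<forall>p. bdd_above (range (\<lambda>i. s i p))) \<and> (\<forall>i p. 0 \<le> s i p) \<and>
    (\<lambda>p. f (fst p) (snd p)) = (SUP i. s i)" ..
  have inc: "incseq s" using s by (elim conjE)
  have simple: "simple_function N (s i)" for i using s by (elim conjE) (rule spec)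
  have bdd: "bdd_above (range (\<lambda>i. s i p))" for p
    using s by (elim conjE) (rule spec[where P = "\<lambda>p. bdd_above (range (\<lambda>i. s i p))"])
  have "\<forall>i p. 0 \<le> s i p" using s by (elim conjE)
  then have nonneg: "0 \<le> s i p" for i p by (elim allE)
  have sup: "(\<lambda>p. f (fst p) (snd p)) = (SUP i. s i)" using s by (elim conjE)
  have "\<forall>i. \<exists>J. has_elementary_integral M X \<X> \<mu> (\<lambda>x \<omega>. s i (x, \<omega>)) J"
    using simple_function_has_elementary_integral[OF simple nonneg] ..
  from choice[OF this] obtain J where
    "\<forall>i. has_elementary_integral M X \<X> \<mu> (\<lambda>x \<omega>. s i (x, \<omega>)) (J i)" ..
  then have J: "has_elementary_integral M X \<X> \<mu> (\<lambda>x \<omega>. s i (x, \<omega>)) (J i)" for i by (rule spec)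
  have J_meas [measurable]: "J i \<in> borel_measurable M" for i
    using J[of i] unfolding has_elementary_integral_def by (elim exE conjE)
  have "has_stable_nn_integral M X \<X> \<mu> f (\<lambda>\<omega>. SUP i. J i \<omega>)"
    unfolding has_stable_nn_integral_def
  proof (rule exI[of _ "\<lambda>i x \<omega>. s i (x, \<omega>)"], rule exI[of _ J], intro conjI ballI allI)
    show "has_elementary_integral M X \<X> \<mu> (\<lambda>x \<omega>. s i (x, \<omega>)) (J i)" for i by (rule J)
    show "AE \<omega> in M. s i (x, \<omega>) \<le> s (Suc i) (x, \<omega>)" for x i
      using inc by (auto simp: incseq_Suc_iff le_fun_def)
    show "AE \<omega> in M. (SUP i. ennreal (s i (x, \<omega>))) = ennreal (f x \<omega>)" for x
    proof (rule AE_I2)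
      fix \<omega>
      have "f x \<omega> = (SUP i. s i (x, \<omega>))" using fun_cong[OF sup, of "(x, \<omega>)"] by (simp add: image_image)
      moreover have "ennreal (SUP i. s i (x, \<omega>)) = (SUP i. ennreal (s i (x, \<omega>)))"
      proof (rule ennreal_SUP)
        have "ennreal (s i (x, \<omega>)) \<le> ennreal (SUP i. s i (x, \<omega>))" for i
          by (rule ennreal_leI) (rule cSUP_upper[OF UNIV_I bdd])
        then have "(SUP i. ennreal (s i (x, \<omega>))) \<le> ennreal (SUP i. s i (x, \<omega>))" by (rule SUP_least)
        then show "(SUP i. ennreal (s i (x, \<omega>))) \<noteq> Orderings.top"
          by (rule neq_top_trans[rotated]) simp
      qed (use nonneg in auto)
      ultimately show "(SUP i. ennreal (s i (x, \<omega>))) = ennreal (f x \<omega>)" by simp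
    qed
    show "(\<lambda>\<omega>. SUP i. J i \<omega>) \<in> borel_measurable M" by measurable
  qed simp
  then show ?thesis by (rule exI[where x = "\<lambda>\<omega>. SUP i. J i \<omega>"])
qed

text \<open>
  Integrals over all events determine the stable integral, whatever approximating sequence the choice in its
  definition uses.
\<close>

lemma stable_nn_integral_lift:
  assumes f: "(\<lambda>p. f (fst p) (snd p)) \<in> borel_measurable N" and f_nonneg: "\<And>x \<omega>. 0 \<le> f x \<omega>"
    and u: "u \<in> borel_measurable M"
    and int: "\<And>A. A \<in> sets M \<Longrightarrow> (\<integral>\<^sup>+p. ennreal (f (fst p) (snd p)) * indicator A (snd p) \<partial>N) =
      (\<integral>\<^sup>+\<omega>. u \<omega> * indicator A \<omega> \<partial>M)"
  shows "AE \<omega> in M. stable_nn_integral M X \<X> \<mu> f \<omega> = u \<omega>"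
proof -
  have I: "has_stable_nn_integral M X \<X> \<mu> f (stable_nn_integral M X \<X> \<mu> f)"
    unfolding stable_nn_integral_def
    by (rule someI_ex[OF has_stable_nn_integral_exists[OF f f_nonneg]])
  then have "stable_nn_integral M X \<X> \<mu> f \<in> borel_measurable M"
    unfolding has_stable_nn_integral_def by (elim exE conjE)
  from this u show ?thesis
    by (rule AE_eq_of_nn_integral_eq) (simp add: has_stable_nn_integral_lift[OF I] int)
qed

end

section \<open>Stable measurability from classical measurability\<close>

text \<open>
  A concatenation is determined only up to a null set; completeness of the probability space ensures that
  every version of it is measurable.
\<close>

lemma stable_set_L0:
  assumes "complete_measure M"
  shows "stable_set M (L0 M)"
  unfolding stable_set_def
proof (intro conjI allI impI; (elim conjE)?)
  interpret complete_measure M by fact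
  show "L0 M \<noteq> {}" using borel_measurable_const by blast
  fix A x z assume A: "msr_partition M A" and x: "\<forall>k. x k \<in> L0 M" and z: "is_concat M A x z"
  show "z \<in> L0 M"
  proof (rule measurableI)
    fix S :: "real set" assume S: "S \<in> sets borel"
    have "AE \<omega> in M. \<forall>k. \<omega> \<in> A k \<longrightarrow> z \<omega> = x k \<omega>"
      unfolding AE_all_countable using z by (simp add: is_concat_def)
    then have "AE \<omega> in M. \<omega> \<in> z -` S \<inter> space M \<longleftrightarrow> \<omega> \<in> (\<Union>k. A k \<inter> (x k -` S \<inter> space M))"
      using AE_space
    proof eventually_elim
      case (elim \<omega>)
      have eq: "z \<omega> = x j \<omega>" if "\<omega> \<in> A j" for j using elim(1) that by blast
      obtain k where k: "\<omega> \<in> A k" using A elim(2) unfolding msr_partition_def by blast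
      show ?case
      proof
        assume "\<omega> \<in> z -` S \<inter> space M"
        then have "\<omega> \<in> A k \<inter> (x k -` S \<inter> space M)" using k eq[OF k] by simp
        then show "\<omega> \<in> (\<Union>k. A k \<inter> (x k -` S \<inter> space M))" by blast
      next
        assume "\<omega> \<in> (\<Union>k. A k \<inter> (x k -` S \<inter> space M))"
        then obtain j where j: "\<omega> \<in> A j" "\<omega> \<in> x j -` S \<inter> space M" by blast
        then show "\<omega> \<in> z -` S \<inter> space M" using eq[OF j(1)] by simp
      qed
    qed
    moreover have "(\<Union>k. A k \<inter> (x k -` S \<inter> space M)) \<in> sets M"
      using A x S by (intro sets.countable_UN) (auto simp: msr_partition_def intro: measurable_sets)
    ultimately show "z -` S \<inter> space M \<in> sets M"
      by (rule_tac in_sets_AE[rotated]) (auto simp: iff_conv_conj_imp)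
  qed simp
qed

text \<open>
  The lifted measure enters only through its \<open>\<sigma>\<close>-algebra, which does not depend on the stable
  measure; hence the placeholder \<open>undefined\<close>.
\<close>

locale lift_measurable_function = stable_space M X \<X>
  for M :: "'w measure" and X :: "('w \<Rightarrow> 'e) set" and \<X> :: "('w \<rightharpoonup> 'e) set set" +
  fixes f :: "('w \<Rightarrow> 'e) \<Rightarrow> 'w \<Rightarrow> real"
  assumes complete: "complete_measure M"
    and f_measurable: "(\<lambda>p. f (fst p) (snd p)) \<in> borel_measurable (lift_measure M X \<X> undefined)"
begin

sublocale Y: stable_base M "L0 M"
  by unfold_locales (rule stable_set_L0[OF complete])

lemma f_in_L0: "x \<in> X \<Longrightarrow> f x \<in> L0 M"
  using measurable_compose[OF measurable_Pair_lift f_measurable] by simp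

text \<open>
  The sublevel sets of \<open>f\<close> for rational levels are local, and countably many of them determine the values
  of \<open>f\<close>.
\<close>

lemma f_local:
  assumes x: "x \<in> X" and y: "y \<in> X" and B: "B \<in> sets M"
    and eq: "AE \<omega> in M. \<omega> \<in> B \<longrightarrow> x \<omega> = y \<omega>"
  shows "AE \<omega> in M. \<omega> \<in> B \<longrightarrow> f x \<omega> = f y \<omega>"
proof -
  have "AE \<omega> in M. \<omega> \<in> B \<longrightarrow> (f x \<omega> < of_rat q \<longleftrightarrow> f y \<omega> < of_rat q)" for q :: rat
  proof -
    define E where "E = {p\<in>space (lift_measure M X \<X> undefined). f (fst p) (snd p) < of_rat q}"
    have "E \<in> sets (lift_measure M X \<X> undefined)"
      unfolding E_def by (rule borel_measurable_less[OF f_measurable]) simp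
    then have "local_set M X E" using lift_setsD by simp
    from local_setD[OF this x y B eq] AE_space
    show ?thesis by eventually_elim (use x y in \<open>simp add: E_def\<close>)
  qed
  then have "AE \<omega> in M. \<forall>q::rat. \<omega> \<in> B \<longrightarrow> (f x \<omega> < of_rat q \<longleftrightarrow> f y \<omega> < of_rat q)"
    unfolding AE_all_countable by blast
  then show ?thesis
  proof eventually_elim
    case (elim \<omega>)
    show ?case
    proof
      assume "\<omega> \<in> B"
      then have *: "f x \<omega> < of_rat q \<longleftrightarrow> f y \<omega> < of_rat q" for q :: rat using elim by blast
      show "f x \<omega> = f y \<omega>"
      proof (rule linorder_cases)
        assume "f x \<omega> < f y \<omega>"
        from of_rat_dense[OF this] show ?thesis using * by (metis less_asym)
      next
        assume "f y \<omega> < f x \<omega>"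
        from of_rat_dense[OF this] show ?thesis using * by (metis less_asym)
      qed
    qed
  qed
qed

lemma stable_fun_f: "stable_fun M X (L0 M) f"
  unfolding stable_fun_def
proof (intro conjI ballI allI impI; (elim conjE)?)
  show "f x \<in> L0 M" if "x \<in> X" for x by (rule f_in_L0[OF that])
  fix A x z assume A: "msr_partition M A" and x: "\<forall>k. x k \<in> X" and z: "z \<in> X" "is_concat M A x z"
  show "is_concat M A (\<lambda>k. f (x k)) (f z)"
    unfolding is_concat_def
  proof
    fix k
    show "AE \<omega> in M. \<omega> \<in> A k \<longrightarrow> f z \<omega> = f (x k) \<omega>"
      using A x z by (intro f_local) (auto simp: msr_partition_def is_concat_def)
  qed
qed

definition pullback :: "(('w \<Rightarrow> real) \<times> 'w) set \<Rightarrow> (('w \<Rightarrow> 'e) \<times> 'w) set" where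
  "pullback F = {(x, \<omega>). x \<in> X \<and> (f x, \<omega>) \<in> F}"

lemma local_set_pullback:
  assumes F: "local_set M (L0 M) F"
  shows "local_set M X (pullback F)"
proof (rule local_setI)
  show "pullback F \<subseteq> X \<times> space M" using local_set_sub[OF F] by (auto simp: pullback_def)
  show "{\<omega>. (x, \<omega>) \<in> pullback F} \<in> sets M" if "x \<in> X" for x
    using local_set_section[OF F f_in_L0[OF that]] that by (simp add: pullback_def)
  show "local_on M X (\<lambda>x \<omega>. (x, \<omega>) \<in> pullback F)"
    unfolding local_on_def
  proof (intro ballI impI)
    fix x y B assume *: "x \<in> X" "y \<in> X" "B \<in> sets M" "AE \<omega> in M. \<omega> \<in> B \<longrightarrow> x \<omega> = y \<omega>"
    from local_setD[OF F f_in_L0[OF *(1)] f_in_L0[OF *(2)] *(3) f_local[OF *]]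
    show "AE \<omega> in M. \<omega> \<in> B \<longrightarrow> ((x, \<omega>) \<in> pullback F) = ((y, \<omega>) \<in> pullback F)"
      by eventually_elim (simp add: pullback_def *)
  qed
qed

definition good_sets :: "('w \<rightharpoonup> real) set set" where
  "good_sets = {cond_of M (L0 M) F | F. local_set M (L0 M) F \<and> pullback F \<in> \<L>}"

text \<open>
  Membership in \<open>good_sets\<close> does not depend on the local set chosen to represent the conditional set.
\<close>

lemma good_setsD:
  assumes "cond_of M (L0 M) F \<in> good_sets" and F: "local_set M (L0 M) F"
  shows "pullback F \<in> \<L>"
proof -
  obtain G where G: "local_set M (L0 M) G" "pullback G \<in> \<L>" "cond_of M (L0 M) F = cond_of M (L0 M) G"
    using assms(1) unfolding good_sets_def by blast
  have "Y.section_le G F" "Y.section_le F G" using Y.cond_of_eq_iff[OF F G(1)] G(3) by blast+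
  then have "section_le (pullback G) (pullback F)" "section_le (pullback F) (pullback G)"
    using f_in_L0 by (simp_all add: section_le_def Y.section_le_def pullback_def)
  then show ?thesis by (rule lift_sets_AE_cong[OF G(2) local_set_pullback[OF F]])
qed

text \<open>
  Pulling back commutes with complements, countable unions and concatenations of local sets.
\<close>

lemma stable_sigma_algebra_good_sets: "stable_sigma_algebra M (L0 M) good_sets"
proof -
  let ?T = "L0 M \<times> space M"
  have T: "local_set M (L0 M) ?T" by (rule Y.local_set_product) simp
  have pT: "pullback ?T = X \<times> space M" using f_in_L0 by (auto simp: pullback_def)
  have top: "cond M (L0 M) (space M) \<in> good_sets"
    unfolding good_sets_def Y.cond_top_eq using T product_in_lift[OF sets.top] pT by auto
  have sub: "good_sets \<subseteq> cond_subsets M (L0 M)"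
    unfolding good_sets_def using Y.cond_of_in_cond_subsets by blast
  have concat: "cond_concat M A V B \<in> good_sets"
    if P: "msr_partition M A" and *: "\<forall>k. V k \<in> stable_subsets M (L0 M) \<and> B k \<in> sets M \<and>
      cond M (V k) (B k) \<in> good_sets" for A V B
  proof -
    have V: "V k \<in> stable_subsets M (L0 M)" and B: "B k \<in> sets M"
      and g: "cond M (V k) (B k) \<in> good_sets" for k using * by blast+
    define F where "F k = Y.indicator_set (V k) (B k)" for k
    have F: "local_set M (L0 M) (F k)" for k unfolding F_def by (rule Y.local_set_indicator_set[OF V B])
    have eq: "cond M (V k) (B k) = cond_of M (L0 M) (F k)" for k
      unfolding F_def by (rule Y.cond_eq_indicator_set[OF V B])
    have A: "A k \<in> sets M" for k using P by (simp add: msr_partition_def)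
    have pF: "pullback (F k) \<in> \<L>" for k using good_setsD[OF _ F] g eq by metis
    let ?U = "\<Union>k. F k \<inter> L0 M \<times> A k"
    have "pullback ?U = (\<Union>k. pullback (F k) \<inter> X \<times> A k)" using f_in_L0 by (auto simp: pullback_def)
    moreover have "pullback (F k) \<inter> X \<times> A k \<in> sets (lift_measure M X \<X> undefined)" for k
      using pF product_in_lift[OF A] by (intro sets.Int) simp_all
    then have "(\<Union>k. pullback (F k) \<inter> X \<times> A k) \<in> sets (lift_measure M X \<X> undefined)"
      by (intro sets.countable_UN) blast
    moreover have "local_set M (L0 M) ?U"
    proof (rule Y.local_set_Union)
      fix G assume "G \<in> range (\<lambda>k. F k \<inter> L0 M \<times> A k)"
      then obtain k where "G = F k \<inter> L0 M \<times> A k" by blast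
      then show "local_set M (L0 M) G" using Y.local_set_Int[OF F Y.local_set_product[OF A]] by simp
    qed simp
    ultimately show ?thesis
      unfolding Y.cond_concat_eq[OF P V B F eq] good_sets_def by auto
  qed
  have compl: "cond_compl M (L0 M) P \<in> good_sets" if "P \<in> good_sets" for P
  proof -
    obtain F where F: "local_set M (L0 M) F" "pullback F \<in> \<L>" "P = cond_of M (L0 M) F"
      using \<open>P \<in> good_sets\<close> unfolding good_sets_def by blast
    have "pullback (?T - F) = X \<times> space M - pullback F" using f_in_L0 by (auto simp: pullback_def)
    moreover have "X \<times> space M - pullback F \<in> \<L>"
      using sets.compl_sets[of "pullback F" "lift_measure M X \<X> undefined"] F(2) by simp
    ultimately show ?thesis
      using Y.local_set_diff[OF T F(1)] unfolding F(3) Y.cond_compl_eq[OF F(1)] good_sets_def by auto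
  qed
  have Sup: "\<Squnion>\<^bsub>cond_order M (L0 M)\<^esub>(range P) \<in> good_sets" if "range P \<subseteq> good_sets" for P :: "nat \<Rightarrow> _"
  proof -
    have "\<exists>F. local_set M (L0 M) F \<and> pullback F \<in> \<L> \<and> P k = cond_of M (L0 M) F" for k
    proof -
      have "P k \<in> good_sets" using that by (rule subsetD) simp
      then show ?thesis unfolding good_sets_def by blast
    qed
    then have "\<forall>k. \<exists>F. local_set M (L0 M) F \<and> pullback F \<in> \<L> \<and> P k = cond_of M (L0 M) F" ..
    from choice[OF this] obtain F where
      "\<forall>k. local_set M (L0 M) (F k) \<and> pullback (F k) \<in> \<L> \<and> P k = cond_of M (L0 M) (F k)" ..
    then have F: "local_set M (L0 M) (F k)" "pullback (F k) \<in> \<L>" "P k = cond_of M (L0 M) (F k)" for k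
      by simp_all
    have rP: "range P = cond_of M (L0 M) ` range F" by (simp add: F(3) image_image)
    have "pullback (\<Union>(range F)) = (\<Union>k. pullback (F k))" by (auto simp: pullback_def)
    moreover have "(\<Union>k. pullback (F k)) \<in> sets (lift_measure M X \<X> undefined)"
      using F(2) by (intro sets.countable_UN) auto
    moreover have "local_set M (L0 M) (\<Union>(range F))"
      using F(1) by (intro Y.local_set_Union) auto
    moreover have "\<Squnion>\<^bsub>cond_order M (L0 M)\<^esub>(range P) = cond_of M (L0 M) (\<Union>(range F))"
      unfolding rP using F(1) by (intro Y.cond_Sup_eq) auto
    ultimately show ?thesis unfolding good_sets_def by auto
  qed
  show ?thesis
    unfolding stable_sigma_algebra_def stable_collection_def
    using top sub concat compl Sup by blast
qed

lemma ball_in_good_sets: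
  assumes x: "x \<in> L0 M" and r: "r \<in> L0_pos M"
  shows "cond M (L0_ball M x r) (space M) \<in> good_sets"
proof -
  define F where "F = {(y, \<omega>). y \<in> L0 M \<and> \<omega> \<in> space M \<and> \<bar>x \<omega> - y \<omega>\<bar> < r \<omega>}"
  have r': "r \<in> L0 M" "AE \<omega> in M. 0 < r \<omega>" using r by (simp_all add: L0_pos_def)
  have F: "local_set M (L0 M) F"
  proof (rule local_setI)
    show "F \<subseteq> L0 M \<times> space M" by (auto simp: F_def)
    fix y assume y: "y \<in> L0 M"
    have "{\<omega>. (y, \<omega>) \<in> F} = {\<omega>\<in>space M. \<bar>x \<omega> - y \<omega>\<bar> < r \<omega>}" using y by (auto simp: F_def)
    also have "\<dots> \<in> sets M" using x y r'(1) by measurable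
    finally show "{\<omega>. (y, \<omega>) \<in> F} \<in> sets M" .
  next
    show "local_on M (L0 M) (\<lambda>y \<omega>. (y, \<omega>) \<in> F)"
      unfolding local_on_def
    proof (intro ballI impI)
      fix y z B assume "y \<in> L0 M" "z \<in> L0 M" "AE \<omega> in M. \<omega> \<in> B \<longrightarrow> y \<omega> = z \<omega>"
      from this(3) show "AE \<omega> in M. \<omega> \<in> B \<longrightarrow> ((y, \<omega>) \<in> F) = ((z, \<omega>) \<in> F)"
        by eventually_elim (use \<open>y \<in> L0 M\<close> \<open>z \<in> L0 M\<close> in \<open>simp add: F_def\<close>)
    qed
  qed
  have x_ball: "x \<in> L0_ball M x r" using x r'(2) by (simp add: L0_ball_def)
  have "represents M (L0 M) F (L0_ball M x r) (space M)"
    unfolding represents_def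
  proof (intro conjI ballI impI)
    show "AE \<omega> in M. \<omega> \<in> space M \<longrightarrow> (v, \<omega>) \<in> F" if "v \<in> L0_ball M x r" for v
    proof -
      have v: "v \<in> L0 M" "AE \<omega> in M. \<bar>x \<omega> - v \<omega>\<bar> < r \<omega>" using that by (simp_all add: L0_ball_def)
      from v(2) show ?thesis by eventually_elim (use v(1) in \<open>simp add: F_def\<close>)
    qed
    show "AE \<omega> in M. (y, \<omega>) \<in> F \<longrightarrow> \<omega> \<in> space M" for y by (simp add: F_def)
    fix y B assume y: "y \<in> L0 M" and B: "B \<in> sets M" and BF: "AE \<omega> in M. \<omega> \<in> B \<longrightarrow> (y, \<omega>) \<in> F"
    define v where "v = (\<lambda>\<omega>. if \<omega> \<in> B then y \<omega> else x \<omega>)"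
    have "v \<in> L0 M" unfolding v_def by (rule stable_set_glue[OF Y.stable_X y x B])
    moreover have "AE \<omega> in M. \<bar>x \<omega> - v \<omega>\<bar> < r \<omega>"
      using BF r'(2) by eventually_elim (auto simp: v_def F_def)
    ultimately have "v \<in> L0_ball M x r" by (simp add: L0_ball_def)
    then show "\<exists>v\<in>L0_ball M x r. AE \<omega> in M. \<omega> \<in> B \<longrightarrow> v \<omega> = y \<omega>"
      by (rule bexI[rotated]) (simp add: v_def)
  qed
  then have eq: "cond M (L0_ball M x r) (space M) = cond_of M (L0 M) F"
    using x_ball by (intro represents_cond_eq) (auto simp: L0_ball_def)
  have "pullback F = {p\<in>space (lift_measure M X \<X> undefined). \<bar>x (snd p) - f (fst p) (snd p)\<bar> < r (snd p)}"
    using f_in_L0 by (auto simp: pullback_def F_def)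
  also have "\<dots> \<in> sets (lift_measure M X \<X> undefined)"
    using f_measurable measurable_compose[OF measurable_snd_lift x] measurable_compose[OF measurable_snd_lift r'(1)]
    by (intro borel_measurable_less) auto
  finally show ?thesis unfolding eq good_sets_def using F by auto
qed

text \<open>
  The event \<open>C\<close> in the definition of the preimage is the largest section of the pulled back local set, by
  \<open>ess_Sup_attained\<close>.
\<close>

lemma stable_preimage_eq:
  assumes W: "W \<in> stable_subsets M (L0 M)" and A: "A \<in> sets M"
  shows "stable_preimage M X f W A = cond_of M X (pullback (Y.indicator_set W A))"
proof -
  define F where "F = Y.indicator_set W A"
  have F: "local_set M (L0 M) F" unfolding F_def by (rule Y.local_set_indicator_set[OF W A])
  have rep: "represents M (L0 M) F W A" unfolding F_def by (rule Y.represents_indicator_set[OF W A])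
  note W' = Y.stable_subsetsD[OF W]
  note pF = local_set_pullback[OF F]
  define \<C> where "\<C> = {A' \<in> sets M. A' \<subseteq> A \<and> (\<exists>x\<in>X. restr (f x) A' \<in> cond M W A')}"
  define C where "C = ess_Sup M \<C>"
  define V where "V = {x \<in> X. restr (f x) C \<in> cond M W C}"
  have \<C>: "\<C> \<subseteq> sets M" by (auto simp: \<C>_def)
  have C: "C \<in> sets M" unfolding C_def by (rule ess_Sup_measurable[OF \<C>])
  have CA: "AE \<omega> in M. \<omega> \<in> C \<longrightarrow> \<omega> \<in> A"
    unfolding C_def by (rule ess_Sup_least[OF \<C> A]) (auto simp: \<C>_def)
  have to_F: "AE \<omega> in M. \<omega> \<in> B \<longrightarrow> (x, \<omega>) \<in> pullback F"
    if x: "x \<in> X" and B: "B \<in> sets M" and BA: "AE \<omega> in M. \<omega> \<in> B \<longrightarrow> \<omega> \<in> A"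
      and W: "restr (f x) B \<in> cond M W B" for x B
  proof -
    obtain w where w: "w \<in> W" "AE \<omega> in M. \<omega> \<in> B \<longrightarrow> w \<omega> = f x \<omega>"
      using W unfolding restr_in_cond_iff by blast
    have "w \<in> L0 M" using w(1) W' by blast
    from local_setD[OF F this f_in_L0[OF x] B w(2)] BA represents_inside[OF rep w(1)]
    show ?thesis by eventually_elim (simp add: pullback_def x)
  qed
  have from_F: "restr (f x) B \<in> cond M W B"
    if x: "x \<in> X" and B: "B \<in> sets M" and BF: "AE \<omega> in M. \<omega> \<in> B \<longrightarrow> (x, \<omega>) \<in> pullback F" for x B
  proof -
    have "AE \<omega> in M. \<omega> \<in> B \<longrightarrow> (f x, \<omega>) \<in> F" using BF by eventually_elim (simp add: pullback_def)
    from represents_attained[OF rep f_in_L0[OF x] B this] show ?thesis unfolding restr_in_cond_iff by blast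
  qed
  have "\<exists>v\<in>X. AE \<omega> in M. \<omega> \<in> C \<longrightarrow> (v, \<omega>) \<in> pullback F"
    unfolding C_def
  proof (rule ess_Sup_attained[OF stable_X local_set_local[OF pF] \<C>])
    fix B assume "B \<in> \<C>"
    then obtain x where "x \<in> X" "B \<in> sets M" "B \<subseteq> A" "restr (f x) B \<in> cond M W B"
      unfolding \<C>_def by blast
    with to_F[of x B] show "\<exists>v\<in>X. AE \<omega> in M. \<omega> \<in> B \<longrightarrow> (v, \<omega>) \<in> pullback F" by auto
  qed
  then obtain v where v: "v \<in> X" "AE \<omega> in M. \<omega> \<in> C \<longrightarrow> (v, \<omega>) \<in> pullback F" by blast
  have vV: "v \<in> V" using from_F[OF v(1) C v(2)] v(1) by (simp add: V_def)
  have upper: "AE \<omega> in M. (x, \<omega>) \<in> pullback F \<longrightarrow> \<omega> \<in> C" if x: "x \<in> X" for x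
  proof -
    let ?B = "{\<omega>. (x, \<omega>) \<in> pullback F} \<inter> A"
    have B: "?B \<in> sets M" using local_set_section[OF pF x] A by simp
    have "restr (f x) ?B \<in> cond M W ?B" by (rule from_F[OF x B]) simp
    with B x have "?B \<in> \<C>" by (auto simp: \<C>_def)
    from ess_Sup_upper[OF \<C> this] represents_support[OF rep f_in_L0[OF x]]
    show ?thesis by eventually_elim (auto simp: C_def pullback_def)
  qed
  have "represents M X (pullback F) V C"
    unfolding represents_def
  proof (intro conjI ballI impI)
    show "AE \<omega> in M. \<omega> \<in> C \<longrightarrow> (x, \<omega>) \<in> pullback F" if "x \<in> V" for x
      using that by (intro to_F C CA) (simp_all add: V_def)
    show "AE \<omega> in M. (x, \<omega>) \<in> pullback F \<longrightarrow> \<omega> \<in> C" if "x \<in> X" for x by (rule upper[OF that])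
    fix x B assume x: "x \<in> X" and B: "B \<in> sets M" and BF: "AE \<omega> in M. \<omega> \<in> B \<longrightarrow> (x, \<omega>) \<in> pullback F"
    define y where "y = (\<lambda>\<omega>. if \<omega> \<in> B then x \<omega> else v \<omega>)"
    have y: "y \<in> X" unfolding y_def by (rule stable_set_glue[OF stable_X x v(1) B])
    have y1: "AE \<omega> in M. \<omega> \<in> B \<longrightarrow> ((y, \<omega>) \<in> pullback F \<longleftrightarrow> (x, \<omega>) \<in> pullback F)"
      by (rule local_setD[OF pF y x B]) (simp add: y_def)
    have y2: "AE \<omega> in M. \<omega> \<in> space M - B \<longrightarrow> ((y, \<omega>) \<in> pullback F \<longleftrightarrow> (v, \<omega>) \<in> pullback F)"
      by (rule local_setD[OF pF y v(1)]) (use B in \<open>auto simp: y_def\<close>)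
    have "AE \<omega> in M. \<omega> \<in> C \<longrightarrow> (y, \<omega>) \<in> pullback F"
      using y1 y2 BF v(2) AE_space by eventually_elim auto
    then have "y \<in> V" using from_F[OF y C] y by (simp add: V_def)
    then show "\<exists>v\<in>V. AE \<omega> in M. \<omega> \<in> B \<longrightarrow> v \<omega> = x \<omega>" by (intro bexI[of _ y]) (simp_all add: y_def)
  qed
  then have "cond M V C = cond_of M X (pullback F)"
    using vV C by (intro represents_cond_eq) (auto simp: V_def)
  then show ?thesis
    unfolding stable_preimage_def Let_def F_def V_def C_def \<C>_def .
qed

lemma stably_measurable_f: "stably_measurable M X \<X> (L0 M) (stable_borel M) f"
  unfolding stably_measurable_def
proof (intro conjI ballI impI)
  show "stable_fun M X (L0 M) f" by (rule stable_fun_f)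
  fix W A assume W: "W \<in> stable_subsets M (L0 M)" and A: "A \<in> sets M" and "cond M W A \<in> stable_borel M"
  then have "cond M W A \<in> good_sets"
    using stable_sigma_algebra_good_sets ball_in_good_sets unfolding stable_borel_def by blast
  then have "cond_of M (L0 M) (Y.indicator_set W A) \<in> good_sets"
    unfolding Y.cond_eq_indicator_set[OF W A] .
  from lift_setsD(2)[OF good_setsD[OF this Y.local_set_indicator_set[OF W A]]]
  show "stable_preimage M X f W A \<in> \<X>" unfolding stable_preimage_eq[OF W A] .
qed

end

section \<open>The density\<close>

context stable_prob
begin

lemma mu_le_one:
  assumes E: "E \<in> \<L>"
  shows "AE \<omega> in M. \<mu>' E \<omega> \<le> 1"
proof (rule AE_le_of_nn_integral_le[OF mu_measurable[OF E]])
  fix A assume A: "A \<in> sets M"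
  have EN: "E \<in> sets N" "X \<times> space M \<in> sets N" using E product_in_lift[OF sets.top] by simp_all
  have r: "(\<lambda>\<omega>. indicator A \<omega> :: ennreal) \<in> borel_measurable M" using A by simp
  have "(\<integral>\<^sup>+\<omega>. \<mu>' E \<omega> * indicator A \<omega> \<partial>M) = (\<integral>\<^sup>+p. indicator A (snd p) * indicator E p \<partial>N)"
    using nn_integral_lift_indicator[OF E r] by (simp add: mult.commute)
  also have "\<dots> \<le> (\<integral>\<^sup>+p. indicator A (snd p) * indicator (X \<times> space M) p \<partial>N)"
    using sets.sets_into_space[OF EN(1)] by (intro nn_integral_mono mult_left_mono) (auto simp: indicator_def)
  also have "\<dots> = (\<integral>\<^sup>+\<omega>. indicator A \<omega> * \<mu>' (X \<times> space M) \<omega> \<partial>M)"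
    using EN(2) by (intro nn_integral_lift_indicator r) simp
  also have "\<dots> = (\<integral>\<^sup>+\<omega>. 1 * indicator A \<omega> \<partial>M)"
    by (rule nn_integral_cong_AE) (use mu_top in eventually_elim, simp)
  finally show "(\<integral>\<^sup>+\<omega>. \<mu>' E \<omega> * indicator A \<omega> \<partial>M) \<le> (\<integral>\<^sup>+\<omega>. 1 * indicator A \<omega> \<partial>M)" .
qed simp

text \<open>
  The negative part of \<open>g\<close> vanishes, and the integral of the positive part is recognised from its
  integrals over all events. Finiteness of \<open>u\<close> makes \<open>g\<close> integrable.
\<close>

lemma stable_integral_lift:
  assumes complete: "complete_measure M"
    and g: "(\<lambda>p. g (fst p) (snd p)) \<in> borel_measurable N" and nonneg: "\<And>x \<omega>. 0 \<le> g x \<omega>"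
    and u: "u \<in> borel_measurable M" "AE \<omega> in M. u \<omega> < \<infinity>"
    and int: "\<And>A. A \<in> sets M \<Longrightarrow> (\<integral>\<^sup>+p. ennreal (g (fst p) (snd p)) * indicator A (snd p) \<partial>N) =
      (\<integral>\<^sup>+\<omega>. u \<omega> * indicator A \<omega> \<partial>M)"
  shows "stable_integrable M X \<X> \<mu> g"
    and "AE \<omega> in M. enn2ereal (u \<omega>) = ereal (stable_integral M X \<X> \<mu> g \<omega>)"
proof -
  have "L0 N = L0 (lift_measure M X \<X> undefined)" by (rule measurable_cong_sets) simp_all
  with g have "(\<lambda>p. g (fst p) (snd p)) \<in> L0 (lift_measure M X \<X> undefined)" by (simp only:)
  then interpret g: lift_measurable_function M X \<X> g
    by (intro lift_measurable_function.intro stable_space_axioms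
        lift_measurable_function_axioms.intro complete)
  have pos: "pos_part g = g" and neg: "neg_part g = (\<lambda>x \<omega>. 0)"
    using nonneg by (simp_all add: pos_part_def neg_part_def fun_eq_iff)
  have P: "AE \<omega> in M. stable_nn_integral M X \<X> \<mu> (pos_part g) \<omega> = u \<omega>"
    unfolding pos by (rule stable_nn_integral_lift[OF g nonneg u(1) int])
  have Q: "AE \<omega> in M. stable_nn_integral M X \<X> \<mu> (neg_part g) \<omega> = 0"
    unfolding neg by (rule stable_nn_integral_lift) simp_all
  show "stable_integrable M X \<X> \<mu> g"
    unfolding stable_integrable_def
  proof (intro conjI)
    show "stably_measurable M X \<X> (L0 M) (stable_borel M) g" by (rule g.stably_measurable_f)
    show "AE \<omega> in M. stable_nn_integral M X \<X> \<mu> (pos_part g) \<omega> < \<infinity>"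
      using P u(2) by eventually_elim simp
    show "AE \<omega> in M. stable_nn_integral M X \<X> \<mu> (neg_part g) \<omega> < \<infinity>"
      using Q by eventually_elim simp
  qed
  show "AE \<omega> in M. enn2ereal (u \<omega>) = ereal (stable_integral M X \<X> \<mu> g \<omega>)"
    using P Q u(2)
  proof eventually_elim
    case (elim \<omega>)
    then show ?case by (cases "u \<omega>") (simp_all add: stable_integral_def)
  qed
qed

end

text \<open>
  The density of the lifted measures can be taken real valued, since the measure lifted from \<open>\<nu>\<close> is finite.
\<close>

theorem theorem5p7:
  fixes M :: "'w measure" and X :: "('w \<Rightarrow> 'e) set" and \<X> :: "('w \<rightharpoonup> 'e) set set"
    and \<mu> \<nu> :: "('w \<rightharpoonup> 'e) set \<Rightarrow> 'w \<Rightarrow> ennreal"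
  assumes "prob_space M" and "complete_measure M"
    and "stable_measurable_space M X \<X>"
    and "stable_prob_measure M X \<X> \<mu>"
    and "stable_prob_measure M X \<X> \<nu>"
    and "stable_abs_continuous M \<X> \<nu> \<mu>"
  shows "\<exists>f :: ('w \<Rightarrow> 'e) \<Rightarrow> 'w \<Rightarrow> real. stable_integrable M X \<X> \<mu> f \<and>
    (\<forall>V\<in>stable_subsets M X. \<forall>A\<in>sets M. cond M V A \<in> \<X> \<longrightarrow>
       stable_integrable M X \<X> \<mu> (\<lambda>x \<omega>. stable_indicator M V A x \<omega> * f x \<omega>) \<and>
       (AE \<omega> in M. enn2ereal (\<nu> (cond M V A) \<omega>) =
          ereal (stable_integral M X \<X> \<mu> (\<lambda>x \<omega>. stable_indicator M V A x \<omega> * f x \<omega>) \<omega>)))"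
proof -
  interpret prob_space M by fact
  interpret mu: stable_prob M X \<X> \<mu>
    using assms by unfold_locales (simp_all add: stable_measurable_space_def)
  interpret nu: stable_prob M X \<X> \<nu>
    using assms by unfold_locales (simp_all add: stable_measurable_space_def)
  interpret N: finite_measure mu.N by (rule mu.finite_measure_lift)
  have ac: "absolutely_continuous mu.N nu.N"
    unfolding absolutely_continuous_def
  proof
    fix E assume "E \<in> null_sets mu.N"
    then have E: "E \<in> lift_sets M X \<X>" and "emeasure mu.N E = 0"
      using null_setsD2[of E mu.N] by (simp_all add: null_setsD1)
    then have "(\<integral>\<^sup>+\<omega>. mu.\<mu>' E \<omega> \<partial>M) = 0" using mu.emeasure_lift[OF E] by simp
    then have "AE \<omega> in M. mu.\<mu>' E \<omega> = 0"
      using mu.mu_measurable[OF E] by (simp add: nn_integral_0_iff_AE)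
    then have "AE \<omega> in M. nu.\<mu>' E \<omega> = 0"
      using assms(6) mu.lift_setsD(2)[OF E] unfolding stable_abs_continuous_def by blast
    then have "(\<integral>\<^sup>+\<omega>. nu.\<mu>' E \<omega> \<partial>M) = 0"
      using nu.mu_measurable[OF E] by (simp add: nn_integral_0_iff_AE)
    then show "E \<in> null_sets nu.N" using E nu.emeasure_lift[OF E] by (auto intro: null_setsI)
  qed
  have sets: "sets nu.N = sets mu.N" by simp
  obtain D where D [measurable]: "D \<in> borel_measurable mu.N"
    and RN: "AE p in mu.N. RN_deriv mu.N nu.N p = ennreal (D p)" and D_nonneg: "\<And>p. 0 \<le> D p"
    by (rule N.real_RN_deriv[OF nu.finite_measure_lift ac sets]) (rule that)
  have "nu.N = density mu.N (RN_deriv mu.N nu.N)" by (rule N.density_RN_deriv[OF ac sets, symmetric])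
  also have "\<dots> = density mu.N D"
    using RN by (intro density_cong) (auto intro: borel_measurable_RN_deriv)
  finally have density: "nu.N = density mu.N D" .
  \<comment> \<open>Used with \<open>E = X \<times> \<Omega>\<close> for the integrability of the density itself, and with the local set of \<open>V|A\<close>.\<close>
  have key: "stable_integrable M X \<X> \<mu> g \<and>
      (AE \<omega> in M. enn2ereal (nu.\<mu>' E \<omega>) = ereal (stable_integral M X \<X> \<mu> g \<omega>))"
    if E: "E \<in> lift_sets M X \<X>" and nonneg: "\<And>x \<omega>. 0 \<le> g x \<omega>"
      and g: "\<And>x \<omega>. x \<in> X \<Longrightarrow> \<omega> \<in> space M \<Longrightarrow> g x \<omega> = indicator E (x, \<omega>) * D (x, \<omega>)" for g E
  proof -
    have EN [measurable]: "E \<in> sets mu.N" using E by simp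
    have g': "g (fst p) (snd p) = indicator E p * D p" if "p \<in> space mu.N" for p
      using g[of "fst p" "snd p"] that by auto
    have "(\<lambda>p. indicator E p * D p) \<in> borel_measurable mu.N" by measurable
    then have meas: "(\<lambda>p. g (fst p) (snd p)) \<in> borel_measurable mu.N"
      using measurable_cong[of mu.N "\<lambda>p. g (fst p) (snd p)" "\<lambda>p. indicator E p * D p" borel] g'
      by simp
    have fin: "AE \<omega> in M. nu.\<mu>' E \<omega> < \<infinity>"
      using nu.mu_le_one[OF E] by eventually_elim (auto intro: le_less_trans)
    have int: "(\<integral>\<^sup>+p. ennreal (g (fst p) (snd p)) * indicator A (snd p) \<partial>mu.N) =
        (\<integral>\<^sup>+\<omega>. nu.\<mu>' E \<omega> * indicator A \<omega> \<partial>M)" if A: "A \<in> sets M" for A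
    proof -
      have A': "X \<times> A \<in> sets mu.N" using mu.product_in_lift[OF A] by simp
      then have EA: "E \<inter> X \<times> A \<in> sets mu.N" by measurable
      then have EA': "E \<inter> X \<times> A \<in> lift_sets M X \<X>" by simp
      have "(\<integral>\<^sup>+p. ennreal (g (fst p) (snd p)) * indicator A (snd p) \<partial>mu.N) =
          (\<integral>\<^sup>+p. ennreal (D p) * indicator (E \<inter> X \<times> A) p \<partial>mu.N)"
        by (rule nn_integral_cong) (auto simp: g' indicator_def)
      also have "\<dots> = emeasure (density mu.N D) (E \<inter> X \<times> A)"
        using EA by (subst emeasure_density) auto
      also have "\<dots> = (\<integral>\<^sup>+\<omega>. nu.\<mu>' (E \<inter> X \<times> A) \<omega> \<partial>M)"
        unfolding density[symmetric] by (rule nu.emeasure_lift[OF EA'])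
      also have "\<dots> = (\<integral>\<^sup>+\<omega>. nu.\<mu>' E \<omega> * indicator A \<omega> \<partial>M)"
        by (rule nn_integral_cong_AE[OF nu.mu_restrict[OF E A]])
      finally show ?thesis .
    qed
    from mu.stable_integral_lift[OF assms(2) meas nonneg nu.mu_measurable[OF E] fin int]
    show ?thesis by (rule conjI)
  qed
  show ?thesis
  proof (rule exI[of _ "\<lambda>x \<omega>. D (x, \<omega>)"], intro conjI ballI impI)
    show "stable_integrable M X \<X> \<mu> (\<lambda>x \<omega>. D (x, \<omega>))"
      by (rule conjunct1[OF key[OF mu.product_in_lift[OF sets.top]]]) (simp_all add: D_nonneg)
    fix V A assume V: "V \<in> stable_subsets M X" and A: "A \<in> sets M" and "cond M V A \<in> \<X>"
    then have ind: "mu.indicator_set V A \<in> lift_sets M X \<X>" by (rule mu.indicator_set_in_lift)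
    have ind_nonneg: "0 \<le> stable_indicator M V A x \<omega>" for x \<omega> by (simp add: stable_indicator_def)
    from ind have *: "stable_integrable M X \<X> \<mu> (\<lambda>x \<omega>. stable_indicator M V A x \<omega> * D (x, \<omega>)) \<and>
      (AE \<omega> in M. enn2ereal (nu.\<mu>' (mu.indicator_set V A) \<omega>) = ereal (stable_integral M X \<X> \<mu>
        (\<lambda>x \<omega>. stable_indicator M V A x \<omega> * D (x, \<omega>)) \<omega>))"
      by (rule key) (simp_all add: mu.stable_indicator_eq D_nonneg ind_nonneg)
    then show "stable_integrable M X \<X> \<mu> (\<lambda>x \<omega>. stable_indicator M V A x \<omega> * D (x, \<omega>))" ..
    show "AE \<omega> in M. enn2ereal (\<nu> (cond M V A) \<omega>) = ereal (stable_integral M X \<X> \<mu>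
        (\<lambda>x \<omega>. stable_indicator M V A x \<omega> * D (x, \<omega>)) \<omega>)"
      using * unfolding mu.cond_eq_indicator_set[OF V A] ..
  qed
qed

end
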